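(* Let $k$ be an algebraically closed uncountable field of characteristic $0$, let $R$ be a graded Cohen--Macaulay $k$-algebra with graded Noetherian normalization $S$, and suppose that $R$ is of graded countable Cohen--Macaulay representation type. Then for each finite dimensional graded $k$-vector space $V$ there are only finitely many isomorphism classes of graded maximal Cohen--Macaulay $R$-modules which are isomorphic to $S\otimes_k V$ as graded $S$-modules. In other words, there are only finitely many isomorphism classes of graded maximal Cohen--Macaulay $R$-modules with any fixed Hilbert series.
   Context: $R=\bigoplus_{i\ge 0}R_i$ is a commutative positively graded finitely generated $k$-algebra with $R_0=k$. A graded Noetherian normalization of $R$ is a graded polynomial subalgebra $S=k[y_1,\dots,y_n]\subseteq R$, with $n=\dim R$ and the $y_j$ homogeneous of positive degree, such that $R$ is a finitely generated graded $S$-module. A finitely generated $\mathbb{Z}$-graded $R$-module $M$ is (graded) maximal Cohen--Macaulay if it is graded free as an $S$-module, i.e. $M\cong\bigoplus_{i=1}^m S(l_i)$; equivalently $M\cong S\otimes_k V$ as graded $S$-modules for some finite dimensional graded $k$-vector space $V$. $R$ is Cohen--Macaulay if it is maximal Cohen--Macaulay as a module over itself. The shift $M(i)$ is defined by $M(i)_n=M_{n+i}$. Isomorphisms of graded modules are homogeneous of degree $0$. The Hilbert series of $M$ is $\sum_{i\in\mathbb{Z}}(\dim_k M_i)t^i$. $R$ is of graded countable Cohen--Macaulay representation type if there are only countably many (possibly finitely many) isomorphism classes of indecomposable graded maximal Cohen--Macaulay $R$-modules up to shift. *)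

theory Defs
  imports
    "Jordan_Normal_Form.Missing_VectorSpace"
    "HOL-Algebra.Algebra"
    "HOL-Algebra.Algebraic_Closure_Type"
    "HOL-Library.Poly_Mapping"
    "HOL-Library.Extended_Nat"
    "HOL-Library.Countable_Set"
begin

text \<open>
  The field \<open>k\<close> and the ring \<open>R\<close> are types \<open>'k\<close> and \<open>'r\<close>; the \<open>k\<close>-algebra structure is a ring
  homomorphism \<open>\<iota> :: 'k \<Rightarrow> 'r\<close>. Modules are HOL-Algebra modules with carrier, over the ring records
  \<open>ring_of_type_algebra\<close> or their subrings. (The fields \<open>mult\<close> and \<open>one\<close> of a module record
  carry no information.)
\<close>

record ('a, 'm) gmodule = "('a, 'm) module" +
  hcomp :: "int \<Rightarrow> 'm set"

text \<open>\<open>M\<close> is the internal direct sum of the family \<open>c\<close>.\<close>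

definition is_grading :: "('m, 'z) ring_scheme \<Rightarrow> (int \<Rightarrow> 'm set) \<Rightarrow> bool" where
  "is_grading M c \<longleftrightarrow>
     (\<forall>i. subgroup (c i) (add_monoid M)) \<and>
     (\<forall>x\<in>carrier M. \<exists>!f. (\<forall>i. f i \<in> c i) \<and> finite {i. f i \<noteq> \<zero>\<^bsub>M\<^esub>} \<and>
        x = (\<Oplus>\<^bsub>M\<^esub>i\<in>{i. f i \<noteq> \<zero>\<^bsub>M\<^esub>}. f i))"

definition graded_module ::
    "('a, 'z) ring_scheme \<Rightarrow> (int \<Rightarrow> 'a set) \<Rightarrow> ('a, 'm) gmodule \<Rightarrow> bool" where
  "graded_module A Ag M \<longleftrightarrow>
     Module.module A M \<and> is_grading M (hcomp M) \<and>
     (\<forall>i j. \<forall>a\<in>Ag i. \<forall>x\<in>hcomp M j. a \<odot>\<^bsub>M\<^esub> x \<in> hcomp M (i + j))"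

definition finitely_generated :: "('a, 'z) ring_scheme \<Rightarrow> ('a, 'm) gmodule \<Rightarrow> bool" where
  "finitely_generated A M \<longleftrightarrow>
     (\<exists>B. finite B \<and> B \<subseteq> carrier M \<and> LinearCombinations.module.span A M B = carrier M)"

definition graded_iso ::
    "('a, 'z) ring_scheme \<Rightarrow> ('a, 'm) gmodule \<Rightarrow> ('a, 'n) gmodule \<Rightarrow> bool" where
  "graded_iso A M N \<longleftrightarrow>
     (\<exists>f\<in>LinearCombinations.module_hom A M N. bij_betw f (carrier M) (carrier N) \<and>
        (\<forall>i. f ` hcomp M i = hcomp N i))"

definition shift :: "('a, 'm) gmodule \<Rightarrow> int \<Rightarrow> ('a, 'm) gmodule" where
  "shift M i = M\<lparr>hcomp := (\<lambda>n. hcomp M (n + i))\<rparr>"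

definition graded_submodule ::
    "'m set \<Rightarrow> ('a, 'z) ring_scheme \<Rightarrow> ('a, 'm) gmodule \<Rightarrow> bool" where
  "graded_submodule N A M \<longleftrightarrow>
     Module.submodule N A M \<and> is_grading (M\<lparr>carrier := N\<rparr>) (\<lambda>i. N \<inter> hcomp M i)"

definition graded_indecomposable :: "('a, 'z) ring_scheme \<Rightarrow> ('a, 'm) gmodule \<Rightarrow> bool" where
  "graded_indecomposable A M \<longleftrightarrow>
     carrier M \<noteq> {\<zero>\<^bsub>M\<^esub>} \<and>
     (\<forall>N P. graded_submodule N A M \<and> graded_submodule P A M \<and>
        N \<inter> P = {\<zero>\<^bsub>M\<^esub>} \<and> N <+>\<^bsub>M\<^esub> P = carrier M \<longrightarrow>
        N = {\<zero>\<^bsub>M\<^esub>} \<or> P = {\<zero>\<^bsub>M\<^esub>})"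

definition iso_classes :: "('x \<Rightarrow> 'x \<Rightarrow> bool) \<Rightarrow> 'x set \<Rightarrow> 'x set set" where
  "iso_classes E A = A // {(x, y). x \<in> A \<and> y \<in> A \<and> E x y}"


text \<open>
  Elements of \<open>(nat \<Rightarrow>\<^sub>0 nat) \<Rightarrow>\<^sub>0 'k\<close> are polynomials over \<open>'k\<close> in the variables \<open>X\<^sub>0, X\<^sub>1, \<dots>\<close>, where an
  exponent vector \<open>m\<close> stands for the monomial \<open>\<Prod>j. X\<^sub>j ^ lookup m j\<close>.
\<close>

definition polys :: "nat \<Rightarrow> ((nat \<Rightarrow>\<^sub>0 nat) \<Rightarrow>\<^sub>0 'k::field) set" where
  "polys n = {p. \<forall>m\<in>Poly_Mapping.keys p. Poly_Mapping.keys m \<subseteq> {..<n}}"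

definition poly_eval ::
    "('k::field \<Rightarrow> 'r::comm_ring_1) \<Rightarrow> (nat \<Rightarrow> 'r) \<Rightarrow> ((nat \<Rightarrow>\<^sub>0 nat) \<Rightarrow>\<^sub>0 'k) \<Rightarrow> 'r" where
  "poly_eval \<iota> y p =
     (\<Sum>m\<in>Poly_Mapping.keys p.
        \<iota> (Poly_Mapping.lookup p m) * (\<Prod>j\<in>Poly_Mapping.keys m. y j ^ Poly_Mapping.lookup m j))"

text \<open>
  The grading is indexed by \<open>int\<close>, with vanishing components in negative degrees. The condition
  \<open>R\<^sub>0 = k\<close> becomes \<open>Rg 0 = range \<iota>\<close>; \<open>\<iota>\<close> is injective, being a homomorphism from a field to a
  nonzero ring.
\<close>

definition graded_algebra ::
    "('k::field \<Rightarrow> 'r::comm_ring_1) \<Rightarrow> (int \<Rightarrow> 'r set) \<Rightarrow> bool" where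
  "graded_algebra \<iota> Rg \<longleftrightarrow>
     \<iota> \<in> ring_hom ring_of_type_algebra ring_of_type_algebra \<and>
     is_grading (ring_of_type_algebra :: 'r ring) Rg \<and>
     (\<forall>i j. \<forall>a\<in>Rg i. \<forall>b\<in>Rg j. a * b \<in> Rg (i + j)) \<and>
     (\<forall>i<0. Rg i = {0}) \<and>
     Rg 0 = range \<iota> \<and>
     (\<exists>n x. poly_eval \<iota> x ` polys n = UNIV)"

definition krull_dim :: "('a, 'z) ring_scheme \<Rightarrow> enat" where
  "krull_dim A = Sup {enat d | d. \<exists>P. (\<forall>i\<le>d. primeideal (P i) A) \<and> (\<forall>i<d. P i \<subset> P (Suc i))}"

abbreviation subring_of :: "'r::comm_ring_1 set \<Rightarrow> 'r ring" where
  "subring_of S \<equiv> ring_of_type_algebra\<lparr>carrier := S\<rparr>"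

text \<open>\<open>R\<close> as a graded module over itself or, by restriction, over a graded subring.\<close>

definition self_module :: "(int \<Rightarrow> 'r set) \<Rightarrow> ('r::comm_ring_1, 'r) gmodule" where
  "self_module Rg =
     \<lparr>carrier = UNIV, monoid.mult = (*), one = 1, ring.zero = 0, add = (+),
      module.smult = (*), hcomp = Rg\<rparr>"

definition graded_noether_normalization ::
    "('k::field \<Rightarrow> 'r::comm_ring_1) \<Rightarrow> (int \<Rightarrow> 'r set) \<Rightarrow> 'r set \<Rightarrow> bool" where
  "graded_noether_normalization \<iota> Rg S \<longleftrightarrow>
     (\<exists>n y. krull_dim (ring_of_type_algebra :: 'r ring) = enat n \<and>
        (\<forall>j<n. \<exists>d>0. y j \<in> Rg d) \<and>
        inj_on (poly_eval \<iota> y) (polys n) \<and>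
        S = poly_eval \<iota> y ` polys n) \<and>
     finitely_generated (subring_of S) (self_module Rg)"

text \<open>\<open>\<Oplus>\<^bsub>i<m\<^esub> S(l\<^sub>i)\<close>, where \<open>S\<close> has the grading induced from \<open>R\<close>.\<close>

definition graded_free_module ::
    "(int \<Rightarrow> 'r set) \<Rightarrow> 'r set \<Rightarrow> nat \<Rightarrow> (nat \<Rightarrow> int) \<Rightarrow> ('r::comm_ring_1, nat \<Rightarrow> 'r) gmodule" where
  "graded_free_module Rg S m l =
     Module.module.extend (ring.func_space (subring_of S) {..<m})
       (gmodule.fields (\<lambda>j. {f \<in> {..<m} \<rightarrow>\<^sub>E S. \<forall>i<m. f i \<in> Rg (j + l i)}))"

definition graded_mcm ::
    "(int \<Rightarrow> 'r set) \<Rightarrow> 'r set \<Rightarrow> ('r::comm_ring_1, 'm) gmodule \<Rightarrow> bool" where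
  "graded_mcm Rg S M \<longleftrightarrow>
     graded_module ring_of_type_algebra Rg M \<and>
     finitely_generated ring_of_type_algebra M \<and>
     (\<exists>m l. graded_iso (subring_of S) M (graded_free_module Rg S m l))"

text \<open>
  Every finitely generated \<open>R\<close>-module is isomorphic to one with carrier in \<open>nat \<Rightarrow> 'r\<close> (choose coset
  representatives in a quotient of \<open>R\<^sup>n\<close>), so restricting to this carrier type loses no isomorphism
  class.
\<close>

definition graded_countable_CM_type :: "(int \<Rightarrow> 'r::comm_ring_1 set) \<Rightarrow> 'r set \<Rightarrow> bool" where
  "graded_countable_CM_type Rg S \<longleftrightarrow>
     countable (iso_classes (\<lambda>M N. \<exists>i. graded_iso ring_of_type_algebra M (shift N i))
       {M :: ('r, nat \<Rightarrow> 'r) gmodule.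
          graded_mcm Rg S M \<and> graded_indecomposable ring_of_type_algebra M})"

definition findim_graded_vectorspace :: "('k::field, 'v) gmodule \<Rightarrow> bool" where
  "findim_graded_vectorspace V \<longleftrightarrow>
     graded_module ring_of_type_algebra (\<lambda>i. if i = 0 then UNIV else {0}) V \<and>
     vectorspace.fin_dim ring_of_type_algebra V"

text \<open>
  \<open>S \<otimes>\<^sub>k V\<close> is the quotient of the free abelian group on \<open>S \<times> V\<close> by the usual bilinearity relations;
  the degree-\<open>j\<close> component is generated by the pure tensors \<open>s \<otimes> v\<close> of homogeneous elements with
  \<open>deg s + deg v = j\<close>.
\<close>

definition tensor_relations ::
    "('k::field \<Rightarrow> 'r::comm_ring_1) \<Rightarrow> 'r set \<Rightarrow> ('k, 'v) gmodule \<Rightarrow> ('r \<times> 'v \<Rightarrow>\<^sub>0 int) set" where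
  "tensor_relations \<iota> S V =
     {frag_of (s + t, v) - frag_of (s, v) - frag_of (t, v) | s t v.
        s \<in> S \<and> t \<in> S \<and> v \<in> carrier V} \<union>
     {frag_of (s, v \<oplus>\<^bsub>V\<^esub> w) - frag_of (s, v) - frag_of (s, w) | s v w.
        s \<in> S \<and> v \<in> carrier V \<and> w \<in> carrier V} \<union>
     {frag_of (s * \<iota> c, v) - frag_of (s, c \<odot>\<^bsub>V\<^esub> v) | s c v.
        s \<in> S \<and> v \<in> carrier V}"

definition tensor_module ::
    "('k::field \<Rightarrow> 'r::comm_ring_1) \<Rightarrow> (int \<Rightarrow> 'r set) \<Rightarrow> 'r set \<Rightarrow> ('k, 'v) gmodule \<Rightarrow>
     ('r, ('r \<times> 'v \<Rightarrow>\<^sub>0 int) set) gmodule" where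
  "tensor_module \<iota> Rg S V =
     (let G = free_Abelian_group (S \<times> carrier V);
          H = generate G (tensor_relations \<iota> S V)
      in \<lparr>carrier = carrier (G Mod H),
          monoid.mult = (\<lambda>C D. H),
          one = H,
          ring.zero = \<one>\<^bsub>G Mod H\<^esub>,
          add = (\<otimes>\<^bsub>G Mod H\<^esub>),
          module.smult = (\<lambda>a C. \<Union>x\<in>C. H #>\<^bsub>G\<^esub> frag_extend (\<lambda>(s, v). frag_of (a * s, v)) x),
          hcomp = (\<lambda>j. generate (G Mod H)
            {H #>\<^bsub>G\<^esub> frag_of (s, v) | s v a b.
               s \<in> S \<inter> Rg a \<and> v \<in> hcomp V b \<and> a + b = j})\<rparr>)"

text \<open>
  The Hilbert series \<open>\<Sum>\<^sub>i (dim\<^sub>k M\<^sub>i) t\<^sup>i\<close>, given by its coefficients; \<open>k\<close> acts on \<open>M\<^sub>i\<close> through \<open>\<iota>\<close>.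
\<close>

definition hilbert_series ::
    "('k::field \<Rightarrow> 'r::comm_ring_1) \<Rightarrow> ('r, 'm) gmodule \<Rightarrow> int \<Rightarrow> nat" where
  "hilbert_series \<iota> M i =
     vectorspace.dim (ring_of_type_algebra :: 'k ring)
       \<lparr>carrier = hcomp M i, monoid.mult = monoid.mult M, one = \<one>\<^bsub>M\<^esub>,
        ring.zero = \<zero>\<^bsub>M\<^esub>, add = add M, module.smult = (\<lambda>c x. \<iota> c \<odot>\<^bsub>M\<^esub> x)\<rparr>"

end

(*
  A graded maximal Cohen-Macaulay module that is S-isomorphic to F = S(l_1) + ... + S(l_m) is an
  R-module structure on F. As R is itself graded free over S, such a structure consists of finitely
  many matrices with entries in finite dimensional homogeneous components of S, subject to polynomial
  equations, so the structures are the zeros X of polynomials on a k-vector space of finite dimension.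
  Isomorphism with a fixed structure x means: the linear system phi y = x phi in a degree 0
  endomorphism phi of F, whose coefficients are polynomials in y, has a solution with det phi /= 0.
  Splitting into indecomposables shows that X is covered by countably many isomorphism classes O_n.

  If no finite number of the O_n covered X, some ultrafilter on X would avoid every O_n. The polynomials
  vanishing almost everywhere form a prime P, and Gaussian elimination modulo P yields mu_n outside P
  such that no zero y of P with mu_n(y) /= 0 lies in O_n. As k is uncountable, there is a zero y of P
  with mu_n(y) /= 0 for all n, hence a point of X outside all O_n, a contradiction. Neither Noetherian
  induction nor Chevalley's theorem on constructible images is needed.

  The module S (x) V enters only through transitivity of isomorphism, and the Hilbert series of F
  determines the multiset of the shifts l_i, lowest degree first.
*)

theory Submission
  imports Defs "Jordan_Normal_Form.Determinant" "HOL-Library.Function_Algebras"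
begin

section \<open>Countable covers of zero sets over an uncountable field\<close>

text \<open>An isomorphism class of structures is in general not closed: it is the projection of a
  set given by linear equations and one determinant condition. The determinant of a degree 0
  endomorphism lies in \<open>R_0 = k\<close>, so nonzero already means invertible, and a single
  inequality in k tests for isomorphism. The zero set X may be reducible; the ultrafilter singles
  out an irreducible closed set V(P) on which every class is negligible. The linear system is solved
  over the function field of V(P) with denominators cleared, and \<open>mu_n\<close> is the product
  of the pivots. The kernel vectors found solve the system almost everywhere, so a combination with
  constant coefficients and nonzero determinant modulo P would place almost every point in O_n;
  hence all these determinants lie in P. At a zero of P where the pivots survive, every solution is
  such a combination, so O_n is missed. The countable cover requires summands to be graded free over
  S again, and the integer shift to be recorded, because the hypothesis counts modules only up to
  shift.\<close>

inductive_set polyfun :: "'i set \<Rightarrow> (('i \<Rightarrow> 'k::comm_ring_1) \<Rightarrow> 'k) set" for J where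
  polyfun_const: "(\<lambda>_. c) \<in> polyfun J"
| polyfun_coord: "i \<in> J \<Longrightarrow> (\<lambda>x. x i) \<in> polyfun J"
| polyfun_add: "f \<in> polyfun J \<Longrightarrow> g \<in> polyfun J \<Longrightarrow> (\<lambda>x. f x + g x) \<in> polyfun J"
| polyfun_mult: "f \<in> polyfun J \<Longrightarrow> g \<in> polyfun J \<Longrightarrow> (\<lambda>x. f x * g x) \<in> polyfun J"

lemma polyfun_uminus: "f \<in> polyfun J \<Longrightarrow> (\<lambda>x. - f x) \<in> polyfun J"
  using polyfun_mult[OF polyfun_const[of "-1"], of f J] by simp

lemma polyfun_diff: "f \<in> polyfun J \<Longrightarrow> g \<in> polyfun J \<Longrightarrow> (\<lambda>x. f x - g x) \<in> polyfun J"
  using polyfun_add[OF _ polyfun_uminus] by fastforce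

lemma polyfun_sum: "(\<And>a. a \<in> A \<Longrightarrow> f a \<in> polyfun J) \<Longrightarrow> (\<lambda>x. \<Sum>a\<in>A. f a x) \<in> polyfun J"
  by (induction A rule: infinite_finite_induct) (auto intro: polyfun_const polyfun_add)

lemma polyfun_prod: "(\<And>a. a \<in> A \<Longrightarrow> f a \<in> polyfun J) \<Longrightarrow> (\<lambda>x. \<Prod>a\<in>A. f a x) \<in> polyfun J"
  by (induction A rule: infinite_finite_induct) (auto intro: polyfun_const polyfun_mult)

text \<open>A monomial is a list of variables with repetitions, so multiplication is concatenation
  and \<open>lists J\<close> is countable whenever J is.\<close>

definition monom_eval :: "'i list \<Rightarrow> ('i \<Rightarrow> 'k::comm_ring_1) \<Rightarrow> 'k" where
  "monom_eval t x = prod_list (map x t)"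

text \<open>Sums of scaled monomials are closed under the four formation rules. Coefficients and
  monomials are kept apart on purpose: over a countable J there are only countably many lists of
  monomials, while the coefficients may range over an uncountable field.\<close>

lemma polyfun_monomials:
  assumes "f \<in> polyfun J"
  shows "\<exists>ps. set (map snd ps) \<subseteq> lists J \<and> f = (\<lambda>x. \<Sum>(c, t)\<leftarrow>ps. c * monom_eval t x)"
  using assms
proof (induction rule: polyfun.induct)
  case (polyfun_const c)
  then show ?case by (intro exI[of _ "[(c, [])]"]) (auto simp: monom_eval_def)
next
  case (polyfun_coord i)
  then show ?case by (intro exI[of _ "[(1, [i])]"]) (auto simp: monom_eval_def)
next
  case (polyfun_add f g)
  then obtain ps qs where "set (map snd ps) \<subseteq> lists J" "f = (\<lambda>x. \<Sum>(c, t)\<leftarrow>ps. c * monom_eval t x)"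
    "set (map snd qs) \<subseteq> lists J" "g = (\<lambda>x. \<Sum>(c, t)\<leftarrow>qs. c * monom_eval t x)" by metis
  then show ?case by (intro exI[of _ "ps @ qs"]) auto
next
  case (polyfun_mult f g)
  then obtain ps qs where ps: "set (map snd ps) \<subseteq> lists J" "f = (\<lambda>x. \<Sum>(c, t)\<leftarrow>ps. c * monom_eval t x)"
    and qs: "set (map snd qs) \<subseteq> lists J" "g = (\<lambda>x. \<Sum>(c, t)\<leftarrow>qs. c * monom_eval t x)" by metis
  define rs where "rs = concat (map (\<lambda>(c, s). map (\<lambda>(d, t). (c * d, s @ t)) qs) ps)"
  have one: "(\<Sum>(c, t)\<leftarrow>map (\<lambda>(d, t). (c * d, s @ t)) qs. c * monom_eval t x) =
      c * monom_eval s x * (\<Sum>(c, t)\<leftarrow>qs. c * monom_eval t x)" for c s x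
    by (induction qs) (auto simp: monom_eval_def algebra_simps)
  have "(\<Sum>(c, t)\<leftarrow>rs. c * monom_eval t x) = f x * g x" for x
    unfolding rs_def ps(2) qs(2)
    by (induction ps) (auto simp: one algebra_simps simp del: map_map)
  moreover have "set (map snd rs) \<subseteq> lists J"
    using ps(1) qs(1) unfolding rs_def by fastforce
  ultimately show ?case by (intro exI[of _ rs]) auto
qed

text \<open>Gaussian elimination on the equations R. If some coefficient in row j is nonzero, its
  unknown a0 is eliminated: the reduced system has one equation and one unknown less, so the strict
  inequality of cardinalities persists.\<close>

lemma nontrivial_kernel:
  fixes C :: "'a \<Rightarrow> 'j \<Rightarrow> 'k::field"
  assumes "finite R" "finite A" "card R < card A"
  shows "\<exists>c. (\<exists>a\<in>A. c a \<noteq> 0) \<and> (\<forall>j\<in>R. (\<Sum>a\<in>A. c a * C a j) = 0)"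
  using assms
proof (induction R arbitrary: A C rule: finite_induct)
  case empty
  then have "A \<noteq> {}" by auto
  then show ?case by (intro exI[of _ "\<lambda>_. 1"]) auto
next
  case (insert j R)
  show ?case
  proof (cases "\<forall>a\<in>A. C a j = 0")
    case True
    then show ?thesis using insert.IH[of A C] insert.prems insert.hyps by (auto simp: card_insert_if)
  next
    case False
    then obtain a0 where a0: "a0 \<in> A" "C a0 j \<noteq> 0" by auto
    define A' where "A' = A - {a0}"
    have A: "A = insert a0 A'" "a0 \<notin> A'" "finite A'" using a0 insert.prems by (auto simp: A'_def)
    have "card R < card A'" using insert.prems insert.hyps A by auto
    then obtain c' where c': "\<exists>a\<in>A'. c' a \<noteq> 0"
      "\<And>i. i \<in> R \<Longrightarrow> (\<Sum>a\<in>A'. c' a * (C a i - C a j / C a0 j * C a0 i)) = 0"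
      using insert.IH[of A' "\<lambda>a i. C a i - C a j / C a0 j * C a0 i"] A(3) by auto
    \<comment> \<open>The eliminated unknown takes the value that row j forces; the multiples
      subtracted in the reduced coefficients then account for a0 in the other rows.\<close>
    define z where "z = - (\<Sum>a\<in>A'. c' a * C a j) / C a0 j"
    define c where "c = c'(a0 := z)"
    have sm: "(\<Sum>a\<in>A. c a * C a i) = z * C a0 i + (\<Sum>a\<in>A'. c' a * C a i)" for i
    proof -
      have "(\<Sum>a\<in>A'. c a * C a i) = (\<Sum>a\<in>A'. c' a * C a i)"
        using A(2) by (intro sum.cong) (auto simp: c_def)
      then show ?thesis using A by (simp add: c_def)
    qed
    have "(\<Sum>a\<in>A. c a * C a j) = 0" unfolding sm z_def using a0 by simp
    moreover have "(\<Sum>a\<in>A. c a * C a i) = 0" if "i \<in> R" for i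
    proof -
      have "(\<Sum>a\<in>A'. c' a * (C a i - C a j / C a0 j * C a0 i)) =
          (\<Sum>a\<in>A'. c' a * C a i) - (\<Sum>a\<in>A'. c' a * C a j) / C a0 j * C a0 i"
        by (simp add: algebra_simps sum_subtractf sum_distrib_left sum_divide_distrib)
      then show ?thesis using c'(2)[OF that] unfolding sm z_def by (simp add: algebra_simps)
    qed
    moreover have "\<exists>a\<in>A. c a \<noteq> 0" using c'(1) A by (auto simp: c_def)
    ultimately show ?thesis by auto
  qed
qed

section \<open>Prime ideals of polynomial functions\<close>

definition poly_ideal :: "'i set \<Rightarrow> (('i \<Rightarrow> 'k::comm_ring_1) \<Rightarrow> 'k) set \<Rightarrow> bool" where
  "poly_ideal J P \<longleftrightarrow> P \<subseteq> polyfun J \<and> (\<lambda>_. 0) \<in> P \<and>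
     (\<forall>f\<in>P. \<forall>g\<in>P. (\<lambda>x. f x + g x) \<in> P) \<and> (\<forall>f\<in>P. \<forall>g\<in>polyfun J. (\<lambda>x. f x * g x) \<in> P)"

definition poly_prime :: "'i set \<Rightarrow> (('i \<Rightarrow> 'k::comm_ring_1) \<Rightarrow> 'k) set \<Rightarrow> bool" where
  "poly_prime J P \<longleftrightarrow> poly_ideal J P \<and> (\<lambda>_. 1) \<notin> P \<and>
     (\<forall>f\<in>polyfun J. \<forall>g\<in>polyfun J. (\<lambda>x. f x * g x) \<in> P \<longrightarrow> f \<in> P \<or> g \<in> P)"

lemma poly_idealD:
  assumes "poly_ideal J P"
  shows "P \<subseteq> polyfun J" "(\<lambda>_. 0) \<in> P" "f \<in> P \<Longrightarrow> g \<in> P \<Longrightarrow> (\<lambda>x. f x + g x) \<in> P"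
    "f \<in> P \<Longrightarrow> h \<in> polyfun J \<Longrightarrow> (\<lambda>x. f x * h x) \<in> P"
  using assms by (simp_all add: poly_ideal_def)

lemma poly_idealI:
  assumes "P \<subseteq> polyfun J" "(\<lambda>_. 0) \<in> P" "\<And>f g. f \<in> P \<Longrightarrow> g \<in> P \<Longrightarrow> (\<lambda>x. f x + g x) \<in> P"
    "\<And>f h. f \<in> P \<Longrightarrow> h \<in> polyfun J \<Longrightarrow> (\<lambda>x. f x * h x) \<in> P"
  shows "poly_ideal J P"
  using assms by (simp add: poly_ideal_def)

lemma poly_primeD:
  assumes "poly_prime J P"
  shows "poly_ideal J P" "(\<lambda>_. 1) \<notin> P"
    "f \<in> polyfun J \<Longrightarrow> g \<in> polyfun J \<Longrightarrow> (\<lambda>x. f x * g x) \<in> P \<Longrightarrow> f \<in> P \<or> g \<in> P"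
  using assms by (simp_all add: poly_prime_def)

lemma poly_ideal_sum:
  assumes "poly_ideal J P" "\<And>a. a \<in> A \<Longrightarrow> f a \<in> P"
  shows "(\<lambda>x. \<Sum>a\<in>A. f a x) \<in> P"
  using assms(2)
proof (induction A rule: infinite_finite_induct)
  case (insert a A)
  then have "(\<lambda>x. f a x + (\<Sum>a\<in>A. f a x)) \<in> P" using assms(1) by (simp add: poly_ideal_def)
  then show ?case using insert.hyps by simp
qed (use assms(1) in \<open>simp_all add: poly_ideal_def\<close>)

lemma poly_ideal_diff:
  assumes "poly_ideal J P" "f \<in> P" "g \<in> P"
  shows "(\<lambda>x. f x - g x) \<in> P"
proof -
  have "(\<lambda>x. g x * - 1) \<in> P"
    by (rule poly_idealD(4)[OF assms(1,3) polyfun_const])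
  then have "(\<lambda>x. f x + g x * - 1) \<in> P" by (rule poly_idealD(3)[OF assms(1,2)])
  then show ?thesis by simp
qed

text \<open>Zorn's lemma and the classical fact that an ideal maximal among those disjoint from a
  multiplicative set is prime. The final clause retains the maximality itself: every f outside P
  becomes invertible modulo P once the elements of Sg are inverted, so P corresponds to a maximal
  ideal of the localization at Sg.\<close>

lemma poly_ideal_max_disjoint:
  assumes I: "poly_ideal J I" and Sg: "Sg \<subseteq> polyfun J" "(\<lambda>_. 1) \<in> Sg"
    "\<And>s t. s \<in> Sg \<Longrightarrow> t \<in> Sg \<Longrightarrow> (\<lambda>x. s x * t x) \<in> Sg" and dis: "I \<inter> Sg = {}"
  shows "\<exists>P. I \<subseteq> P \<and> P \<inter> Sg = {} \<and> poly_prime J P \<and>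
    (\<forall>f\<in>polyfun J. f \<notin> P \<longrightarrow> (\<exists>p\<in>P. \<exists>g\<in>polyfun J. (\<lambda>x. p x + f x * g x) \<in> Sg))"
proof -
  define F where "F = {P. poly_ideal J P \<and> I \<subseteq> P \<and> P \<inter> Sg = {}}"
  have "\<exists>M\<in>F. \<forall>Q\<in>F. M \<subseteq> Q \<longrightarrow> Q = M"
  proof (rule subset_Zorn_nonempty)
    show "F \<noteq> {}" using I dis by (auto simp: F_def)
    fix C assume C: "C \<noteq> {}" "subset.chain F C"
    have CF: "C \<subseteq> F" using C(2) by (auto simp: subset_chain_def)
    have "(\<lambda>x. f x + g x) \<in> \<Union>C" if fg: "f \<in> \<Union>C" "g \<in> \<Union>C" for f g
    proof -
      obtain A B where "A \<in> C" "f \<in> A" "B \<in> C" "g \<in> B" using fg by auto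
      moreover from this have "A \<subseteq> B \<or> B \<subseteq> A" using C(2) by (auto simp: subset_chain_def)
      ultimately obtain D where "D \<in> C" "f \<in> D" "g \<in> D" by blast
      moreover from this have "poly_ideal J D" using CF by (auto simp: F_def)
      ultimately show ?thesis using poly_idealD(3)[of J D f g] by blast
    qed
    moreover have "(\<lambda>x. f x * g x) \<in> \<Union>C" if fg: "f \<in> \<Union>C" "g \<in> polyfun J" for f g
    proof -
      obtain D where "D \<in> C" "f \<in> D" using fg by auto
      moreover from this have "poly_ideal J D" using CF by (auto simp: F_def)
      ultimately show ?thesis using poly_idealD(4)[of J D f g] that by blast
    qed
    moreover have "\<Union>C \<subseteq> polyfun J" "(\<lambda>_. 0) \<in> \<Union>C"
      using CF C(1) poly_idealD(1,2) unfolding F_def by blast+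
    ultimately have "poly_ideal J (\<Union>C)" by (intro poly_idealI)
    then show "\<Union>C \<in> F" using CF C(1) unfolding F_def by blast
  qed
  then obtain M where M: "poly_ideal J M" "I \<subseteq> M" "M \<inter> Sg = {}"
    and mx: "\<And>Q. Q \<in> F \<Longrightarrow> M \<subseteq> Q \<Longrightarrow> Q = M" by (auto simp: F_def)
  have M': "(\<lambda>_. 0) \<in> M" "\<And>f g. f \<in> M \<Longrightarrow> g \<in> M \<Longrightarrow> (\<lambda>x. f x + g x) \<in> M"
    "\<And>f g. f \<in> M \<Longrightarrow> g \<in> polyfun J \<Longrightarrow> (\<lambda>x. f x * g x) \<in> M" "M \<subseteq> polyfun J"
    by (fact poly_idealD(2,3,4,1)[OF M(1)])+
  have meet: "\<exists>p\<in>M. \<exists>g\<in>polyfun J. (\<lambda>x. p x + f x * g x) \<in> Sg" if f: "f \<in> polyfun J" "f \<notin> M" for f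
  proof (rule ccontr)
    assume no: "\<not> ?thesis"
    \<comment> \<open>The ideal generated by M and f; if it avoided Sg it would equal M and yet
      contain f.\<close>
    define Q where "Q = {(\<lambda>x. p x + f x * g x) |p g. p \<in> M \<and> g \<in> polyfun J}"
    have "(\<lambda>x. u x + v x) \<in> Q" if uv: "u \<in> Q" "v \<in> Q" for u v
    proof -
      obtain p g q h where "u = (\<lambda>x. p x + f x * g x)" "v = (\<lambda>x. q x + f x * h x)"
        "p \<in> M" "g \<in> polyfun J" "q \<in> M" "h \<in> polyfun J" using uv by (auto simp: Q_def)
      then show ?thesis unfolding Q_def using M'(2)[of p q] polyfun_add[of g J h]
        by (intro CollectI exI[of _ "\<lambda>x. p x + q x"] exI[of _ "\<lambda>x. g x + h x"])
          (auto simp: algebra_simps)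
    qed
    moreover have "(\<lambda>x. u x * v x) \<in> Q" if uv: "u \<in> Q" "v \<in> polyfun J" for u v
    proof -
      obtain p g where "u = (\<lambda>x. p x + f x * g x)" "p \<in> M" "g \<in> polyfun J"
        using uv by (auto simp: Q_def)
      then show ?thesis unfolding Q_def using M'(3)[of p v] polyfun_mult[of g J v] uv
        by (intro CollectI exI[of _ "\<lambda>x. p x * v x"] exI[of _ "\<lambda>x. g x * v x"])
          (auto simp: algebra_simps)
    qed
    moreover have MX: "M \<subseteq> Q"
    proof
      fix p assume "p \<in> M"
      then show "p \<in> Q" unfolding Q_def
        by (intro CollectI exI[of _ p] exI[of _ "\<lambda>_. 0"]) (auto intro: polyfun_const)
    qed
    moreover have "Q \<subseteq> polyfun J" using M'(4) f by (auto simp: Q_def intro!: polyfun_add polyfun_mult)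
    ultimately have "poly_ideal J Q" using M'(1) by (intro poly_idealI) blast+
    moreover have "Q \<inter> Sg = {}" using no by (auto simp: Q_def)
    ultimately have "Q = M" using mx[of Q] MX M(2) by (auto simp: F_def)
    moreover have "f \<in> Q" unfolding Q_def
      by (intro CollectI exI[of _ "\<lambda>_. 0"] exI[of _ "\<lambda>_. 1"]) (auto intro: polyfun_const M'(1))
    ultimately show False using f by simp
  qed
  have "f \<in> M \<or> g \<in> M" if fg: "f \<in> polyfun J" "g \<in> polyfun J" "(\<lambda>x. f x * g x) \<in> M" for f g
  proof (rule ccontr)
    assume "\<not> ?thesis"
    then obtain p u q v where pu: "p \<in> M" "u \<in> polyfun J" "(\<lambda>x. p x + f x * u x) \<in> Sg"
      and qv: "q \<in> M" "v \<in> polyfun J" "(\<lambda>x. q x + g x * v x) \<in> Sg"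
      using meet fg by meson
    have 1: "(\<lambda>x. (p x + f x * u x) * (q x + g x * v x)) \<in> Sg" using Sg(3)[OF pu(3) qv(3)] .
    \<comment> \<open>When the product of the two members of Sg is expanded, every term has a factor
      p, q or f g and so lies in M, against disjointness.\<close>
    have "(\<lambda>x. (p x * (q x + g x * v x) + q x * (f x * u x)) + (f x * g x) * (u x * v x)) \<in> M"
      using pu qv fg M'(4) by (auto intro!: M'(2,3) polyfun_add polyfun_mult)
    moreover have "(\<lambda>x. (p x * (q x + g x * v x) + q x * (f x * u x)) + (f x * g x) * (u x * v x)) =
      (\<lambda>x. (p x + f x * u x) * (q x + g x * v x))" by (auto simp: algebra_simps)
    ultimately show False using 1 M(3) by auto
  qed
  then have "poly_prime J M" using M Sg(2) unfolding poly_prime_def by blast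
  then show ?thesis using M meet by blast
qed

text \<open>A weak Nullstellensatz: over an uncountable field the polynomial functions modulo a prime
  \<open>P\<close> have countable dimension, while the inverses of the \<open>x\<^sub>i - a\<close> would be linearly independent
  if \<open>x\<^sub>i\<close> were transcendental modulo \<open>P\<close>.\<close>

lemma generic_point:
  fixes I :: "(('i \<Rightarrow> 'k::alg_closed_field) \<Rightarrow> 'k) set"
  assumes unc: "uncountable (UNIV :: 'k set)" and J: "countable J"
    and I: "poly_ideal J I" and Sg: "Sg \<subseteq> polyfun J" "(\<lambda>_. 1) \<in> Sg"
    "\<And>s t. s \<in> Sg \<Longrightarrow> t \<in> Sg \<Longrightarrow> (\<lambda>x. s x * t x) \<in> Sg" and dis: "I \<inter> Sg = {}" and cSg: "countable Sg"
  shows "\<exists>y. (\<forall>f\<in>I. f y = 0) \<and> (\<forall>s\<in>Sg. s y \<noteq> 0)"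
proof -
  from poly_ideal_max_disjoint[OF I Sg dis] obtain P where P0: "I \<subseteq> P \<and> P \<inter> Sg = {} \<and> poly_prime J P \<and>
    (\<forall>f\<in>polyfun J. f \<notin> P \<longrightarrow> (\<exists>p\<in>P. \<exists>g\<in>polyfun J. (\<lambda>x. p x + f x * g x) \<in> Sg))" by (rule exE)
  then have IP: "I \<subseteq> P" and PSg: "P \<inter> Sg = {}" and prime: "poly_prime J P"
    and meet: "\<And>f. f \<in> polyfun J \<Longrightarrow> f \<notin> P \<Longrightarrow> \<exists>p\<in>P. \<exists>g\<in>polyfun J. (\<lambda>x. p x + f x * g x) \<in> Sg"
    by simp_all
  note idl = poly_primeD(1)[OF prime] and one = poly_primeD(2)[OF prime] and pr = poly_primeD(3)[OF prime]
  note P = poly_idealD(2,3,4,1)[OF idl]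
  have const: "c = 0" if "(\<lambda>_. c) \<in> P" for c
  proof (rule ccontr)
    assume "c \<noteq> 0"
    then have "(\<lambda>_. 1) \<in> P" using P(3)[OF that polyfun_const[of "inverse c"]] by simp
    then show False using one by simp
  qed
  have ex: "\<exists>a. (\<lambda>x. x i - a) \<in> P" if i: "i \<in> J" for i
  proof (rule ccontr)
    assume no: "\<nexists>a. (\<lambda>x. x i - a) \<in> P"
    have lin: "(\<lambda>x. x i - a) \<in> polyfun J" for a by (intro polyfun_diff polyfun_coord polyfun_const i)
    have "\<exists>p. \<exists>g. \<exists>s. p \<in> P \<and> g \<in> polyfun J \<and> s \<in> Sg \<and> s = (\<lambda>x. p x + (x i - a) * g x)" for a
    proof -
      have "(\<lambda>x. x i - a) \<notin> P" using no by simp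
      from meet[OF lin this] show ?thesis unfolding Bex_def by simp
    qed
    then have "\<forall>a. \<exists>p. \<exists>g. \<exists>s. p \<in> P \<and> g \<in> polyfun J \<and> s \<in> Sg \<and> s = (\<lambda>x. p x + (x i - a) * g x)"
      by (rule allI)
    from choice[OF this] obtain p where
      "\<forall>a. \<exists>g. \<exists>s. p a \<in> P \<and> g \<in> polyfun J \<and> s \<in> Sg \<and> s = (\<lambda>x. p a x + (x i - a) * g x)" by (rule exE)
    from choice[OF this] obtain g where
      "\<forall>a. \<exists>s. p a \<in> P \<and> g a \<in> polyfun J \<and> s \<in> Sg \<and> s = (\<lambda>x. p a x + (x i - a) * g a x)" by (rule exE)
    from choice[OF this] obtain s where
      "\<forall>a. p a \<in> P \<and> g a \<in> polyfun J \<and> s a \<in> Sg \<and> s a = (\<lambda>x. p a x + (x i - a) * g a x)" by (rule exE)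
    then have all: "p a \<in> P \<and> g a \<in> polyfun J \<and> s a \<in> Sg \<and> s a = (\<lambda>x. p a x + (x i - a) * g a x)" for a
      by (rule spec)
    note pgs = all[THEN conjunct1] all[THEN conjunct2, THEN conjunct1]
      all[THEN conjunct2, THEN conjunct2, THEN conjunct1] all[THEN conjunct2, THEN conjunct2, THEN conjunct2]
    have "\<forall>a. \<exists>ps. set (map snd ps) \<subseteq> lists J \<and> g a = (\<lambda>x. \<Sum>(c, t)\<leftarrow>ps. c * monom_eval t x)"
      by (intro allI polyfun_monomials[OF pgs(2)])
    from choice[OF this] obtain ps where ps: "\<And>a. set (map snd (ps a)) \<subseteq> lists J"
      "\<And>a. g a = (\<lambda>x. \<Sum>(c, t)\<leftarrow>ps a. c * monom_eval t x)" by auto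
    \<comment> \<open>The key forgets the coefficients of \<open>g a\<close>. Its values lie in a
      countable set, so some key is shared by uncountably many a; all these \<open>g a\<close> lie
      in the span of one finite list of monomials, and the \<open>s a\<close> coincide.\<close>
    define key where "key a = (s a, map snd (ps a))" for a
    have "map snd (ps a) \<in> lists (lists J)" for a using ps(1)[of a] by (simp only: lists_eq_set mem_Collect_eq)
    then have "range key \<subseteq> Sg \<times> lists (lists J)" using pgs(3) unfolding key_def by blast
    then have "countable (range key)"
      using cSg J by (meson countable_SIGMA countable_lists countable_subset)
    then have "\<exists>k\<in>range key. uncountable (key -` {k})"
    proof (rule contrapos_pp)
      assume "\<not> (\<exists>k\<in>range key. uncountable (key -` {k}))"
      then have "countable (range key) \<Longrightarrow> countable (\<Union>k\<in>range key. key -` {k})" by blast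
      moreover have "(\<Union>k\<in>range key. key -` {k}) = UNIV" by auto
      ultimately show "uncountable (range key)" using unc by auto
    qed
    then obtain sg ts where "uncountable (key -` {(sg, ts)})" by (metis surj_pair)
    then have "infinite (key -` {(sg, ts)})" using countable_finite by blast
    \<comment> \<open>One point more than there are monomials, which forces a linear relation among
      the \<open>g a\<close>.\<close>
    then obtain A where A: "finite A" "card A = Suc (length ts)" "A \<subseteq> key -` {(sg, ts)}"
      using infinite_arbitrarily_large by blast
    have key: "s a = sg" "map snd (ps a) = ts" if "a \<in> A" for a using that A by (auto simp: key_def)
    define C where "C a j = fst (ps a ! j)" for a j
    have gC: "g a x = (\<Sum>j<length ts. C a j * monom_eval (ts ! j) x)" if "a \<in> A" for a x
    proof -
      have len: "length (ps a) = length ts" using key(2)[OF that] by auto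
      have "g a x = (\<Sum>j<length (ps a). (case ps a ! j of (c, t) \<Rightarrow> c * monom_eval t x))"
        unfolding ps(2) by (simp add: sum_list_sum_nth atLeast0LessThan)
      also have "\<dots> = (\<Sum>j<length ts. C a j * monom_eval (ts ! j) x)"
        unfolding len C_def using key(2)[OF that] len
        by (intro sum.cong) (auto simp: case_prod_unfold)
      finally show ?thesis .
    qed
    obtain c where c: "\<exists>a\<in>A. c a \<noteq> 0" "\<And>j. j < length ts \<Longrightarrow> (\<Sum>a\<in>A. c a * C a j) = 0"
      using nontrivial_kernel[of "{..<length ts}" A C] A by auto
    have dep: "(\<Sum>a\<in>A. c a * g a x) = 0" for x
    proof -
      have "(\<Sum>a\<in>A. c a * g a x) = (\<Sum>a\<in>A. \<Sum>j<length ts. c a * C a j * monom_eval (ts ! j) x)"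
        by (intro sum.cong) (auto simp: gC sum_distrib_left mult.assoc)
      also have "\<dots> = (\<Sum>j<length ts. (\<Sum>a\<in>A. c a * C a j) * monom_eval (ts ! j) x)"
        by (subst sum.swap) (simp add: sum_distrib_right)
      finally show ?thesis using c(2) by simp
    qed
    \<comment> \<open>The numerator of the partial fraction sum of \<open>c a / (X - a)\<close> over
      A. At a point a1 of A only the summand of a1 survives, so h is nonzero as soon as
      \<open>c a1\<close> is.\<close>
    define h where "h = (\<Sum>a\<in>A. smult (c a) (\<Prod>b\<in>A - {a}. [:- b, 1:]))"
    have h_eval: "poly h z = (\<Sum>a\<in>A. c a * (\<Prod>b\<in>A - {a}. z - b))" for z
      by (simp add: h_def poly_sum poly_prod)
    obtain a1 where a1: "a1 \<in> A" "c a1 \<noteq> 0" using c(1) by auto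
    have "poly h a1 = c a1 * (\<Prod>b\<in>A - {a1}. a1 - b)"
    proof -
      have "(\<Prod>b\<in>A - {a}. a1 - b) = 0" if "a \<in> A - {a1}" for a
        using that a1 A(1) by (intro prod_zero) auto
      then have "(\<Sum>a\<in>A - {a1}. c a * (\<Prod>b\<in>A - {a}. a1 - b)) = 0" by (intro sum.neutral) simp
      then show ?thesis unfolding h_eval using A(1) a1 by (subst sum.remove[of A a1]) simp_all
    qed
    then have "poly h a1 \<noteq> 0" using a1 A(1) by simp
    then have h0: "h \<noteq> 0" by auto
    have split: "(z - a) * (\<Prod>b\<in>A - {a}. z - b) = (\<Prod>b\<in>A. z - b)" if "a \<in> A" for a and z :: 'k
      using that A(1) by (simp add: prod.remove)
    \<comment> \<open>Each \<open>p a = s a - (x i - a) * g a\<close> is multiplied by the product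
      over the other points and by \<open>c a\<close>. In the sum the \<open>g a\<close> part
      becomes the linear relation times a common product and drops out, which leaves
      \<open>sg * h (x i)\<close> in P.\<close>
    have "(\<lambda>x. \<Sum>a\<in>A. p a x * (c a * (\<Prod>b\<in>A - {a}. x i - b))) \<in> P"
      using pgs(1) by (intro poly_ideal_sum[OF idl] P(3) polyfun_mult polyfun_prod lin polyfun_const)
    moreover have "(\<Sum>a\<in>A. p a x * (c a * (\<Prod>b\<in>A - {a}. x i - b))) = sg x * poly h (x i)" for x
    proof -
      have "(\<Sum>a\<in>A. p a x * (c a * (\<Prod>b\<in>A - {a}. x i - b))) =
        (\<Sum>a\<in>A. sg x * (c a * (\<Prod>b\<in>A - {a}. x i - b)) - c a * g a x * (\<Prod>b\<in>A. x i - b))"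
      proof (intro sum.cong refl)
        fix a assume a: "a \<in> A"
        have sgx: "sg x = p a x + (x i - a) * g a x" using key(1)[OF a] pgs(4)[of a] by metis
        then show "p a x * (c a * (\<Prod>b\<in>A - {a}. x i - b)) =
          sg x * (c a * (\<Prod>b\<in>A - {a}. x i - b)) - c a * g a x * (\<Prod>b\<in>A. x i - b)"
          unfolding split[OF a, symmetric] by (subst sgx) (simp add: algebra_simps)
      qed
      also have "\<dots> = sg x * poly h (x i) - (\<Sum>a\<in>A. c a * g a x) * (\<Prod>b\<in>A. x i - b)"
        by (simp add: h_eval sum_subtractf sum_distrib_left sum_distrib_right)
      finally show ?thesis using dep by simp
    qed
    ultimately have sgh: "(\<lambda>x. sg x * poly h (x i)) \<in> P" by simp
    have sg: "sg \<in> Sg" using pgs(3)[of a1] key(1)[OF a1(1)] by simp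
    \<comment> \<open>Algebraic closedness splits h into linear factors; by primality
      \<open>h (x i)\<close> cannot lie in P unless some \<open>x i - b\<close> does.\<close>
    obtain B where B: "h = smult (lead_coeff h) (\<Prod>x\<in>#B. [:-x, 1:])"
      using alg_closed_imp_factorization[OF h0] by blast
    have evB: "poly (\<Prod>x\<in>#B. [:-x, 1:]) z = (\<Prod>b\<in>#B. z - b)" for z
      by (induction B) (auto simp: algebra_simps)
    have linB: "(\<lambda>x. \<Prod>b\<in>#B. x i - b) \<in> polyfun J" for B
      by (induction B) (auto intro: polyfun_const polyfun_mult lin)
    have "poly h z = (\<Prod>b\<in>#B. z - b) * lead_coeff h" for z by (subst B) (simp add: evB)
    then have hB: "(\<lambda>x. poly h (x i)) = (\<lambda>x. (\<Prod>b\<in>#B. x i - b) * lead_coeff h)" by auto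
    then have "(\<lambda>x. poly h (x i)) \<in> polyfun J" using polyfun_mult[OF linB polyfun_const] by simp
    then have "(\<lambda>x. poly h (x i)) \<in> P" using pr[OF _ _ sgh] sg Sg(1) PSg by blast
    then have "(\<lambda>x. (\<Prod>b\<in>#B. x i - b) * lead_coeff h) \<in> P" using hB by simp
    then have "(\<lambda>x. \<Prod>b\<in>#B. x i - b) \<in> P"
      using pr[OF linB polyfun_const] const h0 by (metis leading_coeff_0_iff)
    moreover have "(\<lambda>x. \<Prod>b\<in>#B. x i - b) \<notin> P" for B
    proof (induction B)
      case empty then show ?case using one by simp
    next
      case (add b B)
      then show ?case using pr[OF lin[of b] linB[of B]] no by auto
    qed
    ultimately show False by blast
  qed
  \<comment> \<open>Modulo P every coordinate in J is congruent to a constant, hence so is every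
    member of \<open>polyfun J\<close>; coordinates outside J take an arbitrary value that these
    functions do not see.\<close>
  define y where "y i = (SOME a. (\<lambda>x. x i - a) \<in> P)" for i
  have y: "(\<lambda>x. x i - y i) \<in> P" if "i \<in> J" for i unfolding y_def using someI_ex[OF ex[OF that]] .
  have ev: "(\<lambda>x. f x - f y) \<in> P" if "f \<in> polyfun J" for f
    using that
  proof (induction rule: polyfun.induct)
    case (polyfun_const c) then show ?case using P(1) by simp
  next
    case (polyfun_coord i) then show ?case using y by simp
  next
    case (polyfun_add f g)
    then show ?case using P(2)[OF polyfun_add.IH] by (simp add: algebra_simps)
  next
    case (polyfun_mult f g)
    have "(\<lambda>x. (f x - f y) * g x) \<in> P" "(\<lambda>x. (g x - g y) * f y) \<in> P"
      using P(3) polyfun_mult polyfun_const by blast+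
    from P(2)[OF this] show ?case by (simp add: algebra_simps)
  qed
  have "f y = 0" if "f \<in> P" for f
    using poly_ideal_diff[OF idl that ev[of f]] that P(4) const by fastforce
  moreover have "s y \<noteq> 0" if "s \<in> Sg" for s
  proof
    assume "s y = 0"
    then have "s \<in> P" using ev[of s] that Sg(1) by auto
    then show False using that PSg by auto
  qed
  ultimately show ?thesis using IP by blast
qed

section \<open>Gaussian elimination modulo a prime\<close>

text \<open>The kernel of a system over the fraction field of the polynomial functions modulo P,
  with denominators cleared: the vectors \<open>\<Phi> i\<close> solve it modulo P, and at the zeros
  of P where \<mu> does not vanish their values span the kernel of the specialized system over k.
  Spanning is recorded, linear independence is not.\<close>

definition generic_kernel_basis ::
    "'i set \<Rightarrow> (('i \<Rightarrow> 'k::field) \<Rightarrow> 'k) set \<Rightarrow> 'e set \<Rightarrow> ('e \<Rightarrow> ('i \<Rightarrow> 'k) \<Rightarrow> 'k) set \<Rightarrow>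
     (('i \<Rightarrow> 'k) \<Rightarrow> 'k) \<Rightarrow> nat \<Rightarrow> (nat \<Rightarrow> 'e \<Rightarrow> ('i \<Rightarrow> 'k) \<Rightarrow> 'k) \<Rightarrow> bool" where
  "generic_kernel_basis J P K L \<mu> d \<Phi> \<longleftrightarrow>
    \<mu> \<in> polyfun J \<and> \<mu> \<notin> P \<and> (\<forall>i<d. \<forall>\<kappa>\<in>K. \<Phi> i \<kappa> \<in> polyfun J) \<and>
    (\<forall>i<d. \<forall>r\<in>L. (\<lambda>y. \<Sum>\<kappa>\<in>K. r \<kappa> y * \<Phi> i \<kappa> y) \<in> P) \<and>
    (\<forall>y \<phi>. (\<forall>f\<in>P. f y = 0) \<and> \<mu> y \<noteq> 0 \<and> (\<forall>r\<in>L. (\<Sum>\<kappa>\<in>K. r \<kappa> y * \<phi> \<kappa>) = 0) \<longrightarrow>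
      (\<exists>t. \<forall>\<kappa>\<in>K. \<phi> \<kappa> = (\<Sum>i<d. t i * \<Phi> i \<kappa> y)))"

text \<open>One unknown k0 is eliminated at a time. If its column vanishes modulo P, then k0 is free
  and contributes a unit vector. Otherwise an entry outside P serves as pivot; rows are
  cross-multiplied instead of divided, and the pivot enters \<mu> so that it can be inverted at the
  points considered.\<close>

lemma generic_kernel:
  fixes P :: "(('i \<Rightarrow> 'k::field) \<Rightarrow> 'k) set"
  assumes prime: "poly_prime J P" and K: "finite K" and L: "finite L"
    and row: "\<And>r \<kappa>. r \<in> L \<Longrightarrow> \<kappa> \<in> K \<Longrightarrow> r \<kappa> \<in> polyfun J"
  shows "\<exists>\<mu> d \<Phi>. generic_kernel_basis J P K L \<mu> d \<Phi>"
  using K L row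
proof (induction K arbitrary: L rule: finite_induct)
  case empty
  then show ?case using poly_primeD(2)[OF prime] unfolding generic_kernel_basis_def
    by (intro exI[of _ "\<lambda>_. 1"] exI[of _ 0]) (auto intro: polyfun_const)
next
  case (insert k0 K)
  note idl = poly_primeD(1)[OF prime]
  show ?case
  proof (cases "\<forall>r\<in>L. r k0 \<in> P")
    case True
    have "\<exists>\<mu> d \<Phi>. generic_kernel_basis J P K L \<mu> d \<Phi>"
      using insert.prems by (intro insert.IH) simp_all
    then obtain \<mu> d \<Phi> where "generic_kernel_basis J P K L \<mu> d \<Phi>" by (elim exE) (rule that)
    then have \<mu>: "\<mu> \<in> polyfun J" "\<mu> \<notin> P"
      and \<Phi>: "\<forall>i<d. \<forall>\<kappa>\<in>K. \<Phi> i \<kappa> \<in> polyfun J" "\<forall>i<d. \<forall>r\<in>L. (\<lambda>y. \<Sum>\<kappa>\<in>K. r \<kappa> y * \<Phi> i \<kappa> y) \<in> P"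
      and sp: "\<forall>y \<phi>. (\<forall>f\<in>P. f y = 0) \<and> \<mu> y \<noteq> 0 \<and> (\<forall>r\<in>L. (\<Sum>\<kappa>\<in>K. r \<kappa> y * \<phi> \<kappa>) = 0) \<longrightarrow>
        (\<exists>t. \<forall>\<kappa>\<in>K. \<phi> \<kappa> = (\<Sum>i<d. t i * \<Phi> i \<kappa> y))" unfolding generic_kernel_basis_def by simp_all
    \<comment> \<open>The old vectors extended by 0 at k0, and in position d the unit vector of the
      free unknown k0.\<close>
    define \<Psi> where "\<Psi> i \<kappa> = (if i < d then if \<kappa> = k0 then (\<lambda>_. 0) else \<Phi> i \<kappa>
      else if \<kappa> = k0 then (\<lambda>_. 1) else (\<lambda>_. 0))" for i \<kappa>
    have sum\<Psi>: "(\<Sum>\<kappa>\<in>insert k0 K. r \<kappa> y * \<Psi> i \<kappa> y) =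
        (if i < d then \<Sum>\<kappa>\<in>K. r \<kappa> y * \<Phi> i \<kappa> y else r k0 y)" for i r y
    proof (cases "i < d")
      case True
      have "(\<Sum>\<kappa>\<in>K. r \<kappa> y * \<Psi> i \<kappa> y) = (\<Sum>\<kappa>\<in>K. r \<kappa> y * \<Phi> i \<kappa> y)"
        using insert.hyps True by (intro sum.cong) (auto simp: \<Psi>_def)
      then show ?thesis using insert.hyps True by (simp add: \<Psi>_def)
    next
      case False
      have "(\<Sum>\<kappa>\<in>K. r \<kappa> y * \<Psi> i \<kappa> y) = 0"
        using insert.hyps False by (intro sum.neutral) (auto simp: \<Psi>_def)
      then show ?thesis using insert.hyps False by (simp add: \<Psi>_def)
    qed
    have "\<forall>i<Suc d. \<forall>\<kappa>\<in>insert k0 K. \<Psi> i \<kappa> \<in> polyfun J"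
      using \<Phi>(1) by (auto simp: \<Psi>_def intro: polyfun_const)
    moreover have "\<forall>i<Suc d. \<forall>r\<in>L. (\<lambda>y. \<Sum>\<kappa>\<in>insert k0 K. r \<kappa> y * \<Psi> i \<kappa> y) \<in> P"
    proof (intro allI impI ballI)
      fix i r assume "i < Suc d" and r: "r \<in> L"
      show "(\<lambda>y. \<Sum>\<kappa>\<in>insert k0 K. r \<kappa> y * \<Psi> i \<kappa> y) \<in> P"
      proof (cases "i < d")
        case True then show ?thesis unfolding sum\<Psi> using \<Phi>(2) r by simp
      next
        case False then show ?thesis unfolding sum\<Psi> using \<open>\<forall>r\<in>L. r k0 \<in> P\<close> r by simp
      qed
    qed
    moreover have "\<exists>t. \<forall>\<kappa>\<in>insert k0 K. \<phi> \<kappa> = (\<Sum>i<Suc d. t i * \<Psi> i \<kappa> y)"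
      if y: "\<forall>f\<in>P. f y = 0" "\<mu> y \<noteq> 0" "\<forall>r\<in>L. (\<Sum>\<kappa>\<in>insert k0 K. r \<kappa> y * \<phi> \<kappa>) = 0" for y \<phi>
    proof -
      have "\<forall>r\<in>L. (\<Sum>\<kappa>\<in>K. r \<kappa> y * \<phi> \<kappa>) = 0"
      proof
        fix r assume r: "r \<in> L"
        then have "r k0 \<in> P" using True by blast
        then have "r k0 y = 0" using y(1) by blast
        moreover have "r k0 y * \<phi> k0 + (\<Sum>\<kappa>\<in>K. r \<kappa> y * \<phi> \<kappa>) = 0" using y(3) r insert.hyps by simp
        ultimately show "(\<Sum>\<kappa>\<in>K. r \<kappa> y * \<phi> \<kappa>) = 0" by simp
      qed
      then obtain t where t: "\<forall>\<kappa>\<in>K. \<phi> \<kappa> = (\<Sum>i<d. t i * \<Phi> i \<kappa> y)" using sp y(1,2) by blast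
      have "\<phi> \<kappa> = (\<Sum>i<Suc d. (t(d := \<phi> k0)) i * \<Psi> i \<kappa> y)" if \<kappa>: "\<kappa> \<in> insert k0 K" for \<kappa>
      proof (cases "\<kappa> = k0")
        case True then show ?thesis by (simp add: \<Psi>_def)
      next
        case False then show ?thesis using \<kappa> t by (simp add: \<Psi>_def)
      qed
      then show ?thesis by blast
    qed
    ultimately show ?thesis using \<mu> unfolding generic_kernel_basis_def
      by (intro exI[of _ \<mu>] exI[of _ "Suc d"] exI[of _ \<Psi>]) simp
  next
    case False
    then obtain r0 where r0: "r0 \<in> L" "r0 k0 \<notin> P" by auto
    define a where "a = r0 k0"
    have a: "a \<in> polyfun J" "a \<notin> P" using r0 insert.prems by (auto simp: a_def)
    \<comment> \<open>The entry of \<open>red r\<close> at k0 would be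
      \<open>a * r k0 - r k0 * a = 0\<close>, so k0 no longer occurs in the reduced rows.\<close>
    define red where "red r = (\<lambda>\<kappa> y. a y * r \<kappa> y - r k0 y * r0 \<kappa> y)" for r
    have "\<exists>\<mu> d \<Phi>. generic_kernel_basis J P K (red ` L) \<mu> d \<Phi>"
    proof (rule insert.IH)
      show "finite (red ` L)" using insert.prems by simp
      fix r \<kappa> assume "r \<in> red ` L" "\<kappa> \<in> K"
      then obtain q where q: "r = red q" "q \<in> L" by auto
      have "q \<kappa> \<in> polyfun J" "q k0 \<in> polyfun J" "r0 \<kappa> \<in> polyfun J"
        using insert.prems(2) q(2) r0(1) \<open>\<kappa> \<in> K\<close> by simp_all
      then show "r \<kappa> \<in> polyfun J" unfolding q red_def by (intro polyfun_diff polyfun_mult a(1))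
    qed
    then obtain \<mu> d \<Phi> where "generic_kernel_basis J P K (red ` L) \<mu> d \<Phi>" by (elim exE) (rule that)
    then have \<mu>: "\<mu> \<in> polyfun J" "\<mu> \<notin> P"
      and \<Phi>: "\<forall>i<d. \<forall>\<kappa>\<in>K. \<Phi> i \<kappa> \<in> polyfun J"
        "\<forall>i<d. \<forall>r\<in>red ` L. (\<lambda>y. \<Sum>\<kappa>\<in>K. r \<kappa> y * \<Phi> i \<kappa> y) \<in> P"
      and sp: "\<forall>y \<phi>. (\<forall>f\<in>P. f y = 0) \<and> \<mu> y \<noteq> 0 \<and> (\<forall>r\<in>red ` L. (\<Sum>\<kappa>\<in>K. r \<kappa> y * \<phi> \<kappa>) = 0) \<longrightarrow>
        (\<exists>t. \<forall>\<kappa>\<in>K. \<phi> \<kappa> = (\<Sum>i<d. t i * \<Phi> i \<kappa> y))" unfolding generic_kernel_basis_def by simp_all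
    \<comment> \<open>Back substitution scaled by the pivot: row r0 asks that a times the k0 entry
      be minus the rest, and in place of dividing this entry by a, all the others are multiplied by
      a.\<close>
    define \<Psi> where "\<Psi> i \<kappa> = (if \<kappa> = k0 then (\<lambda>y. - (\<Sum>\<kappa>\<in>K. r0 \<kappa> y * \<Phi> i \<kappa> y))
      else (\<lambda>y. a y * \<Phi> i \<kappa> y))" for i \<kappa>
    have \<Psi>K: "\<Psi> i \<kappa> y = a y * \<Phi> i \<kappa> y" if "\<kappa> \<in> K" for i \<kappa> y
      using that insert.hyps by (auto simp: \<Psi>_def)
    have \<Psi>k0: "\<Psi> i k0 y = - (\<Sum>\<kappa>\<in>K. r0 \<kappa> y * \<Phi> i \<kappa> y)" for i y by (simp add: \<Psi>_def)
    have sum\<Psi>: "(\<Sum>\<kappa>\<in>insert k0 K. r \<kappa> y * \<Psi> i \<kappa> y) = (\<Sum>\<kappa>\<in>K. red r \<kappa> y * \<Phi> i \<kappa> y)" for i r y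
    proof -
      have "(\<Sum>\<kappa>\<in>insert k0 K. r \<kappa> y * \<Psi> i \<kappa> y) =
          r k0 y * \<Psi> i k0 y + (\<Sum>\<kappa>\<in>K. r \<kappa> y * \<Psi> i \<kappa> y)" using insert.hyps by simp
      also have "\<dots> = (\<Sum>\<kappa>\<in>K. red r \<kappa> y * \<Phi> i \<kappa> y)"
        unfolding \<Psi>k0 red_def
        by (simp add: \<Psi>K sum_distrib_left algebra_simps sum_subtractf)
      finally show ?thesis .
    qed
    have "\<forall>i<d. \<forall>\<kappa>\<in>insert k0 K. \<Psi> i \<kappa> \<in> polyfun J"
      using \<Phi>(1) insert.prems r0(1) a(1) unfolding \<Psi>_def
      by (auto intro!: polyfun_uminus polyfun_sum polyfun_mult)
    moreover have "\<forall>i<d. \<forall>r\<in>L. (\<lambda>y. \<Sum>\<kappa>\<in>insert k0 K. r \<kappa> y * \<Psi> i \<kappa> y) \<in> P"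
      unfolding sum\<Psi> using \<Phi>(2) by simp
    moreover have "\<exists>t. \<forall>\<kappa>\<in>insert k0 K. \<phi> \<kappa> = (\<Sum>i<d. t i * \<Psi> i \<kappa> y)"
      if y: "\<forall>f\<in>P. f y = 0" "\<mu> y * a y \<noteq> 0" "\<forall>r\<in>L. (\<Sum>\<kappa>\<in>insert k0 K. r \<kappa> y * \<phi> \<kappa>) = 0" for y \<phi>
    proof -
      have ay: "a y \<noteq> 0" "\<mu> y \<noteq> 0" using y(2) by auto
      have e: "(\<Sum>\<kappa>\<in>K. r \<kappa> y * \<phi> \<kappa>) = - (r k0 y * \<phi> k0)" if "r \<in> L" for r
      proof -
        have "r k0 y * \<phi> k0 + (\<Sum>\<kappa>\<in>K. r \<kappa> y * \<phi> \<kappa>) = 0" using y(3) that insert.hyps by simp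
        then show ?thesis by (simp add: add_eq_0_iff2)
      qed
      have "(\<Sum>\<kappa>\<in>K. red r \<kappa> y * \<phi> \<kappa>) = 0" if r: "r \<in> L" for r
      proof -
        have "(\<Sum>\<kappa>\<in>K. red r \<kappa> y * \<phi> \<kappa>) = a y * (\<Sum>\<kappa>\<in>K. r \<kappa> y * \<phi> \<kappa>) - r k0 y * (\<Sum>\<kappa>\<in>K. r0 \<kappa> y * \<phi> \<kappa>)"
          unfolding red_def by (simp add: sum_distrib_left algebra_simps sum_subtractf)
        then show ?thesis unfolding e[OF r] e[OF r0(1)] by (simp add: a_def)
      qed
      then obtain t where t: "\<forall>\<kappa>\<in>K. \<phi> \<kappa> = (\<Sum>i<d. t i * \<Phi> i \<kappa> y)" using sp y(1) ay(2) by blast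
      have "\<phi> \<kappa> = (\<Sum>i<d. (t i / a y) * \<Psi> i \<kappa> y)" if \<kappa>: "\<kappa> \<in> insert k0 K" for \<kappa>
      proof (cases "\<kappa> = k0")
        case True
        have "(\<Sum>\<kappa>\<in>K. r0 \<kappa> y * \<phi> \<kappa>) = (\<Sum>\<kappa>\<in>K. \<Sum>i<d. r0 \<kappa> y * (t i * \<Phi> i \<kappa> y))"
          using t by (simp add: sum_distrib_left)
        also have "\<dots> = (\<Sum>i<d. t i * (\<Sum>\<kappa>\<in>K. r0 \<kappa> y * \<Phi> i \<kappa> y))"
          by (subst sum.swap) (simp add: sum_distrib_left mult_ac)
        also have "\<dots> = - (\<Sum>i<d. t i * \<Psi> i k0 y)" unfolding \<Psi>k0 by (simp add: sum_negf)
        finally have "a y * \<phi> k0 = (\<Sum>i<d. t i * \<Psi> i k0 y)" using e[OF r0(1)] by (simp add: a_def)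
        then have "\<phi> k0 = (\<Sum>i<d. t i * \<Psi> i k0 y) / a y" using ay by (simp add: field_simps)
        then show ?thesis using True by (simp add: sum_divide_distrib)
      next
        case False
        then have "\<kappa> \<in> K" using \<kappa> by simp
        then show ?thesis using t ay by (simp add: \<Psi>K)
      qed
      then show ?thesis by (intro exI[of _ "\<lambda>i. t i / a y"]) blast
    qed
    moreover have "(\<lambda>y. \<mu> y * a y) \<in> polyfun J" "(\<lambda>y. \<mu> y * a y) \<notin> P"
      using polyfun_mult[OF \<mu>(1) a(1)] poly_primeD(3)[OF prime \<mu>(1) a(1)] \<mu>(2) a(2) by auto
    ultimately show ?thesis unfolding generic_kernel_basis_def
      by (intro exI[of _ "\<lambda>y. \<mu> y * a y"] exI[of _ d] exI[of _ \<Psi>]) simp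
  qed
qed

section \<open>Ultrafilters and countable covers\<close>

text \<open>A family maximal with the finite intersection property is an ultrafilter: by maximality
  every set outside it misses some finite intersection of members (\<open>wit\<close>), and such
  witnesses yield closure under intersections and supersets as well as the dichotomy for
  complements.\<close>

lemma ultrafilter_exists:
  fixes F :: "'a set set"
  assumes fip: "\<And>G. finite G \<Longrightarrow> G \<subseteq> F \<Longrightarrow> \<Inter>G \<noteq> {}"
  shows "\<exists>U. F \<subseteq> U \<and> {} \<notin> U \<and> (\<forall>A\<in>U. \<forall>B\<in>U. A \<inter> B \<in> U) \<and>
    (\<forall>A\<in>U. \<forall>B. A \<subseteq> B \<longrightarrow> B \<in> U) \<and> (\<forall>A. A \<in> U \<or> - A \<in> U)"
proof -
  define FIP where "FIP M \<longleftrightarrow> (\<forall>G. finite G \<and> G \<subseteq> M \<longrightarrow> \<Inter>G \<noteq> {})" for M :: "'a set set"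
  have "\<exists>M\<in>{M. F \<subseteq> M \<and> FIP M}. \<forall>N\<in>{M. F \<subseteq> M \<and> FIP M}. M \<subseteq> N \<longrightarrow> N = M"
  proof (rule subset_Zorn_nonempty)
    show "{M. F \<subseteq> M \<and> FIP M} \<noteq> {}" using fip by (auto simp: FIP_def)
    fix C assume C: "C \<noteq> {}" "subset.chain {M. F \<subseteq> M \<and> FIP M} C"
    then have sub: "C \<subseteq> {M. F \<subseteq> M \<and> FIP M}" by (auto simp: subset_chain_def)
    have "\<Inter>G \<noteq> {}" if G: "finite G" "G \<subseteq> \<Union>C" for G
    proof -
      obtain B where "B \<in> C" "G \<subseteq> B" using finite_subset_Union_chain[OF G C] by blast
      then show ?thesis using sub G(1) by (auto simp: FIP_def)
    qed
    then have "FIP (\<Union>C)" by (simp add: FIP_def)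
    moreover have "F \<subseteq> \<Union>C" using sub C(1) by blast
    ultimately show "\<Union>C \<in> {M. F \<subseteq> M \<and> FIP M}" by simp
  qed
  then obtain M where M: "F \<subseteq> M" "FIP M" and mx: "\<And>N. F \<subseteq> N \<Longrightarrow> FIP N \<Longrightarrow> M \<subseteq> N \<Longrightarrow> N = M" by auto
  have wit: "\<exists>G. finite G \<and> G \<subseteq> M \<and> \<Inter>G \<inter> A = {}" if A: "A \<notin> M" for A
  proof -
    have "\<not> FIP (insert A M)" using mx[of "insert A M"] M(1) A by auto
    then obtain G where G: "finite G" "G \<subseteq> insert A M" "\<Inter>G = {}" by (auto simp: FIP_def)
    have "\<Inter>(G - {A}) \<inter> A \<subseteq> \<Inter>G" by blast
    then show ?thesis using G by (intro exI[of _ "G - {A}"]) auto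
  qed
  have no: "\<Inter>G \<noteq> {}" if "finite G" "G \<subseteq> M" for G using M(2) that by (auto simp: FIP_def)
  have "{} \<notin> M" using no[of "{{}}"] by auto
  moreover have "A \<inter> B \<in> M" if AB: "A \<in> M" "B \<in> M" for A B
  proof (rule ccontr)
    assume "A \<inter> B \<notin> M"
    from wit[OF this] obtain G where G: "finite G" "G \<subseteq> M" "\<Inter>G \<inter> (A \<inter> B) = {}"
      by (elim exE conjE) (rule that)
    have "\<Inter>(insert A (insert B G)) = \<Inter>G \<inter> (A \<inter> B)" by blast
    then show False using no[of "insert A (insert B G)"] AB G by simp
  qed
  moreover have "B \<in> M" if AB: "A \<in> M" "A \<subseteq> B" for A B
  proof (rule ccontr)
    assume "B \<notin> M"
    from wit[OF this] obtain G where G: "finite G" "G \<subseteq> M" "\<Inter>G \<inter> B = {}"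
      by (elim exE conjE) (rule that)
    have "\<Inter>(insert A G) \<subseteq> \<Inter>G \<inter> B" using AB(2) by auto
    then show False using no[of "insert A G"] AB G by simp
  qed
  moreover have "A \<in> M \<or> - A \<in> M" for A
  proof (rule ccontr)
    assume "\<not> ?thesis"
    then have "A \<notin> M" "- A \<notin> M" by simp_all
    from wit[OF this(1)] obtain G where G: "finite G" "G \<subseteq> M" "\<Inter>G \<inter> A = {}"
      by (elim exE conjE) (rule that)
    from wit[OF \<open>- A \<notin> M\<close>] obtain H where H: "finite H" "H \<subseteq> M" "\<Inter>H \<inter> - A = {}"
      by (elim exE conjE) (rule that)
    have "\<Inter>(G \<union> H) = {}" using G(3) H(3) unfolding Inter_Un_distrib by blast
    then show False using no[of "G \<union> H"] G H by simp
  qed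
  ultimately show ?thesis using M(1) by blast
qed

text \<open>Each \<open>Ob n\<close> is the image of a constructible set, given by the solutions of a linear system that
  depends polynomially on the parameter \<open>y\<close>; this is the shape of the orbits of module structures.\<close>

lemma countable_cover_finite:
  fixes Eqs :: "(('i \<Rightarrow> 'k::alg_closed_field) \<Rightarrow> 'k) set"
    and L :: "nat \<Rightarrow> ('e \<Rightarrow> ('i \<Rightarrow> 'k) \<Rightarrow> 'k) set"
  assumes unc: "uncountable (UNIV :: 'k set)" and J: "countable J" and K: "finite K"
    and Eqs: "Eqs \<subseteq> polyfun J" and L: "\<And>n. finite (L n)"
    and row: "\<And>n r \<kappa>. r \<in> L n \<Longrightarrow> \<kappa> \<in> K \<Longrightarrow> r \<kappa> \<in> polyfun J"
    and \<delta>_cong: "\<And>\<phi> \<psi>. (\<And>\<kappa>. \<kappa> \<in> K \<Longrightarrow> \<phi> \<kappa> = \<psi> \<kappa>) \<Longrightarrow> \<delta> \<phi> = \<delta> \<psi>"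
    and \<delta>_poly: "\<And>\<psi>. (\<And>\<kappa>. \<kappa> \<in> K \<Longrightarrow> \<psi> \<kappa> \<in> polyfun J) \<Longrightarrow> (\<lambda>y. \<delta> (\<lambda>\<kappa>. \<psi> \<kappa> y)) \<in> polyfun J"
    and Ob_def: "\<And>n. Ob n = {y. \<exists>\<phi>. (\<forall>r\<in>L n. (\<Sum>\<kappa>\<in>K. r \<kappa> y * \<phi> \<kappa>) = 0) \<and> \<delta> \<phi> \<noteq> (0 :: 'k)}"
    and cover: "\<And>y. (\<forall>f\<in>Eqs. f y = 0) \<Longrightarrow> \<exists>n. y \<in> Ob n"
  shows "\<exists>N. \<forall>y. (\<forall>f\<in>Eqs. f y = 0) \<longrightarrow> (\<exists>n<N. y \<in> Ob n)"
proof (rule ccontr)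
  assume no: "\<not> ?thesis"
  define Q where "Q = {y. \<forall>f\<in>Eqs. f y = 0}"
  have noQ: "\<nexists>N. \<forall>y\<in>Q. \<exists>n<N. y \<in> Ob n" using no by (simp add: Q_def)
  \<comment> \<open>A finite part of the family involves finitely many n, all below some N, and by
    assumption a point of Q escapes every \<open>Ob n\<close> with n < N.\<close>
  have fip: "\<Inter>G \<noteq> {}" if G: "finite G" "G \<subseteq> insert Q (range (\<lambda>n. - Ob n))" for G
  proof -
    have "G - {Q} \<subseteq> (\<lambda>n. - Ob n) ` UNIV" "finite (G - {Q})" using G by auto
    then obtain C where C: "finite C" "G - {Q} = (\<lambda>n. - Ob n) ` C"
      by (meson finite_subset_image)
    obtain N where N: "\<forall>n\<in>C. n < N" using C(1) finite_nat_set_iff_bounded by blast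
    obtain y where y: "y \<in> Q" "\<forall>n<N. y \<notin> Ob n" using noQ by blast
    have "y \<in> B" if "B \<in> G" for B
    proof (cases "B = Q")
      case False
      then have "B \<in> (\<lambda>n. - Ob n) ` C" using that by (simp add: C(2)[symmetric])
      then show ?thesis using N y(2) by auto
    qed (use y in simp)
    then have "y \<in> \<Inter>G" by (rule InterI)
    then show ?thesis by (metis empty_iff)
  qed
  have "\<exists>U. insert Q (range (\<lambda>n. - Ob n)) \<subseteq> U \<and> {} \<notin> U \<and> (\<forall>A\<in>U. \<forall>B\<in>U. A \<inter> B \<in> U) \<and>
    (\<forall>A\<in>U. \<forall>B. A \<subseteq> B \<longrightarrow> B \<in> U) \<and> (\<forall>A. A \<in> U \<or> - A \<in> U)"
    by (rule ultrafilter_exists) (rule fip)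
  then obtain U where U0: "insert Q (range (\<lambda>n. - Ob n)) \<subseteq> U \<and> {} \<notin> U \<and> (\<forall>A\<in>U. \<forall>B\<in>U. A \<inter> B \<in> U) \<and>
    (\<forall>A\<in>U. \<forall>B. A \<subseteq> B \<longrightarrow> B \<in> U) \<and> (\<forall>A. A \<in> U \<or> - A \<in> U)" by (rule exE)
  have QU: "Q \<in> U" and OU: "\<And>n. - Ob n \<in> U" using U0 by (simp_all add: image_subset_iff)
  have "\<forall>A\<in>U. \<forall>B\<in>U. A \<inter> B \<in> U" "\<forall>A\<in>U. \<forall>B. A \<subseteq> B \<longrightarrow> B \<in> U" using U0 by simp_all
  note U23 = this[rule_format]
  have U14: "{} \<notin> U" "\<And>A. A \<in> U \<or> - A \<in> U" using U0 by simp_all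
  note U = U14(1) U23 U14(2)
  have Ufin: "(\<Inter>a\<in>A. B a) \<in> U" if "finite A" "\<And>a. a \<in> A \<Longrightarrow> B a \<in> U" for A and B :: "'x \<Rightarrow> ('i \<Rightarrow> 'k) set"
    using that
  proof (induction A rule: finite_induct)
    case empty then show ?case using U(3)[OF QU] by simp
  next
    case (insert a A) then show ?case using U(2) by simp
  qed
  \<comment> \<open>An ultrafilter that contains the zero set of a product contains the zero set of
    one of the factors, which is why P is prime.\<close>
  define P where "P = {f \<in> polyfun J. {y. f y = 0} \<in> U}"
  have idl: "poly_ideal J P"
  proof (rule poly_idealI)
    show "P \<subseteq> polyfun J" by (auto simp: P_def)
    show "(\<lambda>_. 0) \<in> P" using U(3)[OF QU] by (simp add: P_def polyfun_const)
  next
    fix f g assume fg: "f \<in> P" "g \<in> P"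
    then have "{y. f y = 0} \<inter> {y. g y = 0} \<in> U" using U(2) by (simp add: P_def)
    then have "{y. f y + g y = 0} \<in> U" by (rule U(3)) auto
    then show "(\<lambda>y. f y + g y) \<in> P" using fg by (simp add: P_def polyfun_add)
  next
    fix f g :: "('i \<Rightarrow> 'k) \<Rightarrow> 'k" assume fg: "f \<in> P" "g \<in> polyfun J"
    then have "{y. f y = 0} \<in> U" by (simp add: P_def)
    then have "{y. f y * g y = 0} \<in> U" by (rule U(3)) auto
    then show "(\<lambda>y. f y * g y) \<in> P" using fg by (simp add: P_def polyfun_mult)
  qed
  have "(\<lambda>_. 1) \<notin> P" using U(1) by (simp add: P_def)
  moreover have "f \<in> P \<or> g \<in> P" if fg: "f \<in> polyfun J" "g \<in> polyfun J" "(\<lambda>y. f y * g y) \<in> P" for f g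
  proof (rule ccontr)
    assume "\<not> ?thesis"
    then have "- {y. f y = 0} \<in> U" "- {y. g y = 0} \<in> U" using U(4) fg(1,2) by (auto simp: P_def)
    moreover have "{y. f y * g y = 0} \<in> U" using fg(3) by (simp add: P_def)
    ultimately have "{y. f y * g y = 0} \<inter> (- {y. f y = 0} \<inter> - {y. g y = 0}) \<in> U" using U(2) by simp
    moreover have "{y. f y * g y = 0} \<inter> (- {y. f y = 0} \<inter> - {y. g y = 0}) = {}" by auto
    ultimately show False using U(1) by simp
  qed
  ultimately have prime: "poly_prime J P" using idl by (simp add: poly_prime_def)
  have EqP: "f \<in> P" if "f \<in> Eqs" for f
  proof -
    have "{y. f y = 0} \<in> U" using that by (intro U(3)[OF QU]) (auto simp: Q_def)
    then show ?thesis using that Eqs by (auto simp: P_def)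
  qed
  have "\<forall>n. \<exists>\<mu>. \<mu> \<in> polyfun J \<and> \<mu> \<notin> P \<and> (\<forall>y. (\<forall>f\<in>P. f y = 0) \<and> \<mu> y \<noteq> 0 \<longrightarrow> y \<notin> Ob n)"
  proof
    fix n
    have "\<exists>\<mu> d \<Phi>. generic_kernel_basis J P K (L n) \<mu> d \<Phi>"
      using row by (intro generic_kernel[OF prime K L]) simp
    then obtain \<mu> d \<Phi> where "generic_kernel_basis J P K (L n) \<mu> d \<Phi>" by (elim exE) (rule that)
    then have \<mu>: "\<mu> \<in> polyfun J" "\<mu> \<notin> P"
      and \<Phi>: "\<forall>i<d. \<forall>\<kappa>\<in>K. \<Phi> i \<kappa> \<in> polyfun J" "\<forall>i<d. \<forall>r\<in>L n. (\<lambda>y. \<Sum>\<kappa>\<in>K. r \<kappa> y * \<Phi> i \<kappa> y) \<in> P"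
      and sp: "\<forall>y \<phi>. (\<forall>f\<in>P. f y = 0) \<and> \<mu> y \<noteq> 0 \<and> (\<forall>r\<in>L n. (\<Sum>\<kappa>\<in>K. r \<kappa> y * \<phi> \<kappa>) = 0) \<longrightarrow>
        (\<exists>t. \<forall>\<kappa>\<in>K. \<phi> \<kappa> = (\<Sum>i<d. t i * \<Phi> i \<kappa> y))" unfolding generic_kernel_basis_def by simp_all
    \<comment> \<open>W collects the points at which the vectors \<open>\<Phi> i\<close> solve the
      system exactly; it belongs to U because only finitely many members of P are involved. At a
      point of W a nonzero \<delta> would exhibit membership in \<open>Ob n\<close>, whose
      complement belongs to U.\<close>
    have van: "(\<lambda>y. \<delta> (\<lambda>\<kappa>. \<Sum>i<d. t i * \<Phi> i \<kappa> y)) \<in> P" for t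
    proof -
      define W where "W = (\<Inter>(r, i)\<in>L n \<times> {..<d}. {y. (\<Sum>\<kappa>\<in>K. r \<kappa> y * \<Phi> i \<kappa> y) = 0})"
      have "W \<in> U" unfolding W_def using \<Phi>(2) L by (intro Ufin) (auto simp: P_def)
      then have "W \<inter> - Ob n \<in> U" using U(2) OU by blast
      moreover have "\<delta> (\<lambda>\<kappa>. \<Sum>i<d. t i * \<Phi> i \<kappa> y) = 0" if y: "y \<in> W" "y \<notin> Ob n" for y
      proof -
        have "(\<Sum>\<kappa>\<in>K. r \<kappa> y * (\<Sum>i<d. t i * \<Phi> i \<kappa> y)) = 0" if r: "r \<in> L n" for r
        proof -
          have "(\<Sum>\<kappa>\<in>K. r \<kappa> y * (\<Sum>i<d. t i * \<Phi> i \<kappa> y)) = (\<Sum>\<kappa>\<in>K. \<Sum>i<d. r \<kappa> y * (t i * \<Phi> i \<kappa> y))"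
            by (simp add: sum_distrib_left)
          also have "\<dots> = (\<Sum>i<d. t i * (\<Sum>\<kappa>\<in>K. r \<kappa> y * \<Phi> i \<kappa> y))"
            by (subst sum.swap) (simp add: sum_distrib_left mult_ac)
          also have "\<dots> = 0" using y(1) r by (intro sum.neutral) (auto simp: W_def)
          finally show ?thesis .
        qed
        moreover have "y \<in> Ob n" if "\<delta> (\<lambda>\<kappa>. \<Sum>i<d. t i * \<Phi> i \<kappa> y) \<noteq> 0"
          unfolding Ob_def using that calculation
          by (intro CollectI exI[of _ "\<lambda>\<kappa>. \<Sum>i<d. t i * \<Phi> i \<kappa> y"] conjI ballI)
        ultimately show ?thesis using y(2) by blast
      qed
      ultimately have "{y. \<delta> (\<lambda>\<kappa>. \<Sum>i<d. t i * \<Phi> i \<kappa> y) = 0} \<in> U" by (elim U(3)) auto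
      moreover have "(\<lambda>y. \<delta> (\<lambda>\<kappa>. \<Sum>i<d. t i * \<Phi> i \<kappa> y)) \<in> polyfun J"
        using \<Phi>(1) by (intro \<delta>_poly polyfun_sum polyfun_mult polyfun_const) auto
      ultimately show ?thesis by (simp add: P_def)
    qed
    have "y \<notin> Ob n" if y: "\<forall>f\<in>P. f y = 0" "\<mu> y \<noteq> 0" for y
    proof
      assume "y \<in> Ob n"
      then obtain \<phi> where \<phi>: "\<forall>r\<in>L n. (\<Sum>\<kappa>\<in>K. r \<kappa> y * \<phi> \<kappa>) = 0" "\<delta> \<phi> \<noteq> 0" unfolding Ob_def by auto
      then obtain t where t: "\<forall>\<kappa>\<in>K. \<phi> \<kappa> = (\<Sum>i<d. t i * \<Phi> i \<kappa> y)" using sp y by blast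
      \<comment> \<open>The constants t depend on y, but once t is fixed the polynomial of
        \<open>van\<close> lies in P and therefore vanishes at y.\<close>
      have "\<delta> \<phi> = \<delta> (\<lambda>\<kappa>. \<Sum>i<d. t i * \<Phi> i \<kappa> y)" using t by (intro \<delta>_cong) simp
      also have "\<dots> = 0" using van[of t] y(1) by auto
      finally show False using \<phi>(2) by simp
    qed
    then show "\<exists>\<mu>. \<mu> \<in> polyfun J \<and> \<mu> \<notin> P \<and> (\<forall>y. (\<forall>f\<in>P. f y = 0) \<and> \<mu> y \<noteq> 0 \<longrightarrow> y \<notin> Ob n)"
      using \<mu> by blast
  qed
  from choice[OF this] obtain \<mu> where \<mu>: "\<And>n. \<mu> n \<in> polyfun J" "\<And>n. \<mu> n \<notin> P"
    "\<And>n y. (\<forall>f\<in>P. f y = 0) \<Longrightarrow> \<mu> n y \<noteq> 0 \<Longrightarrow> y \<notin> Ob n" by auto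
  \<comment> \<open>Finite products of the \<open>\<mu> n\<close>: countably many, closed under
    multiplication, and outside P by primality.\<close>
  define Sg where "Sg = range (\<lambda>ns y. \<Prod>n\<leftarrow>ns. \<mu> n y)"
  have Sg: "(\<lambda>y. \<Prod>n\<leftarrow>ns. \<mu> n y) \<in> polyfun J \<and> (\<lambda>y. \<Prod>n\<leftarrow>ns. \<mu> n y) \<notin> P" for ns
  proof (induction ns)
    case Nil then show ?case using poly_primeD(2)[OF prime] by (simp add: polyfun_const)
  next
    case (Cons n ns)
    then have "(\<lambda>y. \<mu> n y * (\<Prod>n\<leftarrow>ns. \<mu> n y)) \<in> polyfun J" using \<mu>(1) by (intro polyfun_mult) simp_all
    moreover have "(\<lambda>y. \<mu> n y * (\<Prod>n\<leftarrow>ns. \<mu> n y)) \<notin> P"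
      using poly_primeD(3)[OF prime \<mu>(1)[of n], of "\<lambda>y. \<Prod>n\<leftarrow>ns. \<mu> n y"] Cons \<mu>(2)[of n] by auto
    ultimately show ?case by simp
  qed
  have "\<exists>y. (\<forall>f\<in>P. f y = 0) \<and> (\<forall>s\<in>Sg. s y \<noteq> 0)"
  proof (rule generic_point[OF unc J idl])
    show "Sg \<subseteq> polyfun J" "P \<inter> Sg = {}" using Sg by (auto simp: Sg_def)
    show "(\<lambda>_. 1) \<in> Sg" unfolding Sg_def by (rule range_eqI[of _ _ "[]"]) simp
    show "countable Sg" by (simp add: Sg_def)
  next
    fix s t assume "s \<in> Sg" "t \<in> Sg"
    then obtain ms ns where "s = (\<lambda>y. \<Prod>n\<leftarrow>ms. \<mu> n y)" "t = (\<lambda>y. \<Prod>n\<leftarrow>ns. \<mu> n y)" by (auto simp: Sg_def)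
    then show "(\<lambda>x. s x * t x) \<in> Sg" unfolding Sg_def by (intro range_eqI[of _ _ "ms @ ns"]) simp
  qed
  then obtain y where y: "\<forall>f\<in>P. f y = 0" "\<forall>s\<in>Sg. s y \<noteq> 0" by blast
  have "\<mu> n y \<noteq> 0" for n
  proof -
    have "(\<lambda>y. \<Prod>n\<leftarrow>[n]. \<mu> n y) \<in> Sg" unfolding Sg_def by (rule rangeI)
    then show ?thesis using y(2) by fastforce
  qed
  then have "y \<notin> Ob n" for n using \<mu>(3) y(1) by blast
  moreover have "\<exists>n. y \<in> Ob n" using y(1) EqP by (intro cover) blast
  ultimately show False by blast
qed

section \<open>Graded modules on additive subgroups of a type\<close>

definition homog_decomp :: "(int \<Rightarrow> 'm::ab_group_add set) \<Rightarrow> (int \<Rightarrow> 'm) \<Rightarrow> 'm \<Rightarrow> bool" where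
  "homog_decomp G f x \<longleftrightarrow> (\<forall>i. f i \<in> G i) \<and> finite {i. f i \<noteq> 0} \<and> x = (\<Sum>i\<in>{i. f i \<noteq> 0}. f i)"

text \<open>Uniqueness is demanded only for decompositions of 0; since differences of decompositions
  are decompositions, it follows for every element.\<close>

definition direct_grading :: "'m::ab_group_add set \<Rightarrow> (int \<Rightarrow> 'm set) \<Rightarrow> bool" where
  "direct_grading A G \<longleftrightarrow> (\<forall>i. 0 \<in> G i \<and> G i \<subseteq> A \<and> (\<forall>x\<in>G i. \<forall>y\<in>G i. x - y \<in> G i)) \<and>
     (\<forall>x\<in>A. \<exists>f. homog_decomp G f x) \<and> (\<forall>f. homog_decomp G f 0 \<longrightarrow> (\<forall>i. f i = 0))"

definition homog_comp :: "(int \<Rightarrow> 'm::ab_group_add set) \<Rightarrow> 'm \<Rightarrow> int \<Rightarrow> 'm" where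
  "homog_comp G x = (SOME f. homog_decomp G f x)"

lemma homog_decompI:
  assumes "finite I" "\<And>i. i \<notin> I \<Longrightarrow> f i = 0" "\<And>i. f i \<in> G i" "x = (\<Sum>i\<in>I. f i)"
  shows "homog_decomp G f x"
proof -
  have "{i. f i \<noteq> 0} \<subseteq> I" using assms(2) by auto
  moreover from this have "(\<Sum>i\<in>{i. f i \<noteq> 0}. f i) = (\<Sum>i\<in>I. f i)"
    using assms(1) by (intro sum.mono_neutral_left) auto
  ultimately show ?thesis using assms finite_subset unfolding homog_decomp_def by auto
qed

lemma homog_decomp_sum:
  assumes "homog_decomp G f x" "finite I" "{i. f i \<noteq> 0} \<subseteq> I"
  shows "x = (\<Sum>i\<in>I. f i)"
proof -
  have "(\<Sum>i\<in>{i. f i \<noteq> 0}. f i) = (\<Sum>i\<in>I. f i)" using assms(2,3) by (intro sum.mono_neutral_left) auto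
  then show ?thesis using assms(1) by (simp add: homog_decomp_def)
qed

lemma direct_gradingD:
  assumes "direct_grading A G"
  shows "0 \<in> G i" "x \<in> G i \<Longrightarrow> x \<in> A" "x \<in> G i \<Longrightarrow> y \<in> G i \<Longrightarrow> x - y \<in> G i"
    "x \<in> A \<Longrightarrow> \<exists>f. homog_decomp G f x" "homog_decomp G f 0 \<Longrightarrow> f i = 0"
  using assms unfolding direct_grading_def by blast+

lemma direct_grading_uminus: "direct_grading A G \<Longrightarrow> x \<in> G i \<Longrightarrow> - x \<in> G i"
  using direct_gradingD(3)[of A G 0 i x] direct_gradingD(1)[of A G i] by simp

lemma direct_grading_add: "direct_grading A G \<Longrightarrow> x \<in> G i \<Longrightarrow> y \<in> G i \<Longrightarrow> x + y \<in> G i"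
  using direct_gradingD(3)[of A G x i "- y"] direct_grading_uminus[of A G y i] by simp

lemma direct_grading_sum:
  "direct_grading A G \<Longrightarrow> (\<And>a. a \<in> I \<Longrightarrow> f a \<in> G i) \<Longrightarrow> sum f I \<in> G i"
  by (induction I rule: infinite_finite_induct) (auto intro: direct_gradingD(1) direct_grading_add)

lemma homog_decomp_diff:
  assumes "direct_grading A G" "homog_decomp G f x" "homog_decomp G g y"
  shows "homog_decomp G (\<lambda>i. f i - g i) (x - y)"
proof -
  let ?I = "{i. f i \<noteq> 0} \<union> {i. g i \<noteq> 0}"
  have fin: "finite ?I" using assms by (auto simp: homog_decomp_def)
  have "x = (\<Sum>i\<in>?I. f i)" by (rule homog_decomp_sum[OF assms(2) fin]) blast
  moreover have "y = (\<Sum>i\<in>?I. g i)" by (rule homog_decomp_sum[OF assms(3) fin]) blast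
  ultimately have "x - y = (\<Sum>i\<in>?I. f i - g i)" by (simp add: sum_subtractf)
  then show ?thesis
    using direct_gradingD(3)[OF assms(1)] assms(2,3)
    by (intro homog_decompI[OF fin]) (auto simp: homog_decomp_def)
qed

lemma homog_decomp_unique:
  assumes "direct_grading A G" "homog_decomp G f x" "homog_decomp G g x"
  shows "f = g"
proof
  fix i
  have "homog_decomp G (\<lambda>i. f i - g i) 0" using homog_decomp_diff[OF assms] by simp
  from direct_gradingD(5)[OF assms(1) this, of i] show "f i = g i" by simp
qed

lemma homog_decomp_single:
  "direct_grading A G \<Longrightarrow> x \<in> G j \<Longrightarrow> homog_decomp G (\<lambda>i. if i = j then x else 0) x"
  by (rule homog_decompI[of "{j}"]) (auto intro: direct_gradingD(1))

lemma homog_comp_decomp: "direct_grading A G \<Longrightarrow> x \<in> A \<Longrightarrow> homog_decomp G (homog_comp G x) x"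
  unfolding homog_comp_def using direct_gradingD(4) by (metis someI_ex)

lemma homog_comp_eqI: "direct_grading A G \<Longrightarrow> homog_decomp G f x \<Longrightarrow> homog_comp G x = f"
  unfolding homog_comp_def using homog_decomp_unique by (metis (mono_tags) someI)

lemma homog_comp_in: "direct_grading A G \<Longrightarrow> x \<in> A \<Longrightarrow> homog_comp G x i \<in> G i"
  using homog_comp_decomp by (auto simp: homog_decomp_def)

lemma homog_comp_fin: "direct_grading A G \<Longrightarrow> x \<in> A \<Longrightarrow> finite {i. homog_comp G x i \<noteq> 0}"
  using homog_comp_decomp by (auto simp: homog_decomp_def)

lemma homog_comp_single:
  "direct_grading A G \<Longrightarrow> x \<in> G j \<Longrightarrow> homog_comp G x i = (if i = j then x else 0)"
  using homog_comp_eqI[OF _ homog_decomp_single] by metis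

lemma homog_comp_diff:
  "direct_grading A G \<Longrightarrow> x \<in> A \<Longrightarrow> y \<in> A \<Longrightarrow> homog_comp G (x - y) i = homog_comp G x i - homog_comp G y i"
  using homog_comp_eqI[OF _ homog_decomp_diff[OF _ homog_comp_decomp homog_comp_decomp]] by metis

text \<open>Additivity of f is given on A alone, so membership of the partial sums in A is carried
  along in the induction.\<close>

lemma additive_sum:
  assumes "0 \<in> A" "\<And>x y. x \<in> A \<Longrightarrow> y \<in> A \<Longrightarrow> x + y \<in> A"
    and "\<And>x y. x \<in> A \<Longrightarrow> y \<in> A \<Longrightarrow> f (x + y) = f x + f y" "\<And>i. i \<in> I \<Longrightarrow> g i \<in> A"
  shows "f (sum g I) = (\<Sum>i\<in>I. f (g i) :: 'b::ab_group_add) \<and> sum g I \<in> A"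
  using assms(4)
proof (induction I rule: infinite_finite_induct)
  case empty
  have "f (0 + 0) = f 0 + f 0" using assms(1,3) by blast
  then show ?case using assms(1) by simp
next
  case (infinite I)
  have "f (0 + 0) = f 0 + f 0" using assms(1,3) by blast
  then show ?case using assms(1) infinite by simp
qed (use assms in simp)

text \<open>The homogeneous components of a preimage of y map to components of y. If y has degree j,
  uniqueness leaves only degree j, and the component there is a homogeneous preimage. Later
  isomorphisms thus have to be checked for degrees in one direction only.\<close>

lemma additive_bij_grading:
  assumes G: "direct_grading A G" and H: "direct_grading B H"
    and A: "\<And>x y. x \<in> A \<Longrightarrow> y \<in> A \<Longrightarrow> x + y \<in> A"
    and f: "\<And>x y. x \<in> A \<Longrightarrow> y \<in> A \<Longrightarrow> f (x + y) = f x + f y" and bij: "bij_betw f A B"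
    and le: "\<And>j x. x \<in> G j \<Longrightarrow> f x \<in> H j"
  shows "f ` G j = H j"
proof
  show "f ` G j \<subseteq> H j" using le by auto
  have A0: "0 \<in> A" using direct_gradingD(1,2)[OF G] by blast
  have f0: "f 0 = 0" using f[OF A0 A0] by simp
  show "H j \<subseteq> f ` G j"
  proof
    fix y assume y: "y \<in> H j"
    then obtain x where x: "x \<in> A" "y = f x" using bij direct_gradingD(2)[OF H] unfolding bij_betw_def by blast
    let ?g = "homog_comp G x"
    have g: "homog_decomp G ?g x" by (rule homog_comp_decomp[OF G x(1)])
    let ?I = "{i. ?g i \<noteq> 0}"
    have gA: "?g i \<in> A" for i using homog_comp_in[OF G x(1)] direct_gradingD(2)[OF G] by blast
    have "y = (\<Sum>i\<in>?I. f (?g i))"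
      using additive_sum[of A f ?I ?g] A0 A f gA g x(2) unfolding homog_decomp_def by simp
    then have "homog_decomp H (\<lambda>i. f (?g i)) y"
      using homog_comp_fin[OF G x(1)] f0 le[OF homog_comp_in[OF G x(1)]] by (intro homog_decompI[of ?I]) auto
    then have "(\<lambda>i. f (?g i)) = (\<lambda>i. if i = j then y else 0)"
      using homog_decomp_unique[OF H] homog_decomp_single[OF H y] by blast
    then have "f (?g i) = (if i = j then y else 0)" for i by meson
    then have "f (?g j) = y" by simp
    then show "y \<in> f ` G j" using homog_comp_in[OF G x(1)] by blast
  qed
qed

section \<open>Graded modules and graded bases\<close>

text \<open>The carrier is a subgroup of a type of class \<open>ab_group_add\<close>, so that sums
  are the ordinary ones of the type; the laws for \<open>act\<close> are required on A
  alone.\<close>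

locale typed_gmodule =
  fixes Rg :: "int \<Rightarrow> 'r::comm_ring_1 set" and A :: "'m::ab_group_add set"
    and act :: "'r \<Rightarrow> 'm \<Rightarrow> 'm" and G :: "int \<Rightarrow> 'm set"
  assumes grading: "direct_grading A G"
    and diff_closed: "x \<in> A \<Longrightarrow> y \<in> A \<Longrightarrow> x - y \<in> A"
    and act_closed: "x \<in> A \<Longrightarrow> act r x \<in> A"
    and act_add: "x \<in> A \<Longrightarrow> y \<in> A \<Longrightarrow> act r (x + y) = act r x + act r y"
    and add_act: "x \<in> A \<Longrightarrow> act (r + s) x = act r x + act s x"
    and act_act: "x \<in> A \<Longrightarrow> act (r * s) x = act r (act s x)"
    and act_one: "x \<in> A \<Longrightarrow> act 1 x = x"
    and act_homog: "r \<in> Rg i \<Longrightarrow> x \<in> G j \<Longrightarrow> act r x \<in> G (i + j)"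
begin

lemma zero_closed: "0 \<in> A" using direct_gradingD(1,2)[OF grading] by blast
lemma uminus_closed: "x \<in> A \<Longrightarrow> - x \<in> A" using diff_closed[OF zero_closed] by simp
lemma add_closed: "x \<in> A \<Longrightarrow> y \<in> A \<Longrightarrow> x + y \<in> A" using diff_closed[OF _ uminus_closed] by fastforce
lemma sum_closed: "(\<And>i. i \<in> I \<Longrightarrow> f i \<in> A) \<Longrightarrow> sum f I \<in> A"
  by (induction I rule: infinite_finite_induct) (auto intro: zero_closed add_closed)
lemma homog_closed: "x \<in> G j \<Longrightarrow> x \<in> A" using direct_gradingD(2)[OF grading] .
lemma act_zero: "act r 0 = 0" using act_add[OF zero_closed zero_closed] by simp
lemma zero_act: "x \<in> A \<Longrightarrow> act 0 x = 0" using add_act[of x 0 0] by simp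
lemma uminus_act: "x \<in> A \<Longrightarrow> act (- r) x = - act r x"
  using add_act[of x r "- r"] zero_act by (simp add: eq_neg_iff_add_eq_0 add.commute)
lemma diff_act: "x \<in> A \<Longrightarrow> act (r - s) x = act r x - act s x"
  using add_act[of x r "- s"] uminus_act by simp
lemma act_sum: "(\<And>i. i \<in> I \<Longrightarrow> f i \<in> A) \<Longrightarrow> act r (sum f I) = (\<Sum>i\<in>I. act r (f i))"
  using additive_sum[of A "act r" I f] zero_closed add_closed act_add by blast
lemma sum_act: "x \<in> A \<Longrightarrow> act (sum f I) x = (\<Sum>i\<in>I. act (f i) x)"
  by (induction I rule: infinite_finite_induct) (auto simp: zero_act add_act)

end

text \<open>The sign follows the shift convention: the generator of \<open>S(l_i)\<close> sits in
  degree \<open>- l i\<close>. The index set is an arbitrary finite set because a basis of a summand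
  is selected as a part of a basis of the whole.\<close>

definition homog_basis ::
    "'r::comm_ring_1 set \<Rightarrow> 'm::ab_group_add set \<Rightarrow> ('r \<Rightarrow> 'm \<Rightarrow> 'm) \<Rightarrow> (int \<Rightarrow> 'm set) \<Rightarrow>
     nat set \<Rightarrow> (nat \<Rightarrow> 'm) \<Rightarrow> (nat \<Rightarrow> int) \<Rightarrow> bool" where
  "homog_basis S A act G I e l \<longleftrightarrow> finite I \<and> (\<forall>i\<in>I. e i \<in> G (- l i)) \<and>
     (\<forall>x\<in>A. \<exists>f. (\<forall>i\<in>I. f i \<in> S) \<and> x = (\<Sum>i\<in>I. act (f i) (e i))) \<and>
     (\<forall>f. (\<forall>i\<in>I. f i \<in> S) \<and> (\<Sum>i\<in>I. act (f i) (e i)) = 0 \<longrightarrow> (\<forall>i\<in>I. f i = 0))"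

lemma homog_basisD:
  assumes "homog_basis S A act G I e l"
  shows "finite I" "i \<in> I \<Longrightarrow> e i \<in> G (- l i)"
    "x \<in> A \<Longrightarrow> \<exists>f. (\<forall>i\<in>I. f i \<in> S) \<and> x = (\<Sum>i\<in>I. act (f i) (e i))"
    "(\<And>i. i \<in> I \<Longrightarrow> f i \<in> S) \<Longrightarrow> (\<Sum>i\<in>I. act (f i) (e i)) = 0 \<Longrightarrow> i \<in> I \<Longrightarrow> f i = 0"
  using assms unfolding homog_basis_def by blast+

text \<open>What a Noether normalization provides. \<open>Rg_0\<close> makes nonzero elements of
  degree 0 invertible, which drives the exchange of basis elements and the determinant criterion;
  \<open>S_fin\<close> bounds the dimension of the homogeneous components of S, which makes the
  parameter spaces finite dimensional.\<close>

locale graded_setup =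
  fixes \<iota> :: "'k::field \<Rightarrow> 'r::comm_ring_1" and Rg :: "int \<Rightarrow> 'r set" and S :: "'r set"
  assumes iota_add: "\<iota> (a + b) = \<iota> a + \<iota> b" and iota_mult: "\<iota> (a * b) = \<iota> a * \<iota> b"
    and iota_one: "\<iota> 1 = 1"
    and Rg: "direct_grading UNIV Rg" and Rg_mult: "r \<in> Rg i \<Longrightarrow> s \<in> Rg j \<Longrightarrow> r * s \<in> Rg (i + j)"
    and Rg_neg: "i < 0 \<Longrightarrow> Rg i = {0}" and Rg_0: "Rg 0 = range \<iota>"
    and iota_S: "\<iota> c \<in> S" and S_diff: "r \<in> S \<Longrightarrow> s \<in> S \<Longrightarrow> r - s \<in> S"
    and S_mult: "r \<in> S \<Longrightarrow> s \<in> S \<Longrightarrow> r * s \<in> S"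
    and S_homog: "s \<in> S \<Longrightarrow> homog_comp Rg s i \<in> S"
    and S_fin: "\<exists>T. finite T \<and> T \<subseteq> S \<inter> Rg d \<and> (\<forall>s\<in>S \<inter> Rg d. \<exists>c. s = (\<Sum>t\<in>T. \<iota> (c t) * t))"
begin

lemma iota_zero: "\<iota> 0 = 0" using iota_add[of 0 0] by simp
lemma iota_uminus: "\<iota> (- a) = - \<iota> a"
  using iota_add[of a "- a"] iota_zero by (simp add: eq_neg_iff_add_eq_0 add.commute)
lemma iota_inverse: "a \<noteq> 0 \<Longrightarrow> \<iota> (inverse a) * \<iota> a = 1" using iota_mult[of "inverse a" a] iota_one by simp
lemma iota_eq_0: "\<iota> a = 0 \<longleftrightarrow> a = 0" using iota_inverse[of a] iota_zero by force
lemma S_0: "0 \<in> S" and S_1: "1 \<in> S" using iota_S[of 0] iota_S[of 1] iota_zero iota_one by simp_all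
lemma S_uminus: "s \<in> S \<Longrightarrow> - s \<in> S" using S_diff[OF S_0] by simp
lemma S_add: "r \<in> S \<Longrightarrow> s \<in> S \<Longrightarrow> r + s \<in> S" using S_diff[OF _ S_uminus] by fastforce
lemma S_sum: "(\<And>i. i \<in> I \<Longrightarrow> f i \<in> S) \<Longrightarrow> sum f I \<in> S"
  by (induction I rule: infinite_finite_induct) (auto intro: S_0 S_add)
lemma one_Rg: "1 \<in> Rg 0" using Rg_0 iota_one by (metis rangeI)

lemma basis_closed:
  assumes "typed_gmodule Rg A act G" "homog_basis S A act G I e l"
  shows "i \<in> I \<Longrightarrow> e i \<in> A" "i \<in> I \<Longrightarrow> act r (e i) \<in> A"
  using typed_gmodule.homog_closed[OF assms(1)] homog_basisD(2)[OF assms(2)] typed_gmodule.act_closed[OF assms(1)]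
  by blast+

lemma basis_unique:
  assumes M: "typed_gmodule Rg A act G" and b: "homog_basis S A act G I e l"
    and fg: "\<And>i. i \<in> I \<Longrightarrow> f i \<in> S" "\<And>i. i \<in> I \<Longrightarrow> g i \<in> S"
    and eq: "(\<Sum>i\<in>I. act (f i) (e i)) = (\<Sum>i\<in>I. act (g i) (e i))" and i: "i \<in> I"
  shows "f i = g i"
proof -
  have "(\<Sum>i\<in>I. act (f i - g i) (e i)) = (\<Sum>i\<in>I. act (f i) (e i) - act (g i) (e i))"
    using typed_gmodule.diff_act[OF M] basis_closed(1)[OF M b] by (intro sum.cong) auto
  also have "\<dots> = 0" using eq by (simp add: sum_subtractf)
  finally have "f i - g i = 0"
    using homog_basisD(4)[OF b, of "\<lambda>i. f i - g i" i] fg S_diff i by blast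
  then show ?thesis by simp
qed

text \<open>The coefficients are split into homogeneous components and regrouped by total degree:
  \<open>u p\<close> is the part of the sum in degree p. As x is homogeneous of degree j, uniqueness
  of decompositions gives \<open>x = u j\<close>, and uniqueness of coordinates compares the
  coefficients.\<close>

lemma basis_coeff_homog:
  assumes M: "typed_gmodule Rg A act G" and b: "homog_basis S A act G I e l"
    and f: "\<And>i. i \<in> I \<Longrightarrow> f i \<in> S" and x: "x \<in> G j" "x = (\<Sum>i\<in>I. act (f i) (e i))" and i: "i \<in> I"
  shows "f i \<in> Rg (j + l i)"
proof -
  interpret M: typed_gmodule Rg A act G by (rule M)
  define c where "c i = homog_comp Rg (f i)" for i
  have c: "homog_decomp Rg (c i) (f i)" for i unfolding c_def by (rule homog_comp_decomp[OF Rg UNIV_I])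
  have cS: "c i p \<in> S" if "i \<in> I" for i p unfolding c_def using S_homog f that by blast
  have cR: "c i p \<in> Rg p" for i p using c by (auto simp: homog_decomp_def)
  have fin: "finite I" using homog_basisD(1)[OF b] .
  note eA = basis_closed(1)[OF M b]
  define u where "u p = (\<Sum>i\<in>I. act (c i (p + l i)) (e i))" for p
  \<comment> \<open>A component of degree q of the i-th coefficient contributes in degree
    \<open>q - l i\<close>, because \<open>e i\<close> has degree \<open>- l i\<close>.\<close>
  define PP where "PP = (\<Union>i\<in>I. (\<lambda>q. q - l i) ` {q. c i q \<noteq> 0})"
  have PP: "finite PP" unfolding PP_def using fin c by (auto simp: homog_decomp_def)
  have fi: "f i = (\<Sum>p\<in>PP. c i (p + l i))" if "i \<in> I" for i
  proof -
    have "{q. c i q \<noteq> 0} \<subseteq> (\<lambda>p. p + l i) ` PP"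
    proof
      fix q assume "q \<in> {q. c i q \<noteq> 0}"
      then have "q - l i \<in> PP" unfolding PP_def using that by blast
      then show "q \<in> (\<lambda>p. p + l i) ` PP" by (intro image_eqI[of _ _ "q - l i"]) auto
    qed
    then have "f i = (\<Sum>q\<in>(\<lambda>p. p + l i) ` PP. c i q)" using homog_decomp_sum[OF c] PP by blast
    also have "\<dots> = (\<Sum>p\<in>PP. c i (p + l i))" by (subst sum.reindex) (auto simp: inj_on_def)
    finally show ?thesis .
  qed
  have "x = (\<Sum>i\<in>I. \<Sum>p\<in>PP. act (c i (p + l i)) (e i))"
    unfolding x(2) using fi eA by (intro sum.cong refl) (metis M.sum_act)
  also have "\<dots> = (\<Sum>p\<in>PP. u p)" unfolding u_def by (rule sum.swap)
  finally have xu: "x = (\<Sum>p\<in>PP. u p)" .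
  have "u p \<in> G p" for p
    unfolding u_def
  proof (rule direct_grading_sum[OF M.grading])
    fix i assume "i \<in> I"
    from M.act_homog[OF cR homog_basisD(2)[OF b this], of i "p + l i"]
    show "act (c i (p + l i)) (e i) \<in> G p" by simp
  qed
  moreover have "u p = 0" if "p \<notin> PP" for p
  proof -
    have "c i (p + l i) = 0" if "i \<in> I" for i
    proof (rule ccontr)
      assume "c i (p + l i) \<noteq> 0"
      then have "p \<in> (\<lambda>q. q - l i) ` {q. c i q \<noteq> 0}" by (intro image_eqI[of _ _ "p + l i"]) auto
      then show False using \<open>p \<notin> PP\<close> that unfolding PP_def by blast
    qed
    then show ?thesis unfolding u_def using eA by (intro sum.neutral) (simp add: M.zero_act)
  qed
  ultimately have "homog_decomp G u x" using xu PP by (intro homog_decompI[of PP]) auto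
  then have "u = (\<lambda>i. if i = j then x else 0)"
    using homog_decomp_unique[OF M.grading _ homog_decomp_single[OF M.grading x(1)]] by blast
  then have "x = (\<Sum>i\<in>I. act (c i (j + l i)) (e i))" unfolding u_def by metis
  then have "f i = c i (j + l i)" using x(2) by (intro basis_unique[OF M b f cS _ i]) auto
  then show ?thesis using cR by simp
qed

text \<open>The transition from the old basis to the new one is triangular with the unit
  \<open>\<iota> c\<close> in position i0, hence invertible over S.\<close>

lemma basis_replace:
  assumes M: "typed_gmodule Rg A act G" and b: "homog_basis S A act G I e l" and i0: "i0 \<in> I"
    and \<tau>: "\<tau> \<in> G (- l i0)" "\<tau> = (\<Sum>i\<in>I. act (f i) (e i))" and f: "\<And>i. i \<in> I \<Longrightarrow> f i \<in> S"
    and c: "f i0 = \<iota> c" "c \<noteq> 0"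
  shows "homog_basis S A act G I (e(i0 := \<tau>)) l"
proof -
  interpret M: typed_gmodule Rg A act G by (rule M)
  have fin: "finite I" using homog_basisD(1)[OF b] .
  note eA = basis_closed(1)[OF M b]
  have eA': "act r (e i) \<in> A" if "i \<in> I - {i0}" for r i using eA that M.act_closed by blast
  have \<tau>A: "\<tau> \<in> A" using M.homog_closed[OF \<tau>(1)] .
  have act\<tau>: "act r \<tau> = act (r * f i0) (e i0) + (\<Sum>i\<in>I - {i0}. act (r * f i) (e i))" for r
  proof -
    have "act r \<tau> = (\<Sum>i\<in>I. act r (act (f i) (e i)))"
      unfolding \<tau>(2) using eA M.act_closed by (intro M.act_sum) blast
    also have "\<dots> = (\<Sum>i\<in>I. act (r * f i) (e i))" using eA by (intro sum.cong) (auto simp: M.act_act)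
    also have "\<dots> = act (r * f i0) (e i0) + (\<Sum>i\<in>I - {i0}. act (r * f i) (e i))"
      using sum.remove[OF fin i0] .
    finally show ?thesis .
  qed
  have new: "(\<Sum>i\<in>I. act (g i) ((e(i0 := \<tau>)) i)) =
      act (g i0 * f i0) (e i0) + (\<Sum>i\<in>I - {i0}. act (g i + g i0 * f i) (e i))" for g
  proof -
    have "(\<Sum>i\<in>I. act (g i) ((e(i0 := \<tau>)) i)) = act (g i0) \<tau> + (\<Sum>i\<in>I - {i0}. act (g i) (e i))"
      using sum.remove[OF fin i0, of "\<lambda>i. act (g i) ((e(i0 := \<tau>)) i)"] by simp
    also have "\<dots> = act (g i0 * f i0) (e i0) + (\<Sum>i\<in>I - {i0}. act (g i) (e i) + act (g i0 * f i) (e i))"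
      unfolding act\<tau> by (simp add: sum.distrib algebra_simps)
    also have "(\<Sum>i\<in>I - {i0}. act (g i) (e i) + act (g i0 * f i) (e i)) =
        (\<Sum>i\<in>I - {i0}. act (g i + g i0 * f i) (e i))"
      using eA by (intro sum.cong) (auto simp: M.add_act)
    finally show ?thesis .
  qed
  define u where "u = \<iota> (inverse c)"
  have u: "u \<in> S" "u * f i0 = 1" "f i0 * u = 1"
    using iota_S iota_inverse[OF c(2)] c(1) by (auto simp: u_def mult.commute)
  have "\<exists>g. (\<forall>i\<in>I. g i \<in> S) \<and> x = (\<Sum>i\<in>I. act (g i) ((e(i0 := \<tau>)) i))" if x: "x \<in> A" for x
  proof -
    obtain g where g: "\<forall>i\<in>I. g i \<in> S" "x = (\<Sum>i\<in>I. act (g i) (e i))" using homog_basisD(3)[OF b x] by blast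
    \<comment> \<open>The expansion of \<tau> is solved for \<open>e i0\<close> with the inverse u
      of \<open>f i0\<close>, and the result is substituted into the expansion of x.\<close>
    define h where "h i = (if i = i0 then g i0 * u else g i - g i0 * u * f i)" for i
    have "(\<Sum>i\<in>I. act (h i) ((e(i0 := \<tau>)) i)) = act (g i0) (e i0) + (\<Sum>i\<in>I - {i0}. act (g i) (e i))"
      unfolding new using u by (simp add: h_def mult.assoc)
    also have "\<dots> = x" using g(2) sum.remove[OF fin i0, of "\<lambda>i. act (g i) (e i)"] by simp
    finally have "x = (\<Sum>i\<in>I. act (h i) ((e(i0 := \<tau>)) i))" by simp
    moreover have "\<forall>i\<in>I. h i \<in> S" using g(1) f u(1) i0 by (auto simp: h_def intro!: S_diff S_mult)
    ultimately show ?thesis by blast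
  qed
  moreover have "g i = 0" if g: "\<forall>i\<in>I. g i \<in> S" "(\<Sum>i\<in>I. act (g i) ((e(i0 := \<tau>)) i)) = 0" and i: "i \<in> I" for g i
  proof -
    define h where "h i = (if i = i0 then g i0 * f i0 else g i + g i0 * f i)" for i
    have "(\<Sum>i\<in>I. act (h i) (e i)) = act (h i0) (e i0) + (\<Sum>i\<in>I - {i0}. act (h i) (e i))"
      using sum.remove[OF fin i0] .
    also have "\<dots> = 0" using g(2) unfolding new by (simp add: h_def)
    finally have h_sum: "(\<Sum>i\<in>I. act (h i) (e i)) = 0" .
    have hS: "h i \<in> S" if "i \<in> I" for i
      using that g(1) f i0 by (auto simp: h_def intro!: S_add S_mult)
    have h0: "h i = 0" if "i \<in> I" for i by (rule homog_basisD(4)[OF b hS h_sum that])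
    have "g i0 * f i0 = 0" using h0[OF i0] by (simp add: h_def)
    then have "g i0 * (f i0 * u) = 0" by (metis mult.assoc mult_zero_left)
    then have "g i0 = 0" using u(3) by simp
    then show "g i = 0" using h0[OF i] by (cases "i = i0") (auto simp: h_def)
  qed
  moreover have "\<forall>i\<in>I. (e(i0 := \<tau>)) i \<in> G (- l i)" using homog_basisD(2)[OF b] \<tau>(1) by simp
  ultimately show ?thesis unfolding homog_basis_def using fin by blast
qed

text \<open>A Steinitz exchange: writing \<open>e\<^sub>i = n + p\<close>, the \<open>i\<close>-th coordinates of \<open>n\<close> and \<open>p\<close> lie in
  \<open>R\<^sub>0 = k\<close> and have sum \<open>1\<close>, so one of them is a unit.\<close>

lemma basis_exchange:
  assumes M: "typed_gmodule Rg A act G" and b: "homog_basis S A act G I e l"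
    and NP: "\<And>j x. x \<in> G j \<Longrightarrow> \<exists>n\<in>N \<inter> G j. \<exists>p\<in>P \<inter> G j. x = n + p"
  shows "\<exists>e'. homog_basis S A act G I e' l \<and> (\<forall>i\<in>I. e' i \<in> N \<union> P)"
  using b
proof (induction "card {i\<in>I. e i \<notin> N \<union> P}" arbitrary: e rule: less_induct)
  case less
  interpret M: typed_gmodule Rg A act G by (rule M)
  note b = less.prems
  have fin: "finite I" using homog_basisD(1)[OF b] .
  show ?case
  proof (cases "\<forall>i\<in>I. e i \<in> N \<union> P")
    case True then show ?thesis using b by blast
  next
    case False
    then obtain i0 where i0: "i0 \<in> I" "e i0 \<notin> N \<union> P" by blast
    obtain n p where np: "n \<in> N" "n \<in> G (- l i0)" "p \<in> P" "p \<in> G (- l i0)" "e i0 = n + p"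
      using NP[OF homog_basisD(2)[OF b i0(1)]] by blast
    obtain f where f: "\<forall>i\<in>I. f i \<in> S" "n = (\<Sum>i\<in>I. act (f i) (e i))"
      using homog_basisD(3)[OF b M.homog_closed[OF np(2)]] by blast
    obtain g where g: "\<forall>i\<in>I. g i \<in> S" "p = (\<Sum>i\<in>I. act (g i) (e i))"
      using homog_basisD(3)[OF b M.homog_closed[OF np(4)]] by blast
    have fR: "f i0 \<in> range \<iota>"
      using basis_coeff_homog[OF M b _ np(2) f(2) i0(1)] f(1) by (simp add: Rg_0)
    have gR: "g i0 \<in> range \<iota>"
      using basis_coeff_homog[OF M b _ np(4) g(2) i0(1)] g(1) by (simp add: Rg_0)
    note eA = basis_closed(1)[OF M b]
    have "(\<Sum>i\<in>I. act (f i + g i) (e i)) = (\<Sum>i\<in>I. act (f i) (e i) + act (g i) (e i))"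
      using eA by (intro sum.cong) (auto simp: M.add_act)
    also have "\<dots> = e i0" unfolding np(5) f(2) g(2) by (simp add: sum.distrib)
    also have "\<dots> = (\<Sum>i\<in>I. act (if i = i0 then 1 else 0) (e i))"
    proof -
      have "(\<Sum>i\<in>I. act (if i = i0 then 1 else 0) (e i)) = (\<Sum>i\<in>I. if i = i0 then e i0 else 0)"
        using eA by (intro sum.cong) (auto simp: M.act_one M.zero_act)
      then show ?thesis using fin i0 by simp
    qed
    finally have "f i0 + g i0 = (if i0 = i0 then 1 else 0)"
      using f(1) g(1) by (intro basis_unique[OF M b _ _ _ i0(1), of "\<lambda>i. f i + g i"])
        (auto intro: S_add S_0 S_1)
    then have "f i0 \<noteq> 0 \<or> g i0 \<noteq> 0" by auto
    then have "\<exists>\<tau> h. \<tau> \<in> N \<union> P \<and> \<tau> \<in> G (- l i0) \<and> \<tau> = (\<Sum>i\<in>I. act (h i) (e i)) \<and>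
      (\<forall>i\<in>I. h i \<in> S) \<and> h i0 \<noteq> 0 \<and> h i0 \<in> range \<iota>"
    proof
      assume "f i0 \<noteq> 0"
      then show ?thesis using np(1,2) f fR by (intro exI[of _ n] exI[of _ f] conjI) simp_all
    next
      assume "g i0 \<noteq> 0"
      then show ?thesis using np(3,4) g gR by (intro exI[of _ p] exI[of _ g] conjI) simp_all
    qed
    then obtain \<tau> h where \<tau>: "\<tau> \<in> N \<union> P" "\<tau> \<in> G (- l i0)" "\<tau> = (\<Sum>i\<in>I. act (h i) (e i))"
      "\<forall>i\<in>I. h i \<in> S" "h i0 \<noteq> 0" "h i0 \<in> range \<iota>"
      by (elim exE conjE) (rule that)
    obtain c where c: "h i0 = \<iota> c" using \<tau>(6) by blast
    have c0: "c \<noteq> 0" using c \<tau>(5) iota_zero by auto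
    have b': "homog_basis S A act G I (e(i0 := \<tau>)) l"
      by (rule basis_replace[OF M b i0(1) \<tau>(2,3) _ c c0]) (use \<tau>(4) in blast)
    have "card {i\<in>I. (e(i0 := \<tau>)) i \<notin> N \<union> P} < card {i\<in>I. e i \<notin> N \<union> P}"
      using fin i0 \<tau>(1) by (intro psubset_card_mono) auto
    then show ?thesis using less.hyps b' by blast
  qed
qed

section \<open>Graded direct summands\<close>

definition typed_submodule :: "'m::ab_group_add set \<Rightarrow> ('r \<Rightarrow> 'm \<Rightarrow> 'm) \<Rightarrow> (int \<Rightarrow> 'm set) \<Rightarrow> 'm set \<Rightarrow> bool" where
  "typed_submodule A act G N \<longleftrightarrow> N \<subseteq> A \<and> (\<forall>x\<in>N. \<forall>y\<in>N. x - y \<in> N) \<and> (\<forall>r. \<forall>x\<in>N. act r x \<in> N) \<and>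
     direct_grading N (\<lambda>j. N \<inter> G j)"

lemma typed_submodule_gmodule:
  assumes "typed_gmodule Rg A act G" "typed_submodule A act G N"
  shows "typed_gmodule Rg N act (\<lambda>j. N \<inter> G j)"
proof -
  interpret M: typed_gmodule Rg A act G by fact
  have N: "x \<in> N \<Longrightarrow> x \<in> A" for x using assms(2) by (auto simp: typed_submodule_def)
  show ?thesis using assms(2)
    by unfold_locales (auto simp: typed_submodule_def M.act_add M.add_act M.act_act M.act_one N M.act_homog)
qed

text \<open>In a degree i other than j the components of n and p cancel, so the component of n lies
  in \<open>N \<inter> P\<close> and vanishes.\<close>

lemma summand_homog:
  assumes M: "typed_gmodule Rg A act G" and N: "typed_submodule A act G N" and P: "typed_submodule A act G P"
    and NP: "N \<inter> P = {0}" and x: "n \<in> N" "p \<in> P" "n + p \<in> G j"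
  shows "n \<in> G j" "p \<in> G j"
proof -
  interpret M: typed_gmodule Rg A act G by (rule M)
  have gN: "direct_grading N (\<lambda>j. N \<inter> G j)" and gP: "direct_grading P (\<lambda>j. P \<inter> G j)"
    using N P by (auto simp: typed_submodule_def)
  let ?f = "homog_comp (\<lambda>j. N \<inter> G j) n" and ?g = "homog_comp (\<lambda>j. P \<inter> G j) p"
  have f: "homog_decomp (\<lambda>j. N \<inter> G j) ?f n" by (rule homog_comp_decomp[OF gN x(1)])
  have g: "homog_decomp (\<lambda>j. P \<inter> G j) ?g p" by (rule homog_comp_decomp[OF gP x(2)])
  have "homog_decomp G ?f n" using f by (auto simp: homog_decomp_def)
  moreover have "homog_decomp G (\<lambda>i. 0 - ?g i) (0 - p)"
  proof (rule homog_decomp_diff[OF M.grading])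
    show "homog_decomp G (\<lambda>i. 0) 0" using direct_gradingD(1)[OF M.grading] by (intro homog_decompI[of "{}"]) auto
    show "homog_decomp G ?g p" using g by (auto simp: homog_decomp_def)
  qed
  ultimately have "homog_decomp G (\<lambda>i. ?f i - (0 - ?g i)) (n - (0 - p))"
    by (rule homog_decomp_diff[OF M.grading])
  then have "homog_decomp G (\<lambda>i. ?f i + ?g i) (n + p)" by simp
  from homog_decomp_unique[OF M.grading this homog_decomp_single[OF M.grading x(3)]]
  have e: "?f i + ?g i = (if i = j then n + p else 0)" for i by meson
  have z: "?f i = 0" if "i \<noteq> j" for i
  proof -
    have "?f i = - ?g i" using e[of i] that by (simp add: eq_neg_iff_add_eq_0)
    moreover have "- ?g i \<in> P \<inter> G i"
      by (rule direct_grading_uminus[OF gP homog_comp_in[OF gP x(2)]])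
    ultimately have "?f i \<in> N \<inter> P" using homog_comp_in[OF gN x(1), of i] by simp
    then show ?thesis using NP by simp
  qed
  have "n = (\<Sum>i\<in>{j}. ?f i)" using z by (intro homog_decomp_sum[OF f]) auto
  then have fj: "?f j = n" by simp
  show n: "n \<in> G j" using homog_comp_in[OF gN x(1), of j] unfolding fj by simp
  then show "p \<in> G j" using direct_gradingD(3)[OF M.grading x(3) n] by simp
qed

text \<open>After the exchange every basis element lies in N or in P, and those in N form a basis of
  N: in the expansion of an element of N the remaining terms add up to an element of
  \<open>N \<inter> P\<close>. The rank drops strictly, since otherwise N would be the whole module
  and P would be 0. This is what makes summands of maximal Cohen-Macaulay modules maximal
  Cohen-Macaulay.\<close>

lemma summand_basis:
  assumes M: "typed_gmodule Rg A act G" and b: "homog_basis S A act G I e l"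
    and N: "typed_submodule A act G N" and P: "typed_submodule A act G P"
    and NP: "N \<inter> P = {0}" and sum: "\<And>x. x \<in> A \<Longrightarrow> \<exists>n\<in>N. \<exists>p\<in>P. x = n + p" and P0: "P \<noteq> {0}"
  shows "\<exists>I' e'. card I' < card I \<and> homog_basis S N act (\<lambda>j. N \<inter> G j) I' e' l"
proof -
  interpret M: typed_gmodule Rg A act G by (rule M)
  interpret N: typed_gmodule Rg N act "\<lambda>j. N \<inter> G j" by (rule typed_submodule_gmodule[OF M N])
  interpret P: typed_gmodule Rg P act "\<lambda>j. P \<inter> G j" by (rule typed_submodule_gmodule[OF M P])
  have "\<exists>n\<in>N \<inter> G j. \<exists>p\<in>P \<inter> G j. x = n + p" if x: "x \<in> G j" for j x
  proof -
    obtain n p where "n \<in> N" "p \<in> P" "x = n + p" using sum M.homog_closed[OF x] by blast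
    then show ?thesis using summand_homog[OF M N P NP, of n p j] x by blast
  qed
  then obtain e' where b': "homog_basis S A act G I e' l" and e': "\<forall>i\<in>I. e' i \<in> N \<union> P"
    using basis_exchange[OF M b, of N P] by blast
  have fin: "finite I" using homog_basisD(1)[OF b] .
  define I' where "I' = {i\<in>I. e' i \<in> N}"
  have I': "finite I'" "I' \<subseteq> I" using fin by (auto simp: I'_def)
  have split: "(\<Sum>i\<in>I. act (f i) (e' i)) = (\<Sum>i\<in>I'. act (f i) (e' i)) + (\<Sum>i\<in>I - I'. act (f i) (e' i))" for f
    using sum.subset_diff[OF I'(2) fin] by (simp add: add.commute)
  have spanN: "\<exists>f. (\<forall>i\<in>I'. f i \<in> S) \<and> x = (\<Sum>i\<in>I'. act (f i) (e' i))" if x: "x \<in> N" for x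
  proof -
    have "x \<in> A" using N x by (auto simp: typed_submodule_def)
    then obtain f where f: "\<forall>i\<in>I. f i \<in> S" "x = (\<Sum>i\<in>I. act (f i) (e' i))"
      using homog_basisD(3)[OF b'] by blast
    have "(\<Sum>i\<in>I - I'. act (f i) (e' i)) \<in> P"
      using e' by (intro P.sum_closed P.act_closed) (auto simp: I'_def)
    moreover have n: "(\<Sum>i\<in>I'. act (f i) (e' i)) \<in> N"
      by (intro N.sum_closed N.act_closed) (auto simp: I'_def)
    moreover have "(\<Sum>i\<in>I - I'. act (f i) (e' i)) = x - (\<Sum>i\<in>I'. act (f i) (e' i))"
      using f(2) split[of f] by simp
    ultimately have "(\<Sum>i\<in>I - I'. act (f i) (e' i)) \<in> N \<inter> P" using N.diff_closed[OF x n] by simp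
    then have "x = (\<Sum>i\<in>I'. act (f i) (e' i))" using f(2) split[of f] NP by simp
    then show ?thesis using f(1) I'(2) by blast
  qed
  have "f i = 0" if f: "\<forall>i\<in>I'. f i \<in> S" "(\<Sum>i\<in>I'. act (f i) (e' i)) = 0" and i: "i \<in> I'" for f i
  proof -
    define g where "g i = (if i \<in> I' then f i else 0)" for i
    have "(\<Sum>i\<in>I'. act (g i) (e' i)) = 0" using f(2) by (simp add: g_def)
    moreover have "(\<Sum>i\<in>I - I'. act (g i) (e' i)) = 0"
      using basis_closed(1)[OF M b'] by (intro sum.neutral) (auto simp: g_def M.zero_act)
    ultimately have "(\<Sum>i\<in>I. act (g i) (e' i)) = 0" using split[of g] by simp
    then have "g i = 0"
      using homog_basisD(4)[OF b', of g i] f(1) i I'(2) S_0 by (auto simp: g_def)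
    then show ?thesis using i by (simp add: g_def)
  qed
  moreover have "\<forall>i\<in>I'. e' i \<in> N \<inter> G (- l i)" using homog_basisD(2)[OF b'] by (auto simp: I'_def)
  ultimately have "homog_basis S N act (\<lambda>j. N \<inter> G j) I' e' l"
    unfolding homog_basis_def using I'(1) spanN by blast
  moreover have "I' \<noteq> I"
  proof
    assume "I' = I"
    have "P \<subseteq> N"
    proof
      fix p assume "p \<in> P"
      then have "p \<in> A" using P by (auto simp: typed_submodule_def)
      then obtain f where "p = (\<Sum>i\<in>I. act (f i) (e' i))" using homog_basisD(3)[OF b'] by blast
      then show "p \<in> N" using \<open>I' = I\<close> by (auto simp: I'_def intro!: N.sum_closed N.act_closed)
    qed
    then show False using NP P0 P.zero_closed by blast
  qed
  ultimately show ?thesis using I' fin by (meson psubsetI psubset_card_mono)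
qed

end

section \<open>Comparison with module records\<close>

definition mk_gmodule :: "'m::ab_group_add set \<Rightarrow> ('a \<Rightarrow> 'm \<Rightarrow> 'm) \<Rightarrow> (int \<Rightarrow> 'm set) \<Rightarrow> ('a, 'm) gmodule" where
  "mk_gmodule A act G = \<lparr>carrier = A, monoid.mult = (\<lambda>_ _. 0), one = 0, ring.zero = 0, add = (+),
     module.smult = act, hcomp = G\<rparr>"

lemma mk_gmodule_simps [simp]:
  "carrier (mk_gmodule A act G) = A" "\<zero>\<^bsub>mk_gmodule A act G\<^esub> = 0"
  "x \<oplus>\<^bsub>mk_gmodule A act G\<^esub> y = x + y" "r \<odot>\<^bsub>mk_gmodule A act G\<^esub> x = act r x"
  "hcomp (mk_gmodule A act G) = G" "(mk_gmodule A act G)\<lparr>carrier := N\<rparr> = mk_gmodule N act G"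
  by (simp_all add: mk_gmodule_def)

lemma ring_of_type_algebra_simps [simp]:
  "carrier (ring_of_type_algebra :: 'r::comm_ring_1 ring) = UNIV"
  "(x :: 'r) \<otimes>\<^bsub>ring_of_type_algebra\<^esub> y = x * y" "x \<oplus>\<^bsub>ring_of_type_algebra\<^esub> y = x + y"
  "\<zero>\<^bsub>ring_of_type_algebra\<^esub> = (0 :: 'r)" "\<one>\<^bsub>ring_of_type_algebra\<^esub> = (1 :: 'r)"
  by (simp_all add: ring_of_type_algebra_def)

lemma finsum_eq_sum:
  fixes M :: "('m::ab_group_add, 'z) ring_scheme"
  assumes M: "abelian_monoid M" and add: "\<And>x y. x \<oplus>\<^bsub>M\<^esub> y = x + y" and zero: "\<zero>\<^bsub>M\<^esub> = 0"
    and f: "\<And>i. i \<in> I \<Longrightarrow> f i \<in> carrier M"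
  shows "finsum M f I = sum f I"
  using f
proof (induction I rule: infinite_finite_induct)
  case (infinite I) then show ?case using abelian_monoid.finsum_infinite[OF M] zero by simp
next
  case empty then show ?case using abelian_monoid.finsum_empty[OF M] zero by simp
next
  case (insert i I)
  then have "finsum M f (insert i I) = f i \<oplus>\<^bsub>M\<^esub> finsum M f I"
    by (intro abelian_monoid.finsum_insert[OF M]) auto
  then show ?case using insert add by simp
qed

text \<open>The zero family is a decomposition of 0, which turns unique existence everywhere into
  existence together with uniqueness at 0.\<close>

lemma is_grading_iff:
  fixes M :: "('m::ab_group_add, 'z) ring_scheme"
  assumes M: "abelian_group M" and add: "\<And>x y. x \<oplus>\<^bsub>M\<^esub> y = x + y" and zero: "\<zero>\<^bsub>M\<^esub> = 0"
  shows "is_grading M c \<longleftrightarrow> direct_grading (carrier M) c"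
proof -
  interpret M: abelian_group M by (rule M)
  have neg: "inv\<^bsub>add_monoid M\<^esub> x = - x" if x: "x \<in> carrier M" for x
    using M.l_neg[OF x] unfolding add zero a_inv_def by (simp add: eq_neg_iff_add_eq_0)
  have sub: "subgroup H (add_monoid M) \<longleftrightarrow> 0 \<in> H \<and> H \<subseteq> carrier M \<and> (\<forall>x\<in>H. \<forall>y\<in>H. x - y \<in> H)" for H
  proof
    assume H: "subgroup H (add_monoid M)"
    have HM: "H \<subseteq> carrier M" using subgroup.subset[OF H] by simp
    have "x - y \<in> H" if xy: "x \<in> H" "y \<in> H" for x y
    proof -
      have "- y \<in> H" using subgroup.m_inv_closed[OF H xy(2)] neg[of y] HM xy by auto
      then show ?thesis using subgroup.m_closed[OF H xy(1), of "- y"] add by simp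
    qed
    then show "0 \<in> H \<and> H \<subseteq> carrier M \<and> (\<forall>x\<in>H. \<forall>y\<in>H. x - y \<in> H)"
      using subgroup.one_closed[OF H] zero HM by auto
  next
    assume H: "0 \<in> H \<and> H \<subseteq> carrier M \<and> (\<forall>x\<in>H. \<forall>y\<in>H. x - y \<in> H)"
    then have m: "- y \<in> H" if "y \<in> H" for y using that by (metis diff_0)
    then have "x + y \<in> H" if "x \<in> H" "y \<in> H" for x y using H that by (metis diff_minus_eq_add)
    then show "subgroup H (add_monoid M)"
      using H m neg zero add by (intro subgroup.intro) auto
  qed
  have dec: "((\<forall>i. f i \<in> c i) \<and> finite {i. f i \<noteq> \<zero>\<^bsub>M\<^esub>} \<and> x = (\<Oplus>\<^bsub>M\<^esub>i\<in>{i. f i \<noteq> \<zero>\<^bsub>M\<^esub>}. f i)) \<longleftrightarrow>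
      homog_decomp c f x" if c: "\<And>i. c i \<subseteq> carrier M" for f x
  proof -
    have "(\<Oplus>\<^bsub>M\<^esub>i\<in>{i. f i \<noteq> 0}. f i) = (\<Sum>i\<in>{i. f i \<noteq> 0}. f i)" if "\<forall>i. f i \<in> c i"
      by (rule finsum_eq_sum[OF M.abelian_monoid_axioms add zero]) (use c that in blast)
    then show ?thesis unfolding zero homog_decomp_def by auto
  qed
  show ?thesis
  proof
    assume gr: "is_grading M c"
    then have s: "0 \<in> c i" "c i \<subseteq> carrier M" "\<And>x y. x \<in> c i \<Longrightarrow> y \<in> c i \<Longrightarrow> x - y \<in> c i" for i
      unfolding is_grading_def sub by blast+
    have ex: "\<exists>!f. homog_decomp c f x" if "x \<in> carrier M" for x
      using gr that unfolding is_grading_def dec[OF s(2)] by blast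
    have z: "homog_decomp c (\<lambda>_. 0) 0" using s(1) by (intro homog_decompI[of "{}"]) auto
    have "0 \<in> carrier M" using s(1,2) by blast
    from ex[OF this] z have "f = (\<lambda>_. 0)" if "homog_decomp c f 0" for f using that by blast
    then show "direct_grading (carrier M) c" using s ex unfolding direct_grading_def by fastforce
  next
    assume g: "direct_grading (carrier M) c"
    then have s: "c i \<subseteq> carrier M" for i unfolding direct_grading_def by blast
    have "\<exists>!f. homog_decomp c f x" if "x \<in> carrier M" for x
      using direct_gradingD(4)[OF g that] homog_decomp_unique[OF g] by blast
    moreover have "\<forall>i. 0 \<in> c i \<and> c i \<subseteq> carrier M \<and> (\<forall>x\<in>c i. \<forall>y\<in>c i. x - y \<in> c i)"
      using g by (simp add: direct_grading_def)
    ultimately show "is_grading M c" unfolding is_grading_def sub dec[OF s] by simp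
  qed
qed

lemma abelian_group_mk:
  assumes "0 \<in> A" "\<And>x y. x \<in> A \<Longrightarrow> y \<in> A \<Longrightarrow> x - y \<in> A"
  shows "abelian_group (mk_gmodule A act G)"
proof -
  have m: "- y \<in> A" if "y \<in> A" for y using assms(2)[OF assms(1) that] by simp
  have "x + y \<in> A" if "x \<in> A" "y \<in> A" for x y using assms(2)[OF that(1) m[OF that(2)]] by simp
  then show ?thesis using assms(1) m
    by (intro abelian_groupI) (auto simp: add.assoc add.commute intro!: bexI[of _ "- _"])
qed

lemma is_grading_mk:
  assumes "0 \<in> A" "\<And>x y. x \<in> A \<Longrightarrow> y \<in> A \<Longrightarrow> x - y \<in> A"
  shows "is_grading (mk_gmodule A act G) c \<longleftrightarrow> direct_grading A c"
  using is_grading_iff[OF abelian_group_mk[OF assms], where c = c] by simp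

context typed_gmodule
begin

lemma module_mk: "Module.module ring_of_type_algebra (mk_gmodule A act G)"
  by (rule moduleI)
    (auto intro: abelian_group_mk zero_closed diff_closed simp: act_closed add_act act_add act_act act_one)

lemma graded_module_mk: "graded_module ring_of_type_algebra Rg (mk_gmodule A act G)"
  unfolding graded_module_def
  using module_mk is_grading_mk[OF zero_closed diff_closed] grading act_homog by auto

end

section \<open>Graded isomorphisms\<close>

lemma graded_iso_refl: "graded_iso K M M"
  unfolding graded_iso_def LinearCombinations.module_hom_def by (intro bexI[of _ "\<lambda>x. x"]) (auto simp: bij_betw_def)

lemma graded_iso_trans:
  assumes "graded_iso K M N" "graded_iso K N P"
  shows "graded_iso K M P"
proof -
  obtain f g where f: "f \<in> LinearCombinations.module_hom K M N" "bij_betw f (carrier M) (carrier N)" "\<And>i. f ` hcomp M i = hcomp N i"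
    and g: "g \<in> LinearCombinations.module_hom K N P" "bij_betw g (carrier N) (carrier P)" "\<And>i. g ` hcomp N i = hcomp P i"
    using assms unfolding graded_iso_def by blast
  have "(g \<circ> f) ` hcomp M i = hcomp P i" for i by (metis f(3) g(3) image_comp)
  moreover have "g \<circ> f \<in> LinearCombinations.module_hom K M P" using f(1) g(1) unfolding LinearCombinations.module_hom_def by (auto simp: Pi_iff)
  ultimately show ?thesis unfolding graded_iso_def using bij_betw_trans[OF f(2) g(2)] by blast
qed

text \<open>\<open>graded_iso\<close> presupposes no module axioms. The closure conditions on M
  allow sums and multiples formed in M to be recognized as preimages, which is how the inverse
  becomes linear.\<close>

lemma graded_iso_sym:
  assumes iso: "graded_iso K M N"
    and cl: "\<And>x y. x \<in> carrier M \<Longrightarrow> y \<in> carrier M \<Longrightarrow> x \<oplus>\<^bsub>M\<^esub> y \<in> carrier M"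
      "\<And>r x. r \<in> carrier K \<Longrightarrow> x \<in> carrier M \<Longrightarrow> r \<odot>\<^bsub>M\<^esub> x \<in> carrier M"
      "\<And>i. hcomp M i \<subseteq> carrier M"
  shows "graded_iso K N M"
proof -
  obtain f where f: "f \<in> LinearCombinations.module_hom K M N" "bij_betw f (carrier M) (carrier N)" "\<And>i. f ` hcomp M i = hcomp N i"
    using iso unfolding graded_iso_def by blast
  define g where "g = inv_into (carrier M) f"
  have gf: "g (f x) = x" if "x \<in> carrier M" for x
    unfolding g_def using that f(2) by (simp add: bij_betw_def inv_into_f_f)
  have fg: "f (g y) = y" "g y \<in> carrier M" if "y \<in> carrier N" for y
    unfolding g_def using that f(2) by (auto simp: bij_betw_def f_inv_into_f inv_into_into)
  have g_bij: "bij_betw g (carrier N) (carrier M)" unfolding g_def by (rule bij_betw_inv_into[OF f(2)])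
  have "g (x \<oplus>\<^bsub>N\<^esub> y) = g x \<oplus>\<^bsub>M\<^esub> g y" if xy: "x \<in> carrier N" "y \<in> carrier N" for x y
  proof -
    have "f (g x \<oplus>\<^bsub>M\<^esub> g y) = x \<oplus>\<^bsub>N\<^esub> y" using LinearCombinations.module_hom_add[OF f(1)] fg xy by simp
    then show ?thesis using gf[OF cl(1)] fg xy by metis
  qed
  moreover have "g (r \<odot>\<^bsub>N\<^esub> x) = r \<odot>\<^bsub>M\<^esub> g x" if r: "r \<in> carrier K" "x \<in> carrier N" for r x
  proof -
    have "f (r \<odot>\<^bsub>M\<^esub> g x) = r \<odot>\<^bsub>N\<^esub> x" using LinearCombinations.module_hom_smult[OF f(1)] fg r by simp
    then show ?thesis using gf[OF cl(2)] fg r by metis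
  qed
  ultimately have "g \<in> LinearCombinations.module_hom K N M" using fg(2) unfolding LinearCombinations.module_hom_def by auto
  moreover have "g ` hcomp N i = hcomp M i" for i
  proof -
    have "g ` f ` hcomp M i = (\<lambda>x. x) ` hcomp M i" unfolding image_image
      using gf cl(3) by (intro image_cong) auto
    then show ?thesis using f(3) by simp
  qed
  ultimately show ?thesis unfolding graded_iso_def using g_bij by blast
qed

context graded_setup
begin

lemma cring_S: "cring (subring_of S)"
proof (rule cringI)
  show "abelian_group (subring_of S)"
    using S_add S_0 S_uminus by (intro abelian_groupI) (auto simp: add_ac intro!: bexI[of _ "- _"])
  show "comm_monoid (subring_of S)" using S_mult S_1 by (intro comm_monoidI) (auto simp: mult_ac)
qed (auto simp: algebra_simps)

lemma free_module_simps:
  "carrier (graded_free_module Rg S m l) = {..<m} \<rightarrow>\<^sub>E S"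
  "f \<oplus>\<^bsub>graded_free_module Rg S m l\<^esub> g = (\<lambda>i\<in>{..<m}. f i + g i)"
  "c \<odot>\<^bsub>graded_free_module Rg S m l\<^esub> f = (\<lambda>i\<in>{..<m}. c * f i)"
  "hcomp (graded_free_module Rg S m l) j = {f \<in> {..<m} \<rightarrow>\<^sub>E S. \<forall>i<m. f i \<in> Rg (j + l i)}"
  unfolding graded_free_module_def ring.func_space_def[OF cring.axioms(1)[OF cring_S]]
  by (simp_all add: gmodule.defs Module.module.defs)

section \<open>From graded bases to maximal Cohen-Macaulay modules\<close>

lemma homog_basis_reindex:
  assumes b: "homog_basis S A act G I e l" and h: "bij_betw h {..<m} I"
  shows "homog_basis S A act G {..<m} (e \<circ> h) (l \<circ> h)"
proof -
  have re: "(\<Sum>i\<in>I. act (f i) (e i)) = (\<Sum>i<m. act (f (h i)) ((e \<circ> h) i))" for f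
    using sum.reindex_bij_betw[OF h, of "\<lambda>i. act (f i) (e i)"] by simp
  have hI: "h i \<in> I" if "i < m" for i using h that by (auto simp: bij_betw_def)
  define k where "k = inv_into {..<m} h"
  have k: "k (h i) = i" if "i < m" for i using h that by (simp add: k_def bij_betw_def inv_into_f_f)
  have hk: "h (k i) = i" "k i < m" if "i \<in> I" for i
    using h that unfolding k_def bij_betw_def by (auto simp: f_inv_into_f dest: inv_into_into)
  have "\<exists>f. (\<forall>i\<in>{..<m}. f i \<in> S) \<and> x = (\<Sum>i<m. act (f i) ((e \<circ> h) i))" if x: "x \<in> A" for x
  proof -
    obtain f where "\<forall>i\<in>I. f i \<in> S" "x = (\<Sum>i\<in>I. act (f i) (e i))" using homog_basisD(3)[OF b x] by blast
    then show ?thesis using hI unfolding re by (intro exI[of _ "f \<circ> h"]) simp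
  qed
  moreover have "f i = 0" if f: "\<forall>i\<in>{..<m}. f i \<in> S" "(\<Sum>i<m. act (f i) ((e \<circ> h) i)) = 0" "i < m" for f i
  proof -
    have "(\<Sum>i\<in>I. act (f (k i)) (e i)) = 0" unfolding re using f(2) k by simp
    then have "f (k (h i)) = 0"
      using homog_basisD(4)[OF b, of "f \<circ> k" "h i"] f(1) hk hI[OF f(3)] by simp
    then show ?thesis using k f(3) by simp
  qed
  ultimately show ?thesis unfolding homog_basis_def using homog_basisD(2)[OF b] hI by auto
qed

text \<open>The coordinate map is the isomorphism. It is homogeneous of degree 0 because the
  coefficients of an element of degree j have degree \<open>j + l i\<close>, which is
  \<open>basis_coeff_homog\<close>.\<close>

lemma free_iso_of_basis:
  assumes M: "typed_gmodule Rg A act G" and b: "homog_basis S A act G {..<m} e l"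
  shows "graded_iso (subring_of S) (mk_gmodule A act G) (graded_free_module Rg S m l)"
proof -
  interpret M: typed_gmodule Rg A act G by (rule M)
  have ex: "\<exists>f. f \<in> {..<m} \<rightarrow>\<^sub>E S \<and> x = (\<Sum>i<m. act (f i) (e i))" if x: "x \<in> A" for x
  proof -
    obtain f where "\<forall>i\<in>{..<m}. f i \<in> S" "x = (\<Sum>i<m. act (f i) (e i))" using homog_basisD(3)[OF b x] by blast
    then show ?thesis by (intro exI[of _ "restrict f {..<m}"]) auto
  qed
  define co where "co x = (SOME f. f \<in> {..<m} \<rightarrow>\<^sub>E S \<and> x = (\<Sum>i<m. act (f i) (e i)))" for x
  have co: "co x \<in> {..<m} \<rightarrow>\<^sub>E S" "x = (\<Sum>i<m. act (co x i) (e i))" if "x \<in> A" for x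
    using someI_ex[OF ex[OF that]] unfolding co_def by blast+
  note eA = basis_closed[OF M b]
  have coS: "co x i \<in> S" if "x \<in> A" "i < m" for x i using co(1)[OF that(1)] that(2) by auto
  have uniq: "co x = f" if x: "x \<in> A" and f: "f \<in> {..<m} \<rightarrow>\<^sub>E S" "x = (\<Sum>i<m. act (f i) (e i))" for x f
  proof (rule PiE_ext[OF co(1)[OF x] f(1)])
    fix i assume "i \<in> {..<m}"
    then show "co x i = f i"
      using co(2)[OF x] f(2) by (intro basis_unique[OF M b coS[OF x] PiE_mem[OF f(1)]]) auto
  qed
  have add: "co (x + y) = (\<lambda>i\<in>{..<m}. co x i + co y i)" if xy: "x \<in> A" "y \<in> A" for x y
  proof (rule uniq[OF M.add_closed[OF xy]])
    show "(\<lambda>i\<in>{..<m}. co x i + co y i) \<in> {..<m} \<rightarrow>\<^sub>E S" using coS xy S_add by auto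
    have "(\<Sum>i<m. act ((\<lambda>i\<in>{..<m}. co x i + co y i) i) (e i)) = (\<Sum>i<m. act (co x i) (e i) + act (co y i) (e i))"
      using eA by (intro sum.cong) (auto simp: M.add_act)
    then show "x + y = (\<Sum>i<m. act ((\<lambda>i\<in>{..<m}. co x i + co y i) i) (e i))"
      using co(2) xy by (simp add: sum.distrib)
  qed
  have smult: "co (act s x) = (\<lambda>i\<in>{..<m}. s * co x i)" if s: "s \<in> S" "x \<in> A" for s x
  proof (rule uniq[OF M.act_closed[OF s(2)]])
    show "(\<lambda>i\<in>{..<m}. s * co x i) \<in> {..<m} \<rightarrow>\<^sub>E S" using coS s S_mult by auto
    have "act s x = act s (\<Sum>i<m. act (co x i) (e i))" using co(2)[OF s(2)] by simp
    also have "\<dots> = (\<Sum>i<m. act s (act (co x i) (e i)))" using eA by (intro M.act_sum) auto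
    also have "\<dots> = (\<Sum>i<m. act ((\<lambda>i\<in>{..<m}. s * co x i) i) (e i))"
      using eA by (intro sum.cong) (auto simp: M.act_act)
    finally show "act s x = (\<Sum>i<m. act ((\<lambda>i\<in>{..<m}. s * co x i) i) (e i))" .
  qed
  have ce: "co (\<Sum>i<m. act (f i) (e i)) = f" "(\<Sum>i<m. act (f i) (e i)) \<in> A" if f: "f \<in> {..<m} \<rightarrow>\<^sub>E S" for f
  proof -
    show A: "(\<Sum>i<m. act (f i) (e i)) \<in> A" using eA by (intro M.sum_closed) auto
    show "co (\<Sum>i<m. act (f i) (e i)) = f" using uniq[OF A f] by simp
  qed
  have hom: "co \<in> LinearCombinations.module_hom (subring_of S) (mk_gmodule A act G) (graded_free_module Rg S m l)"
    using co(1) add smult unfolding LinearCombinations.module_hom_def by (auto simp: free_module_simps)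
  have "inj_on co A"
  proof (rule inj_onI)
    fix x y assume xy: "x \<in> A" "y \<in> A" "co x = co y"
    have "x = (\<Sum>i<m. act (co y i) (e i))" using co(2)[OF xy(1)] unfolding xy(3) .
    then show "x = y" using co(2)[OF xy(2)] by (rule trans[OF _ sym])
  qed
  moreover have "co ` A = {..<m} \<rightarrow>\<^sub>E S"
  proof (intro equalityI subsetI)
    fix f assume "f \<in> {..<m} \<rightarrow>\<^sub>E S"
    from ce[OF this] show "f \<in> co ` A" by (intro image_eqI[of _ _ "\<Sum>i<m. act (f i) (e i)"]) simp_all
  qed (use co(1) in blast)
  ultimately have bij: "bij_betw co A ({..<m} \<rightarrow>\<^sub>E S)" by (simp add: bij_betw_def)
  have "co ` G j = {f \<in> {..<m} \<rightarrow>\<^sub>E S. \<forall>i<m. f i \<in> Rg (j + l i)}" for j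
  proof (intro equalityI subsetI)
    fix f assume "f \<in> co ` G j"
    then obtain x where x: "x \<in> G j" "f = co x" by blast
    have xA: "x \<in> A" by (rule M.homog_closed[OF x(1)])
    have "co x i \<in> Rg (j + l i)" if "i < m" for i
      by (rule basis_coeff_homog[OF M b coS[OF xA] x(1) co(2)[OF xA]]) (use that in auto)
    then show "f \<in> {f \<in> {..<m} \<rightarrow>\<^sub>E S. \<forall>i<m. f i \<in> Rg (j + l i)}" using co(1)[OF xA] x(2) by simp
  next
    fix f assume f: "f \<in> {f \<in> {..<m} \<rightarrow>\<^sub>E S. \<forall>i<m. f i \<in> Rg (j + l i)}"
    have "(\<Sum>i<m. act (f i) (e i)) \<in> G j"
    proof (rule direct_grading_sum[OF M.grading])
      fix i assume i: "i \<in> {..<m}"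
      then show "act (f i) (e i) \<in> G j" using M.act_homog[OF _ homog_basisD(2)[OF b i], of "f i" "j + l i"] f by simp
    qed
    then show "f \<in> co ` G j" using ce(1)[of f] f by (intro image_eqI[of _ _ "\<Sum>i<m. act (f i) (e i)"]) simp_all
  qed
  then show ?thesis unfolding graded_iso_def using hom bij by (intro bexI[of _ co]) (auto simp: free_module_simps)
qed

lemma graded_mcm_mk:
  assumes M: "typed_gmodule Rg A act G" and b: "homog_basis S A act G I e l"
  shows "graded_mcm Rg S (mk_gmodule A act G)"
proof -
  interpret M: typed_gmodule Rg A act G by (rule M)
  interpret mod: Module.module ring_of_type_algebra "mk_gmodule A act G" by (rule M.module_mk)
  have fin: "finite I" by (rule homog_basisD(1)[OF b])
  obtain h where h: "bij_betw h {..<card I} I" using ex_bij_betw_nat_finite[OF fin] atLeast0LessThan by metis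
  have iso: "graded_iso (subring_of S) (mk_gmodule A act G) (graded_free_module Rg S (card I) (l \<circ> h))"
    by (rule free_iso_of_basis[OF M homog_basis_reindex[OF b h]])
  note eA = basis_closed[OF M b]
  \<comment> \<open>Linear combinations are indexed by the image set of e rather than by I, so two
    equal basis elements would have to share one coefficient.\<close>
  have inj: "inj_on e I"
  proof (rule inj_onI, rule ccontr)
    fix i j assume ij: "i \<in> I" "j \<in> I" "e i = e j" "i \<noteq> j"
    define f where "f p = (if p = i then 1 else if p = j then - 1 else 0 :: 'r)" for p
    have "(\<Sum>p\<in>I. act (f p) (e p)) = (\<Sum>p\<in>{i, j}. act (f p) (e p))"
      using fin ij(1,2) eA by (intro sum.mono_neutral_right) (auto simp: f_def M.zero_act)
    also have "\<dots> = 0" using ij eA(1) by (simp add: f_def M.act_one M.uminus_act)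
    finally have "f i = 0"
      using ij(1) S_0 S_1 S_uminus by (intro homog_basisD(4)[OF b]) (auto simp: f_def)
    then show False by (simp add: f_def)
  qed
  have "A \<subseteq> mod.span (e ` I)"
  proof
    fix x assume "x \<in> A"
    then obtain f where f: "x = (\<Sum>i\<in>I. act (f i) (e i))" using homog_basisD(3)[OF b] by blast
    define a where "a v = f (inv_into I e v)" for v
    have "mod.lincomb a (e ` I) = (\<Sum>v\<in>e ` I. act (a v) v)"
      unfolding mod.lincomb_def using eA
      by (subst finsum_eq_sum) (auto intro: mod.abelian_monoid_axioms)
    also have "\<dots> = x" unfolding f using inj by (simp add: sum.reindex a_def)
    finally show "x \<in> mod.span (e ` I)" unfolding mod.span_def using fin by fastforce
  qed
  moreover have "mod.span (e ` I) \<subseteq> A"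
    using mod.span_is_subset2[of "e ` I"] eA by auto
  ultimately have "finitely_generated ring_of_type_algebra (mk_gmodule A act G)"
    unfolding finitely_generated_def using fin eA by (intro exI[of _ "e ` I"]) auto
  then show ?thesis unfolding graded_mcm_def using M.graded_module_mk iso by blast
qed

lemma graded_submodule_mkD:
  assumes M: "typed_gmodule Rg A act G"
    and N: "graded_submodule N ring_of_type_algebra (mk_gmodule A act G)"
  shows "typed_submodule A act G N"
proof -
  interpret M: typed_gmodule Rg A act G by (rule M)
  interpret mod: Module.module ring_of_type_algebra "mk_gmodule A act G" by (rule M.module_mk)
  have s: "Module.submodule N ring_of_type_algebra (mk_gmodule A act G)"
    and g: "is_grading (mk_gmodule N act G) (\<lambda>i. N \<inter> G i)"
    using N unfolding graded_submodule_def by simp_all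
  have NA: "N \<subseteq> A" using mod.submoduleE(1)[OF s] by simp
  have zero: "0 \<in> N"
    using subgroup.one_closed[OF Module.submodule.axioms(1)[OF s]] by simp
  have act: "act r x \<in> N" if "x \<in> N" for r x using mod.submoduleE(4)[OF s, of r x] that by simp
  have diff: "x - y \<in> N" if xy: "x \<in> N" "y \<in> N" for x y
  proof -
    have "act (- 1) y \<in> N" by (rule act[OF xy(2)])
    moreover have "act (- 1) y = - y" using NA xy(2) by (auto simp: M.uminus_act M.act_one)
    ultimately show ?thesis using mod.submoduleE(5)[OF s xy(1), of "- y"] by simp
  qed
  have "direct_grading N (\<lambda>i. N \<inter> G i)" using is_grading_mk[OF zero diff] g by blast
  then show ?thesis unfolding typed_submodule_def using NA diff act by blast
qed

lemma decomposable_mk: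
  assumes M: "typed_gmodule Rg A act G" and A: "A \<noteq> {0}"
    and dec: "\<not> graded_indecomposable ring_of_type_algebra (mk_gmodule A act G)"
  shows "\<exists>N P. typed_submodule A act G N \<and> typed_submodule A act G P \<and> N \<inter> P = {0} \<and>
    (\<forall>x\<in>A. \<exists>n\<in>N. \<exists>p\<in>P. x = n + p) \<and> N \<noteq> {0} \<and> P \<noteq> {0}"
proof -
  obtain N P where "graded_submodule N ring_of_type_algebra (mk_gmodule A act G)"
    "graded_submodule P ring_of_type_algebra (mk_gmodule A act G)" "N \<inter> P = {0}"
    and sum: "N <+>\<^bsub>mk_gmodule A act G\<^esub> P = A" and "N \<noteq> {0}" "P \<noteq> {0}"
    using dec A unfolding graded_indecomposable_def by auto
  moreover have "\<exists>n\<in>N. \<exists>p\<in>P. x = n + p" if "x \<in> A" for x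
  proof -
    have "x \<in> N <+>\<^bsub>mk_gmodule A act G\<^esub> P" using that sum by simp
    then show ?thesis by (auto simp: set_add_defs)
  qed
  ultimately show ?thesis using graded_submodule_mkD[OF M] by blast
qed

text \<open>The map sends \<open>n + p\<close> to \<open>f n + g p\<close>. It is well defined since
  N and P meet in 0, injective since N' and P' do, and it respects degrees since the two parts of a
  homogeneous element are homogeneous (\<open>summand_homog\<close>).\<close>

lemma glue_iso:
  assumes M: "typed_gmodule Rg A act G" and N: "typed_submodule A act G N" and P: "typed_submodule A act G P"
    and NP: "N \<inter> P = {0}" and sum: "\<And>x. x \<in> A \<Longrightarrow> \<exists>n\<in>N. \<exists>p\<in>P. x = n + p"
    and M': "typed_gmodule Rg A' act' G'" and N': "typed_submodule A' act' G' N'" and P': "typed_submodule A' act' G' P'"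
    and NP': "N' \<inter> P' = {0}" and sum': "\<And>x. x \<in> A' \<Longrightarrow> \<exists>n\<in>N'. \<exists>p\<in>P'. x = n + p"
    and iN: "graded_iso ring_of_type_algebra (mk_gmodule N act (\<lambda>j. N \<inter> G j)) (mk_gmodule N' act' (\<lambda>j. N' \<inter> G' j))"
    and iP: "graded_iso ring_of_type_algebra (mk_gmodule P act (\<lambda>j. P \<inter> G j)) (mk_gmodule P' act' (\<lambda>j. P' \<inter> G' j))"
  shows "graded_iso ring_of_type_algebra (mk_gmodule A act G) (mk_gmodule A' act' G')"
proof -
  interpret M: typed_gmodule Rg A act G by (rule M)
  interpret N: typed_gmodule Rg N act "\<lambda>j. N \<inter> G j" by (rule typed_submodule_gmodule[OF M N])
  interpret P: typed_gmodule Rg P act "\<lambda>j. P \<inter> G j" by (rule typed_submodule_gmodule[OF M P])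
  interpret M': typed_gmodule Rg A' act' G' by (rule M')
  interpret N': typed_gmodule Rg N' act' "\<lambda>j. N' \<inter> G' j" by (rule typed_submodule_gmodule[OF M' N'])
  interpret P': typed_gmodule Rg P' act' "\<lambda>j. P' \<inter> G' j" by (rule typed_submodule_gmodule[OF M' P'])
  have sub: "N \<subseteq> A" "P \<subseteq> A" "N' \<subseteq> A'" "P' \<subseteq> A'" using N P N' P' by (auto simp: typed_submodule_def)
  obtain f where f: "\<And>x. x \<in> N \<Longrightarrow> f x \<in> N'" "\<And>x y. x \<in> N \<Longrightarrow> y \<in> N \<Longrightarrow> f (x + y) = f x + f y"
    "\<And>r x. x \<in> N \<Longrightarrow> f (act r x) = act' r (f x)" "bij_betw f N N'" "\<And>i. f ` (N \<inter> G i) = N' \<inter> G' i"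
    using iN unfolding graded_iso_def LinearCombinations.module_hom_def by (auto simp: Pi_iff)
  obtain g where g: "\<And>x. x \<in> P \<Longrightarrow> g x \<in> P'" "\<And>x y. x \<in> P \<Longrightarrow> y \<in> P \<Longrightarrow> g (x + y) = g x + g y"
    "\<And>r x. x \<in> P \<Longrightarrow> g (act r x) = act' r (g x)" "bij_betw g P P'" "\<And>i. g ` (P \<inter> G i) = P' \<inter> G' i"
    using iP unfolding graded_iso_def LinearCombinations.module_hom_def by (auto simp: Pi_iff)
  have uniq: "n = n' \<and> p = p'" if "n \<in> N" "n' \<in> N" "p \<in> P" "p' \<in> P" "n + p = n' + p'" for n n' p p'
  proof -
    have e: "n - n' = p' - p" using that(5) by (simp add: algebra_simps)
    have "n - n' \<in> N" using N.diff_closed that by blast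
    moreover have "n - n' \<in> P" unfolding e using P.diff_closed that by blast
    ultimately have "n - n' = 0" using NP by blast
    then show ?thesis using e by simp
  qed
  have uniq': "n = n' \<and> p = p'" if "n \<in> N'" "n' \<in> N'" "p \<in> P'" "p' \<in> P'" "n + p = n' + p'" for n n' p p'
  proof -
    have e: "n - n' = p' - p" using that(5) by (simp add: algebra_simps)
    have "n - n' \<in> N'" using N'.diff_closed that by blast
    moreover have "n - n' \<in> P'" unfolding e using P'.diff_closed that by blast
    ultimately have "n - n' = 0" using NP' by blast
    then show ?thesis using e by simp
  qed
  define h where "h x = (THE z. \<exists>n\<in>N. \<exists>p\<in>P. x = n + p \<and> z = f n + g p)" for x
  have h: "h (n + p) = f n + g p" if "n \<in> N" "p \<in> P" for n p
    unfolding h_def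
  proof (rule the_equality)
    show "\<exists>n'\<in>N. \<exists>p'\<in>P. n + p = n' + p' \<and> f n + g p = f n' + g p'" using that by blast
    fix z assume "\<exists>n'\<in>N. \<exists>p'\<in>P. n + p = n' + p' \<and> z = f n' + g p'"
    then show "z = f n + g p" using uniq[OF that(1) _ that(2)] by metis
  qed
  have add: "h (x + y) = h x + h y" if xy: "x \<in> A" "y \<in> A" for x y
  proof -
    obtain n p n' p' where np: "n \<in> N" "p \<in> P" "x = n + p" "n' \<in> N" "p' \<in> P" "y = n' + p'"
      using sum[OF xy(1)] sum[OF xy(2)] by blast
    have e: "x + y = (n + n') + (p + p')" using np by (simp add: algebra_simps)
    have "h (x + y) = f (n + n') + g (p + p')"
      unfolding e by (rule h) (use np N.add_closed P.add_closed in blast)+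
    then show ?thesis
      unfolding f(2)[OF np(1,4)] g(2)[OF np(2,5)] np(3,6) h[OF np(1,2)] h[OF np(4,5)] by (simp add: algebra_simps)
  qed
  have smult: "h (act r x) = act' r (h x)" if x: "x \<in> A" for r x
  proof -
    obtain n p where np: "n \<in> N" "p \<in> P" "x = n + p" using sum[OF x] by blast
    have "act r x = act r n + act r p" using np sub M.act_add by blast
    then have "h (act r x) = act' r (f n) + act' r (g p)"
      using h[OF N.act_closed[OF np(1)] P.act_closed[OF np(2)], of r r] f(3)[OF np(1)] g(3)[OF np(2)] by simp
    also have "\<dots> = act' r (h x)"
      unfolding np(3) h[OF np(1,2)] using f(1)[OF np(1)] g(1)[OF np(2)] sub by (intro M'.act_add[symmetric]) auto
    finally show ?thesis .
  qed
  have cl: "h x \<in> A'" if x: "x \<in> A" for x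
  proof -
    obtain n p where np: "n \<in> N" "p \<in> P" "x = n + p" using sum[OF x] by blast
    have "f n \<in> A'" "g p \<in> A'" using f(1)[OF np(1)] g(1)[OF np(2)] sub by auto
    then show ?thesis unfolding np(3) h[OF np(1,2)] by (rule M'.add_closed)
  qed
  have bij: "bij_betw h A A'"
  proof (rule bij_betwI')
    fix x y assume xy: "x \<in> A" "y \<in> A"
    obtain n p n' p' where np: "n \<in> N" "p \<in> P" "x = n + p" "n' \<in> N" "p' \<in> P" "y = n' + p'"
      using sum[OF xy(1)] sum[OF xy(2)] by blast
    show "(h x = h y) = (x = y)"
    proof
      assume "h x = h y"
      then have "f n + g p = f n' + g p'" unfolding np(3,6) h[OF np(1,2)] h[OF np(4,5)] .
      from uniq'[OF f(1)[OF np(1)] f(1)[OF np(4)] g(1)[OF np(2)] g(1)[OF np(5)] this]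
      have "f n = f n' \<and> g p = g p'" .
      then show "x = y" using np f(4) g(4) unfolding bij_betw_def by (metis inj_onD)
    qed simp
  next
    fix y assume "y \<in> A'"
    then obtain n p where np: "n \<in> N'" "p \<in> P'" "y = n + p" using sum' by blast
    then obtain n0 p0 where 0: "n0 \<in> N" "p0 \<in> P" "n = f n0" "p = g p0"
      using f(4) g(4) unfolding bij_betw_def by blast
    have "y = h (n0 + p0)" unfolding np(3) h[OF 0(1,2)] 0(3,4) ..
    moreover have "n0 + p0 \<in> A" using 0(1,2) sub by (intro M.add_closed) auto
    ultimately show "\<exists>x\<in>A. y = h x" by blast
  qed (rule cl)
  have gr: "h x \<in> G' j" if x: "x \<in> G j" for j x
  proof -
    obtain n p where np: "n \<in> N" "p \<in> P" "x = n + p" using sum[OF M.homog_closed[OF x]] by blast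
    then have "n \<in> N \<inter> G j" "p \<in> P \<inter> G j" using summand_homog[OF M N P NP np(1,2)] x by auto
    then have "f n \<in> G' j" "g p \<in> G' j" using f(5)[of j] g(5)[of j] by blast+
    then show ?thesis unfolding np(3) h[OF np(1,2)] by (rule direct_grading_add[OF M'.grading])
  qed
  have "h ` G j = G' j" for j
    by (rule additive_bij_grading[OF M.grading M'.grading M.add_closed add bij gr])
  then show ?thesis unfolding graded_iso_def LinearCombinations.module_hom_def using cl add smult bij
    by (intro bexI[of _ h]) auto
qed

end

section \<open>Countably many modules of finite rank\<close>

lemma graded_module_sym:
  fixes M :: "('r::comm_ring_1, 'm) gmodule"
  assumes M: "graded_module ring_of_type_algebra Rg M" and iso: "graded_iso K M N"
  shows "graded_iso K N M"
proof -
  interpret M: Module.module ring_of_type_algebra M using M by (simp add: graded_module_def)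
  have "subgroup (hcomp M i) (add_monoid M)" for i using M by (simp add: graded_module_def is_grading_def)
  then have "hcomp M i \<subseteq> carrier M" for i using subgroup.subset by fastforce
  moreover have "r \<odot>\<^bsub>M\<^esub> x \<in> carrier M" if "x \<in> carrier M" for r x using M.smult_closed[of r x] that by simp
  ultimately show ?thesis by (intro graded_iso_sym[OF iso] M.add.m_closed[simplified])
qed

text \<open>With only reflexivity of E given, the class of M is the set of all N in \<A> with
  \<open>E M N\<close>. It contains M, so a member can be chosen from the class that carries a given
  number, and any such member serves as representative.\<close>

lemma iso_classes_key:
  assumes cnt: "countable (iso_classes E \<A>)" and refl: "\<And>M. M \<in> \<A> \<Longrightarrow> E M M"
  shows "\<exists>\<kappa> :: 'x \<Rightarrow> nat. \<exists>rep. \<forall>M\<in>\<A>. E M (rep (\<kappa> M))"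
proof -
  define cls where "cls M = {(x, y). x \<in> \<A> \<and> y \<in> \<A> \<and> E x y} `` {M}" for M
  have cls: "cls M \<in> iso_classes E \<A>" "M \<in> cls M" if "M \<in> \<A>" for M
  proof -
    show "cls M \<in> iso_classes E \<A>" unfolding cls_def iso_classes_def by (rule quotientI[OF that])
    show "M \<in> cls M" using that refl by (simp add: cls_def)
  qed
  define \<kappa> where "\<kappa> M = to_nat_on (iso_classes E \<A>) (cls M)" for M
  define rep where "rep n = (SOME N. N \<in> from_nat_into (iso_classes E \<A>) n)" for n
  have "E M (rep (\<kappa> M))" if M: "M \<in> \<A>" for M
  proof -
    have "from_nat_into (iso_classes E \<A>) (\<kappa> M) = cls M"
      unfolding \<kappa>_def using cls(1)[OF M] by (rule from_nat_into_to_nat_on[OF cnt])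
    then have "rep (\<kappa> M) \<in> cls M" unfolding rep_def using cls(2)[OF M] by (metis someI)
    then show ?thesis by (simp add: cls_def)
  qed
  then show ?thesis by blast
qed

context graded_setup
begin

text \<open>The hypothesis counts classes up to shift. The number of that class, paired with an
  integer by which its representative has to be shifted to become isomorphic to M, determines M up
  to isomorphism, and such pairs are still countable.\<close>

lemma indecomposable_key:
  assumes cnt: "graded_countable_CM_type Rg S"
  shows "\<exists>\<kappa> :: ('r, nat \<Rightarrow> 'r) gmodule \<Rightarrow> nat. \<forall>M M'.
    graded_mcm Rg S M \<and> graded_indecomposable ring_of_type_algebra M \<and>
    graded_mcm Rg S M' \<and> graded_indecomposable ring_of_type_algebra M' \<and> \<kappa> M = \<kappa> M' \<longrightarrow>
    graded_iso ring_of_type_algebra M M'"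
proof -
  let ?A = "{M :: ('r, nat \<Rightarrow> 'r) gmodule. graded_mcm Rg S M \<and> graded_indecomposable ring_of_type_algebra M}"
  have ex: "\<exists>i. graded_iso ring_of_type_algebra M (shift M i)" for M :: "('r, nat \<Rightarrow> 'r) gmodule"
    using graded_iso_refl by (intro exI[of _ 0]) (simp add: shift_def)
  have "\<exists>\<kappa> :: ('r, nat \<Rightarrow> 'r) gmodule \<Rightarrow> nat. \<exists>rep :: nat \<Rightarrow> ('r, nat \<Rightarrow> 'r) gmodule. \<forall>M\<in>?A.
      \<exists>i. graded_iso ring_of_type_algebra M (shift (rep (\<kappa> M)) i)"
    by (rule iso_classes_key[where E = "\<lambda>M N. \<exists>i. graded_iso ring_of_type_algebra M (shift N i)",
          OF cnt[unfolded graded_countable_CM_type_def]]) (rule ex)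
  then obtain \<kappa> :: "('r, nat \<Rightarrow> 'r) gmodule \<Rightarrow> nat" and rep :: "nat \<Rightarrow> ('r, nat \<Rightarrow> 'r) gmodule" where
    rep: "\<And>M. M \<in> ?A \<Longrightarrow> \<exists>i. graded_iso ring_of_type_algebra M (shift (rep (\<kappa> M)) i)" by blast
  define sh where "sh M = (SOME i. graded_iso ring_of_type_algebra M (shift (rep (\<kappa> M)) i))" for M
  have sh: "graded_iso ring_of_type_algebra M (shift (rep (\<kappa> M)) (sh M))" if "M \<in> ?A" for M
    unfolding sh_def using someI_ex[OF rep[OF that]] .
  define \<kappa>' where "\<kappa>' M = prod_encode (\<kappa> M, to_nat (sh M))" for M
  have "graded_iso ring_of_type_algebra M M'" if M: "M \<in> ?A" "M' \<in> ?A" "\<kappa>' M = \<kappa>' M'" for M M'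
  proof -
    have "\<kappa> M = \<kappa> M'" "sh M = sh M'" using M(3) by (auto simp: \<kappa>'_def prod_encode_eq)
    then have "graded_iso ring_of_type_algebra M (shift (rep (\<kappa> M')) (sh M'))" using sh[OF M(1)] by simp
    moreover have "graded_iso ring_of_type_algebra (shift (rep (\<kappa> M')) (sh M')) M'"
      using M(2) by (intro graded_module_sym[of Rg, OF _ sh[OF M(2)]]) (simp add: graded_mcm_def)
    ultimately show ?thesis by (rule graded_iso_trans)
  qed
  then show ?thesis by (intro exI[of _ \<kappa>']) simp
qed

text \<open>Modules are stored as triples with carrier in \<open>nat \<Rightarrow> 'r\<close>, the
  carrier type on which the representation type is counted. The bound on the rank is the induction
  parameter for splitting.\<close>

definition rank_le ::
    "nat \<Rightarrow> (nat \<Rightarrow> 'r) set \<times> ('r \<Rightarrow> (nat \<Rightarrow> 'r) \<Rightarrow> nat \<Rightarrow> 'r) \<times> (int \<Rightarrow> (nat \<Rightarrow> 'r) set) \<Rightarrow> bool" where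
  "rank_le n = (\<lambda>(A, act, G). typed_gmodule Rg A act G \<and> (\<exists>I e l. homog_basis S A act G I e l \<and> card I \<le> n))"

lemma zero_iso:
  assumes "typed_gmodule Rg A act G" "typed_gmodule Rg A' act' G'" "A = {0}" "A' = {0}"
  shows "graded_iso ring_of_type_algebra (mk_gmodule A act G) (mk_gmodule A' act' G')"
proof -
  interpret M: typed_gmodule Rg A act G by fact
  interpret M': typed_gmodule Rg A' act' G' by fact
  have "G j = {0}" "G' j = {0}" for j
    using M.homog_closed M'.homog_closed direct_gradingD(1)[OF M.grading] direct_gradingD(1)[OF M'.grading]
      assms(3,4) by blast+
  then show ?thesis
    unfolding graded_iso_def LinearCombinations.module_hom_def
    using assms(3,4) M'.act_zero by (intro bexI[of _ "\<lambda>_. 0"]) (auto simp: bij_betw_def)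
qed

text \<open>Every module of finite rank is determined by a finite binary tree of indecomposable summands
  and shifts; the key \<open>\<kappa>\<close> encodes such a tree.\<close>

lemma rank_key:
  assumes cnt: "graded_countable_CM_type Rg S"
  shows "\<exists>\<kappa> :: _ \<Rightarrow> nat. \<forall>A act G A' act' G'. rank_le n (A, act, G) \<and> rank_le n (A', act', G') \<and>
    \<kappa> (A, act, G) = \<kappa> (A', act', G') \<longrightarrow>
    graded_iso ring_of_type_algebra (mk_gmodule A act G) (mk_gmodule A' act' G')"
proof (induction n)
  case 0
  have A0: "A = {0}" if M: "rank_le 0 (A, act, G)" for A act G
  proof -
    have T: "typed_gmodule Rg A act G" using M by (simp add: rank_le_def)
    obtain I e l where b: "homog_basis S A act G I e l" "card I = 0" using M by (auto simp: rank_le_def)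
    have "I = {}" using b(2) homog_basisD(1)[OF b(1)] by simp
    have "x = 0" if "x \<in> A" for x using homog_basisD(3)[OF b(1) that] \<open>I = {}\<close> by auto
    then show ?thesis using typed_gmodule.zero_closed[OF T] by blast
  qed
  have "graded_iso ring_of_type_algebra (mk_gmodule A act G) (mk_gmodule A' act' G')"
    if "rank_le 0 (A, act, G)" "rank_le 0 (A', act', G')" for A act G A' act' G'
    using that by (intro zero_iso[OF _ _ A0[OF that(1)] A0[OF that(2)]]) (simp_all add: rank_le_def)
  then show ?case by (intro exI[of _ "\<lambda>_. 0"]) blast
next
  case (Suc n)
  obtain \<kappa> :: "_ \<Rightarrow> nat" where \<kappa>: "\<And>A act G A' act' G'. rank_le n (A, act, G) \<Longrightarrow> rank_le n (A', act', G') \<Longrightarrow>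
    \<kappa> (A, act, G) = \<kappa> (A', act', G') \<Longrightarrow>
    graded_iso ring_of_type_algebra (mk_gmodule A act G) (mk_gmodule A' act' G')" using Suc.IH by blast
  obtain \<iota>\<kappa> :: "('r, nat \<Rightarrow> 'r) gmodule \<Rightarrow> nat" where \<iota>\<kappa>: "\<And>M M'.
    graded_mcm Rg S M \<Longrightarrow> graded_indecomposable ring_of_type_algebra M \<Longrightarrow>
    graded_mcm Rg S M' \<Longrightarrow> graded_indecomposable ring_of_type_algebra M' \<Longrightarrow> \<iota>\<kappa> M = \<iota>\<kappa> M' \<Longrightarrow>
    graded_iso ring_of_type_algebra M M'" using indecomposable_key[OF cnt] by blast
  \<comment> \<open>A decomposition into two summands of rank at most n; \<open>sp\<close> fixes one
    for each decomposable module, and the key refers to that choice.\<close>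
  define good where "good A act G NP \<longleftrightarrow> (case NP of (N, P) \<Rightarrow>
    typed_submodule A act G N \<and> typed_submodule A act G P \<and> N \<inter> P = {0} \<and>
    (\<forall>x\<in>A. \<exists>n\<in>N. \<exists>p\<in>P. x = n + p) \<and> rank_le n (N, act, \<lambda>j. N \<inter> G j) \<and> rank_le n (P, act, \<lambda>j. P \<inter> G j))"
    for A :: "(nat \<Rightarrow> 'r) set" and act G NP
  define ind where "ind A act G \<longleftrightarrow> graded_indecomposable ring_of_type_algebra (mk_gmodule A act G)"
    for A :: "(nat \<Rightarrow> 'r) set" and act :: "'r \<Rightarrow> (nat \<Rightarrow> 'r) \<Rightarrow> nat \<Rightarrow> 'r" and G
  define sp where "sp A act G = (SOME NP. good A act G NP)" for A act G
  have good: "good A act G (sp A act G)"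
    if M: "rank_le (Suc n) (A, act, G)" "A \<noteq> {0}" "\<not> ind A act G" for A act G
  proof -
    have T: "typed_gmodule Rg A act G" using M by (simp add: rank_le_def)
    obtain I e l where b: "homog_basis S A act G I e l" "card I \<le> Suc n" using M by (auto simp: rank_le_def)
    obtain N P where NP: "typed_submodule A act G N" "typed_submodule A act G P" "N \<inter> P = {0}"
      "\<forall>x\<in>A. \<exists>n\<in>N. \<exists>p\<in>P. x = n + p" "N \<noteq> {0}" "P \<noteq> {0}"
      using decomposable_mk[OF T M(2)] M(3) unfolding ind_def by blast
    obtain IN eN where N: "card IN < card I" "homog_basis S N act (\<lambda>j. N \<inter> G j) IN eN l"
      using summand_basis[OF T b(1) NP(1,2,3) _ NP(6)] NP(4) by blast
    have "P \<inter> N = {0}" using NP(3) by blast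
    moreover have "\<exists>p\<in>P. \<exists>n\<in>N. x = p + n" if "x \<in> A" for x
      using NP(4) that by (metis add.commute)
    ultimately obtain IP eP where P: "card IP < card I" "homog_basis S P act (\<lambda>j. P \<inter> G j) IP eP l"
      using summand_basis[OF T b(1) NP(2,1) _ _ NP(5)] by blast
    have "rank_le n (N, act, \<lambda>j. N \<inter> G j)"
      using typed_submodule_gmodule[OF T NP(1)] N b(2) unfolding rank_le_def by fastforce
    moreover have "rank_le n (P, act, \<lambda>j. P \<inter> G j)"
      using typed_submodule_gmodule[OF T NP(2)] P b(2) unfolding rank_le_def by fastforce
    ultimately have "good A act G (N, P)" using NP by (simp add: good_def)
    then show ?thesis unfolding sp_def by (rule someI)
  qed
  \<comment> \<open>Three disjoint tags: \<open>None\<close> for the zero module, which does not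
    count as indecomposable, \<open>Inl\<close> with the key of an indecomposable module,
    \<open>Inr\<close> with the keys of the two chosen summands. Equal keys therefore come from the
    same case.\<close>
  define \<kappa>' where "\<kappa>' = (\<lambda>(A, act, G). to_nat (if A = {0} then None
    else if ind A act G then Some (Inl (\<iota>\<kappa> (mk_gmodule A act G)))
    else Some (Inr (\<kappa> (fst (sp A act G), act, \<lambda>j. fst (sp A act G) \<inter> G j),
      \<kappa> (snd (sp A act G), act, \<lambda>j. snd (sp A act G) \<inter> G j)) :: nat + nat \<times> nat)))"
  have "graded_iso ring_of_type_algebra (mk_gmodule A act G) (mk_gmodule A' act' G')"
    if M: "rank_le (Suc n) (A, act, G)" "rank_le (Suc n) (A', act', G')" "\<kappa>' (A, act, G) = \<kappa>' (A', act', G')"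
    for A act G A' act' G'
  proof -
    have T: "typed_gmodule Rg A act G" "typed_gmodule Rg A' act' G'" using M(1,2) by (simp_all add: rank_le_def)
    have mcm: "graded_mcm Rg S (mk_gmodule A act G)" "graded_mcm Rg S (mk_gmodule A' act' G')"
      using M(1,2) graded_mcm_mk unfolding rank_le_def by blast+
    consider (zero) "A = {0}" "A' = {0}"
      | (ind) "ind A act G" "ind A' act' G'" "\<iota>\<kappa> (mk_gmodule A act G) = \<iota>\<kappa> (mk_gmodule A' act' G')"
      | (dec) "A \<noteq> {0}" "A' \<noteq> {0}" "\<not> ind A act G" "\<not> ind A' act' G'"
        "\<kappa> (fst (sp A act G), act, \<lambda>j. fst (sp A act G) \<inter> G j) =
         \<kappa> (fst (sp A' act' G'), act', \<lambda>j. fst (sp A' act' G') \<inter> G' j)"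
        "\<kappa> (snd (sp A act G), act, \<lambda>j. snd (sp A act G) \<inter> G j) =
         \<kappa> (snd (sp A' act' G'), act', \<lambda>j. snd (sp A' act' G') \<inter> G' j)"
      using M(3) unfolding \<kappa>'_def by (simp split: if_splits)
    then show ?thesis
    proof cases
      case zero then show ?thesis by (rule zero_iso[OF T])
    next
      case ind then show ?thesis using \<iota>\<kappa> mcm by (simp add: ind_def)
    next
      case dec
      obtain N P where sp: "sp A act G = (N, P)" by (meson surj_pair)
      obtain N' P' where sp': "sp A' act' G' = (N', P')" by (meson surj_pair)
      have g: "typed_submodule A act G N" "typed_submodule A act G P" "N \<inter> P = {0}"
        "\<And>x. x \<in> A \<Longrightarrow> \<exists>n\<in>N. \<exists>p\<in>P. x = n + p" "rank_le n (N, act, \<lambda>j. N \<inter> G j)" "rank_le n (P, act, \<lambda>j. P \<inter> G j)"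
        using good[OF M(1) dec(1,3)] unfolding sp good_def by simp_all
      have g': "typed_submodule A' act' G' N'" "typed_submodule A' act' G' P'" "N' \<inter> P' = {0}"
        "\<And>x. x \<in> A' \<Longrightarrow> \<exists>n\<in>N'. \<exists>p\<in>P'. x = n + p" "rank_le n (N', act', \<lambda>j. N' \<inter> G' j)" "rank_le n (P', act', \<lambda>j. P' \<inter> G' j)"
        using good[OF M(2) dec(2,4)] unfolding sp' good_def by simp_all
      show ?thesis
        by (rule glue_iso[OF T(1) g(1-4) T(2) g'(1-4) \<kappa>[OF g(5) g'(5)] \<kappa>[OF g(6) g'(6)]])
          (use dec(5,6) in \<open>simp_all add: sp sp'\<close>)
    qed
  qed
  then show ?case by (intro exI[of _ \<kappa>']) blast
qed

end

section \<open>Module structures on a graded free module\<close>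

lemma sum_fun_apply: "(\<Sum>j\<in>J. f j) i = (\<Sum>j\<in>J. f j i :: 'a::comm_monoid_add)"
  by (induction J rule: infinite_finite_induct) auto

context graded_setup
begin

text \<open>Vectors vanish from position m on, in place of the extensional functions of
  \<open>graded_free_module\<close>, so that they form an additive subgroup of the function
  type.\<close>

definition free_carrier :: "nat \<Rightarrow> (nat \<Rightarrow> 'r) set" where
  "free_carrier m = {v. (\<forall>i<m. v i \<in> S) \<and> (\<forall>i\<ge>m. v i = 0)}"

definition free_grading :: "nat \<Rightarrow> (nat \<Rightarrow> int) \<Rightarrow> int \<Rightarrow> (nat \<Rightarrow> 'r) set" where
  "free_grading m l j = {v \<in> free_carrier m. \<forall>i<m. v i \<in> Rg (j + l i)}"

definition unit_vec :: "nat \<Rightarrow> nat \<Rightarrow> 'r" where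
  "unit_vec i = (\<lambda>j. if j = i then 1 else 0)"

lemma Rg_zero: "0 \<in> Rg j" by (rule direct_gradingD(1)[OF Rg])
lemma Rg_diff: "r \<in> Rg j \<Longrightarrow> s \<in> Rg j \<Longrightarrow> r - s \<in> Rg j" by (rule direct_gradingD(3)[OF Rg])
lemma Rg_sum: "(\<And>i. i \<in> I \<Longrightarrow> f i \<in> Rg j) \<Longrightarrow> sum f I \<in> Rg j" by (rule direct_grading_sum[OF Rg])
lemma Rg_mult': "r \<in> Rg i \<Longrightarrow> s \<in> Rg j \<Longrightarrow> p = i + j \<Longrightarrow> r * s \<in> Rg p" using Rg_mult by simp
lemma iota_Rg: "\<iota> c \<in> Rg 0" by (simp add: Rg_0)

text \<open>Everything is coordinatewise: the component of v in degree j has as i-th entry the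
  component of \<open>v i\<close> in degree \<open>j + l i\<close>.\<close>

lemma free_grading_direct: "direct_grading (free_carrier m) (free_grading m l)"
  unfolding direct_grading_def
proof (intro conjI allI ballI impI)
  fix i show "0 \<in> free_grading m l i" by (auto simp: free_grading_def free_carrier_def S_0 Rg_zero)
  show "free_grading m l i \<subseteq> free_carrier m" by (auto simp: free_grading_def)
  fix x y assume "x \<in> free_grading m l i" "y \<in> free_grading m l i"
  then show "x - y \<in> free_grading m l i"
    by (auto simp: free_grading_def free_carrier_def intro: S_diff Rg_diff)
next
  fix v assume v: "v \<in> free_carrier m"
  define c where "c i = homog_comp Rg (v i)" for i
  have c: "homog_decomp Rg (c i) (v i)" for i unfolding c_def by (rule homog_comp_decomp[OF Rg UNIV_I])
  define f where "f j = (\<lambda>i. if i < m then c i (j + l i) else 0)" for j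
  define J where "J = (\<Union>i<m. (\<lambda>q. q - l i) ` {q. c i q \<noteq> 0})"
  have J: "finite J" unfolding J_def using c by (auto simp: homog_decomp_def)
  have fG: "f j \<in> free_grading m l j" for j
    using c S_homog v by (auto simp: f_def free_grading_def free_carrier_def homog_decomp_def c_def)
  have zero: "f j = 0" if "j \<notin> J" for j
  proof
    fix i show "f j i = 0 i"
    proof (rule ccontr)
      assume "f j i \<noteq> 0 i"
      then have i: "i < m" "c i (j + l i) \<noteq> 0" by (auto simp: f_def split: if_splits)
      then have "j \<in> (\<lambda>q. q - l i) ` {q. c i q \<noteq> 0}" by (intro image_eqI[of _ _ "j + l i"]) auto
      then show False using that i(1) unfolding J_def by blast
    qed
  qed
  have "v i = (\<Sum>j\<in>J. f j i)" for i
  proof (cases "i < m")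
    case False then show ?thesis using v by (simp add: f_def free_carrier_def)
  next
    case True
    have "{q. c i q \<noteq> 0} \<subseteq> (\<lambda>p. p + l i) ` J"
    proof
      fix q assume "q \<in> {q. c i q \<noteq> 0}"
      then have "q - l i \<in> J" unfolding J_def using True by blast
      then show "q \<in> (\<lambda>p. p + l i) ` J" by (intro image_eqI[of _ _ "q - l i"]) auto
    qed
    then have "v i = (\<Sum>q\<in>(\<lambda>p. p + l i) ` J. c i q)" using homog_decomp_sum[OF c] J by blast
    also have "\<dots> = (\<Sum>p\<in>J. c i (p + l i))" by (subst sum.reindex) (auto simp: inj_on_def)
    finally show ?thesis using True by (simp add: f_def)
  qed
  then have v_eq: "v = (\<Sum>j\<in>J. f j)" by (intro ext) (simp add: sum_fun_apply)
  have "homog_decomp (free_grading m l) f v" by (rule homog_decompI[OF J zero fG v_eq])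
  show "\<exists>f. homog_decomp (free_grading m l) f v"
    by (rule exI[where x = f]) (rule \<open>homog_decomp (free_grading m l) f v\<close>)
next
  fix f j assume f: "homog_decomp (free_grading m l) f 0"
  let ?I = "{j. f j \<noteq> 0}"
  have fin: "finite ?I" and sum: "0 = (\<Sum>j\<in>?I. f j)" and fG: "\<And>j. f j \<in> free_grading m l j"
    using f by (auto simp: homog_decomp_def)
  show "f j = 0"
  proof
    fix i show "f j i = 0 i"
    proof (cases "i < m")
      case False
      then show ?thesis using fG[of j] by (simp add: free_grading_def free_carrier_def)
    next
      case True
      have "homog_decomp Rg (\<lambda>q. f (q - l i) i) 0"
      proof (rule homog_decompI[of "(\<lambda>j. j + l i) ` ?I"])
        show "finite ((\<lambda>j. j + l i) ` ?I)" using fin by simp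
        show "f (q - l i) i = 0" if "q \<notin> (\<lambda>j. j + l i) ` ?I" for q
        proof -
          have "q - l i \<notin> ?I" using that by (metis (no_types, lifting) diff_add_cancel image_eqI)
          then show ?thesis by simp
        qed
        show "f (q - l i) i \<in> Rg q" for q using fG[of "q - l i"] True by (auto simp: free_grading_def)
        have "(\<Sum>q\<in>(\<lambda>j. j + l i) ` ?I. f (q - l i) i) = (\<Sum>j\<in>?I. f j i)"
          by (subst sum.reindex) (auto simp: inj_on_def)
        then show "0 = (\<Sum>q\<in>(\<lambda>j. j + l i) ` ?I. f (q - l i) i)"
          using fun_cong[OF sum, of i] by (simp add: sum_fun_apply)
      qed
      from direct_gradingD(5)[OF Rg this, of "j + l i"] show ?thesis by simp
    qed
  qed
qed

text \<open>The graded R-module structures on a fixed graded free S-module that extend its S-action;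
  these are the points of the parameter space to come.\<close>

definition free_structure :: "nat \<Rightarrow> (nat \<Rightarrow> int) \<Rightarrow> ('r \<Rightarrow> (nat \<Rightarrow> 'r) \<Rightarrow> nat \<Rightarrow> 'r) \<Rightarrow> bool" where
  "free_structure m l act \<longleftrightarrow> typed_gmodule Rg (free_carrier m) act (free_grading m l) \<and>
     (\<forall>s\<in>S. \<forall>v\<in>free_carrier m. act s v = (\<lambda>i. s * v i))"

lemma unit_vec_in: "i < m \<Longrightarrow> unit_vec i \<in> free_carrier m"
  "i < m \<Longrightarrow> unit_vec i \<in> free_grading m l (- l i)"
  by (auto simp: unit_vec_def free_carrier_def free_grading_def S_0 S_1 Rg_zero one_Rg)

lemma sum_unit_vec: "(\<Sum>i<m. f i * unit_vec i j) = (if j < m then f j else 0)"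
  by (simp add: unit_vec_def if_distrib[of "\<lambda>x. _ * x"] cong: if_cong)

lemma free_structure_basis:
  assumes "free_structure m l act"
  shows "homog_basis S (free_carrier m) act (free_grading m l) {..<m} unit_vec l"
proof -
  have act: "act s v = (\<lambda>i. s * v i)" if "s \<in> S" "v \<in> free_carrier m" for s v
    using assms that by (simp add: free_structure_def)
  have sum: "(\<Sum>i<m. act (f i) (unit_vec i)) = (\<lambda>j. if j < m then f j else 0)" if "\<forall>i\<in>{..<m}. f i \<in> S" for f
  proof
    fix j
    have "(\<Sum>i<m. act (f i) (unit_vec i)) j = (\<Sum>i<m. f i * unit_vec i j)"
      unfolding sum_fun_apply using that act unit_vec_in(1) by (intro sum.cong) auto
    then show "(\<Sum>i<m. act (f i) (unit_vec i)) j = (if j < m then f j else 0)" by (simp add: sum_unit_vec)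
  qed
  have "\<exists>f. (\<forall>i\<in>{..<m}. f i \<in> S) \<and> v = (\<Sum>i<m. act (f i) (unit_vec i))" if v: "v \<in> free_carrier m" for v
  proof (intro exI conjI)
    show S: "\<forall>i\<in>{..<m}. v i \<in> S" using v by (simp add: free_carrier_def)
    show "v = (\<Sum>i<m. act (v i) (unit_vec i))"
      unfolding sum[OF S] using v by (auto simp: free_carrier_def)
  qed
  moreover have "f i = 0" if f: "\<forall>i\<in>{..<m}. f i \<in> S" "(\<Sum>i<m. act (f i) (unit_vec i)) = 0" "i < m" for f i
    using fun_cong[OF f(2)[unfolded sum[OF f(1)]], of i] f(3) by simp
  ultimately show ?thesis unfolding homog_basis_def using unit_vec_in(2) by auto
qed

text \<open>Transport of structure along the S-isomorphism. It moves a module with carrier in an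
  arbitrary type to the fixed carrier, and the transporting map is R-linear by construction.\<close>

lemma free_structure_of_iso:
  fixes M :: "('r, 'm) gmodule"
  assumes M: "graded_module ring_of_type_algebra Rg M"
    and iso: "graded_iso (subring_of S) M (graded_free_module Rg S m l)"
  shows "\<exists>act. free_structure m l act \<and>
    graded_iso ring_of_type_algebra M (mk_gmodule (free_carrier m) act (free_grading m l))"
proof -
  interpret M: Module.module ring_of_type_algebra M using M by (simp add: graded_module_def)
  obtain f where f: "f \<in> LinearCombinations.module_hom (subring_of S) M (graded_free_module Rg S m l)"
    and f_bij: "bij_betw f (carrier M) ({..<m} \<rightarrow>\<^sub>E S)"
    and f_gr: "\<And>j. f ` hcomp M j = {f \<in> {..<m} \<rightarrow>\<^sub>E S. \<forall>i<m. f i \<in> Rg (j + l i)}"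
    using iso unfolding graded_iso_def free_module_simps by blast
  have fE: "f x \<in> {..<m} \<rightarrow>\<^sub>E S" if "x \<in> carrier M" for x using f_bij that by (auto simp: bij_betw_def)
  define h where "h x = (\<lambda>i. if i < m then f x i else 0)" for x
  have h_add: "h (x \<oplus>\<^bsub>M\<^esub> y) = h x + h y" if "x \<in> carrier M" "y \<in> carrier M" for x y
    using LinearCombinations.module_hom_add[OF f that] by (auto simp: h_def free_module_simps)
  have h_smult: "h (s \<odot>\<^bsub>M\<^esub> x) = (\<lambda>i. s * h x i)" if "s \<in> S" "x \<in> carrier M" for s x
    using LinearCombinations.module_hom_smult[OF f _ that(2), of s] that(1) by (auto simp: h_def free_module_simps)
  have h_in: "h x \<in> free_carrier m" if "x \<in> carrier M" for x
    using fE[OF that] by (auto simp: h_def free_carrier_def)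
  have ext: "restrict v {..<m} \<in> {..<m} \<rightarrow>\<^sub>E S" if "v \<in> free_carrier m" for v
    using that by (auto simp: free_carrier_def)
  have hf: "h x = v" if "v \<in> free_carrier m" "f x = restrict v {..<m}" for x v
    using that by (auto simp: h_def free_carrier_def)
  have h_bij: "bij_betw h (carrier M) (free_carrier m)"
  proof (rule bij_betwI')
    fix x y assume xy: "x \<in> carrier M" "y \<in> carrier M"
    show "(h x = h y) = (x = y)"
    proof
      assume eq: "h x = h y"
      have "f x = f y"
      proof (rule PiE_ext[OF fE[OF xy(1)] fE[OF xy(2)]])
        fix i assume "i \<in> {..<m}" then show "f x i = f y i" using fun_cong[OF eq, of i] by (simp add: h_def)
      qed
      then show "x = y" using f_bij xy unfolding bij_betw_def by (meson inj_onD)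
    qed simp
  next
    fix v assume v: "v \<in> free_carrier m"
    then obtain x where "x \<in> carrier M" "f x = restrict v {..<m}"
      using ext[OF v] f_bij unfolding bij_betw_def by (metis imageE)
    then show "\<exists>x\<in>carrier M. v = h x" using hf[OF v] by blast
  qed (rule h_in)
  have h_gr: "h ` hcomp M j = free_grading m l j" for j
  proof (intro equalityI subsetI)
    fix v assume "v \<in> h ` hcomp M j"
    then obtain x where x: "x \<in> hcomp M j" "v = h x" by blast
    then have "f x \<in> {f \<in> {..<m} \<rightarrow>\<^sub>E S. \<forall>i<m. f i \<in> Rg (j + l i)}" using f_gr[of j] by blast
    then show "v \<in> free_grading m l j"
      unfolding x(2) by (auto simp: h_def free_grading_def free_carrier_def)
  next
    fix v assume v: "v \<in> free_grading m l j"
    then have "restrict v {..<m} \<in> f ` hcomp M j" unfolding f_gr by (auto simp: free_grading_def free_carrier_def)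
    then obtain x where x: "x \<in> hcomp M j" "f x = restrict v {..<m}" by (metis imageE)
    have "h x = v" by (rule hf[OF _ x(2)]) (use v in \<open>simp add: free_grading_def\<close>)
    then show "v \<in> h ` hcomp M j" using x(1) by blast
  qed
  define k where "k = inv_into (carrier M) h"
  have k: "k v \<in> carrier M" "h (k v) = v" if "v \<in> free_carrier m" for v
    using that h_bij unfolding k_def bij_betw_def by (metis inv_into_into, metis f_inv_into_f)
  have kh: "k (h x) = x" if "x \<in> carrier M" for x
    using that h_bij unfolding k_def bij_betw_def by (simp add: inv_into_f_f)
  define act where "act r v = h (r \<odot>\<^bsub>M\<^esub> k v)" for r v
  note R_cl = M.smult_closed[simplified]
  have h_act: "h (r \<odot>\<^bsub>M\<^esub> x) = act r (h x)" if "x \<in> carrier M" for r x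
    unfolding act_def kh[OF that] ..
  have hM: "\<exists>x\<in>carrier M. v = h x" if "v \<in> free_carrier m" for v using k[OF that] by metis
  have T: "typed_gmodule Rg (free_carrier m) act (free_grading m l)"
  proof unfold_locales
    show "direct_grading (free_carrier m) (free_grading m l)" by (rule free_grading_direct)
    show "x - y \<in> free_carrier m" if "x \<in> free_carrier m" "y \<in> free_carrier m" for x y
      using that by (auto simp: free_carrier_def intro: S_diff)
    show "act r v \<in> free_carrier m" if "v \<in> free_carrier m" for r v
      unfolding act_def using k(1)[OF that] by (intro h_in R_cl)
    fix r s :: 'r and v w assume v: "v \<in> free_carrier m"
    obtain x where x: "x \<in> carrier M" "v = h x" using hM[OF v] by blast
    show "act (r + s) v = act r v + act s v"
      unfolding x(2) h_act[OF x(1), symmetric] using M.smult_l_distr[of r s x] x(1) h_add R_cl by simp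
    show "act (r * s) v = act r (act s v)"
      unfolding x(2) h_act[OF x(1), symmetric] h_act[OF R_cl[OF x(1)], symmetric]
      using M.smult_assoc1[of r s x] x(1) by simp
    show "act 1 v = v" unfolding x(2) h_act[OF x(1), symmetric] using M.smult_one[OF x(1)] by simp
    assume w: "w \<in> free_carrier m"
    obtain y where y: "y \<in> carrier M" "w = h y" using hM[OF w] by blast
    have "act r (h (x \<oplus>\<^bsub>M\<^esub> y)) = act r (h x) + act r (h y)"
      unfolding h_act[OF x(1), symmetric] h_act[OF y(1), symmetric] h_act[OF M.add.m_closed[OF x(1) y(1)], symmetric]
      using M.smult_r_distr[of r x y] x(1) y(1) h_add R_cl by simp
    then show "act r (v + w) = act r v + act r w" unfolding x(2) y(2) h_add[OF x(1) y(1)] .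
  next
    fix r i v j assume r: "r \<in> Rg i" and "v \<in> free_grading m l j"
    then obtain x where x: "x \<in> hcomp M j" "v = h x" using h_gr[of j] by blast
    have "subgroup (hcomp M j) (add_monoid M)" using M by (simp add: graded_module_def is_grading_def)
    then have xM: "x \<in> carrier M" using x(1) subgroup.subset by fastforce
    have "r \<odot>\<^bsub>M\<^esub> x \<in> hcomp M (i + j)" using M r x(1) by (simp add: graded_module_def)
    then show "act r v \<in> free_grading m l (i + j)"
      unfolding x(2) h_act[OF xM, symmetric] using h_gr[of "i + j"] by blast
  qed
  have "act s v = (\<lambda>i. s * v i)" if "s \<in> S" "v \<in> free_carrier m" for s v
    unfolding act_def using h_smult[OF that(1) k(1)[OF that(2)]] k(2)[OF that(2)] by simp
  then have "free_structure m l act" using T by (simp add: free_structure_def)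
  moreover have "graded_iso ring_of_type_algebra M (mk_gmodule (free_carrier m) act (free_grading m l))"
    unfolding graded_iso_def LinearCombinations.module_hom_def
    using h_in h_add h_act h_bij h_gr by (intro bexI[of _ h]) auto
  ultimately show ?thesis by blast
qed

section \<open>Coordinates on the homogeneous components of S\<close>

definition linear_form :: "('r \<Rightarrow> 'k) \<Rightarrow> bool" where
  "linear_form L \<longleftrightarrow> (\<forall>r s. L (r + s) = L r + L s) \<and> (\<forall>c r. L (\<iota> c * r) = c * L r)"

text \<open>A k-basis U of the component of S in degree d with its coordinate functionals. The
  functionals are k-linear on all of R, so that they can be applied termwise to sums in R whose
  single terms need not have degree d.\<close>

definition homog_coords :: "int \<Rightarrow> 'r set \<Rightarrow> ('r \<Rightarrow> 'r \<Rightarrow> 'k) \<Rightarrow> bool" where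
  "homog_coords d U lam \<longleftrightarrow> finite U \<and> U \<subseteq> S \<inter> Rg d \<and> (\<forall>u. linear_form (lam u)) \<and>
     (\<forall>v\<in>S \<inter> Rg d. v = (\<Sum>u\<in>U. \<iota> (lam u v) * u)) \<and>
     (\<forall>c. (\<Sum>u\<in>U. \<iota> (c u) * u) = 0 \<longrightarrow> (\<forall>u\<in>U. c u = 0))"

lemma homog_coords_exist: "\<exists>U lam. homog_coords d U lam"
proof -
  interpret V: vector_space "\<lambda>c r. \<iota> c * r"
    by unfold_locales (auto simp: algebra_simps iota_add iota_mult iota_one)
  obtain T where T: "finite T" "T \<subseteq> S \<inter> Rg d" "\<And>s. s \<in> S \<inter> Rg d \<Longrightarrow> \<exists>c. s = (\<Sum>t\<in>T. \<iota> (c t) * t)"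
    using S_fin[of d] by blast
  obtain U where U: "U \<subseteq> T" "V.independent U" "T \<subseteq> V.span U"
    using V.maximal_independent_subset[of T] by blast
  have fin: "finite U" using U(1) T(1) finite_subset by blast
  have span: "v \<in> V.span U" if v: "v \<in> S \<inter> Rg d" for v
  proof -
    obtain c where "v = (\<Sum>t\<in>T. \<iota> (c t) * t)" using T(3)[OF v] by blast
    then show ?thesis using U(3) by (auto intro!: V.span_sum V.span_scale)
  qed
  \<comment> \<open>Extending U to a k-basis of the whole ring makes the coordinates linear
    functions on R.\<close>
  define B where "B = V.extend_basis U"
  have B: "V.independent B" "U \<subseteq> B" "V.span B = UNIV"
    unfolding B_def using V.independent_extend_basis[OF U(2)] V.extend_basis_superset[OF U(2)]
      V.span_extend_basis[OF U(2)] by auto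
  define lam where "lam u v = V.representation B v u" for u v
  have "linear_form (lam u)" for u
    unfolding linear_form_def lam_def
    using V.representation_add[OF B(1)] V.representation_scale[OF B(1)] B(3) by auto
  moreover have "v = (\<Sum>u\<in>U. \<iota> (lam u v) * u)" if v: "v \<in> S \<inter> Rg d" for v
  proof -
    have "V.representation B v = V.representation U v"
      using V.representation_extend[OF B(1) span[OF v] B(2)] .
    then show ?thesis unfolding lam_def
      using V.sum_representation_eq[OF U(2) span[OF v] fin order_refl] by simp
  qed
  moreover have "c u = 0" if "(\<Sum>u\<in>U. \<iota> (c u) * u) = 0" "u \<in> U" for c u
    using U(2) fin that unfolding V.dependent_finite[OF fin] by blast
  ultimately have "homog_coords d U lam" unfolding homog_coords_def using fin U(1) T(2) by blast
  then show ?thesis by blast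
qed

end

section \<open>Coordinates and polynomial families\<close>

context graded_setup
begin

lemma R_gmodule: "typed_gmodule Rg UNIV (*) Rg"
  by unfold_locales (auto simp: algebra_simps Rg Rg_mult)

lemma linear_formD:
  assumes "linear_form L"
  shows "L (r + s) = L r + L s" "L (\<iota> c * r) = c * L r" "L 0 = 0" "L (r - s) = L r - L s"
    "L (sum f I) = (\<Sum>i\<in>I. L (f i))"
proof -
  show add: "L (r + s) = L r + L s" for r s using assms by (simp add: linear_form_def)
  show smult: "L (\<iota> c * r) = c * L r" for c r using assms by (simp add: linear_form_def)
  show zero: "L 0 = 0" using smult[of 0 0] by (simp add: iota_zero)
  show "L (r - s) = L r - L s" using add[of "r - s" s] by simp
  show "L (sum f I) = (\<Sum>i\<in>I. L (f i))"
    by (induction I rule: infinite_finite_induct) (auto simp: zero add)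
qed

definition homog_base :: "int \<Rightarrow> 'r set" where
  "homog_base d = (SOME U. \<exists>lam. homog_coords d U lam)"

definition homog_coord :: "int \<Rightarrow> 'r \<Rightarrow> 'r \<Rightarrow> 'k" where
  "homog_coord d = (SOME lam. homog_coords d (homog_base d) lam)"

lemma homog_coords: "homog_coords d (homog_base d) (homog_coord d)"
proof -
  have "\<exists>lam. homog_coords d (homog_base d) lam"
    unfolding homog_base_def by (rule someI_ex[OF homog_coords_exist])
  then show ?thesis unfolding homog_coord_def by (rule someI_ex)
qed

lemma homog_base_fin: "finite (homog_base d)"
  and homog_base_in: "u \<in> homog_base d \<Longrightarrow> u \<in> S" "u \<in> homog_base d \<Longrightarrow> u \<in> Rg d"
  and homog_coord_linear: "linear_form (homog_coord d w)"
  and homog_coord_sum: "v \<in> S \<Longrightarrow> v \<in> Rg d \<Longrightarrow> (\<Sum>u\<in>homog_base d. \<iota> (homog_coord d u v) * u) = v"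
  using homog_coords[of d] unfolding homog_coords_def by auto

lemma homog_coord_zero:
  assumes "v \<in> S" "v \<in> Rg d" "\<And>u. u \<in> homog_base d \<Longrightarrow> homog_coord d u v = 0"
  shows "v = 0"
  using homog_coord_sum[OF assms(1,2)] assms(3) by (simp add: iota_zero)

lemma homog_comb_in:
  "(\<Sum>u\<in>homog_base d. \<iota> (c u) * u) \<in> S" "(\<Sum>u\<in>homog_base d. \<iota> (c u) * u) \<in> Rg d"
  using homog_base_in Rg_mult'[OF iota_Rg]
  by (auto intro!: S_sum S_mult iota_S Rg_sum)

text \<open>Polynomial families of ring elements: finite sums of fixed elements of R with polynomial
  functions as coefficients. Matrix entries and determinants are of this kind, and a k-linear form
  turns them into polynomial functions.\<close>

inductive_set rpolyfun :: "'i set \<Rightarrow> (('i \<Rightarrow> 'k) \<Rightarrow> 'r) set" for J where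
  rpolyfun_base: "p \<in> polyfun J \<Longrightarrow> (\<lambda>c. \<iota> (p c) * s) \<in> rpolyfun J"
| rpolyfun_add: "\<Phi> \<in> rpolyfun J \<Longrightarrow> \<Psi> \<in> rpolyfun J \<Longrightarrow> (\<lambda>c. \<Phi> c + \<Psi> c) \<in> rpolyfun J"

lemma rpolyfun_const: "(\<lambda>_. s) \<in> rpolyfun J"
  using rpolyfun_base[OF polyfun_const[of 1 J], of s] by (simp add: iota_one)

lemma rpolyfun_sum: "(\<And>a. a \<in> A \<Longrightarrow> \<Phi> a \<in> rpolyfun J) \<Longrightarrow> (\<lambda>c. \<Sum>a\<in>A. \<Phi> a c) \<in> rpolyfun J"
  by (induction A rule: infinite_finite_induct) (auto intro: rpolyfun_const rpolyfun_add)

lemma rpolyfun_mult: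
  assumes "\<Phi> \<in> rpolyfun J" "\<Psi> \<in> rpolyfun J"
  shows "(\<lambda>c. \<Phi> c * \<Psi> c) \<in> rpolyfun J"
  using assms(1)
proof (induction rule: rpolyfun.induct)
  case (rpolyfun_base p s)
  show ?case using assms(2)
  proof (induction rule: rpolyfun.induct)
    case (rpolyfun_base q t)
    from rpolyfun.rpolyfun_base[OF polyfun_mult[OF \<open>p \<in> polyfun J\<close> rpolyfun_base], of "s * t"]
    show ?case by (simp add: iota_mult mult_ac)
  next
    case (rpolyfun_add \<Phi> \<Psi>)
    from rpolyfun.rpolyfun_add[OF rpolyfun_add.IH] show ?case by (simp add: distrib_left)
  qed
next
  case (rpolyfun_add \<Phi> \<Psi>')
  from rpolyfun.rpolyfun_add[OF rpolyfun_add.IH] show ?case by (simp add: distrib_right)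
qed

lemma rpolyfun_prod: "(\<And>a. a \<in> A \<Longrightarrow> \<Phi> a \<in> rpolyfun J) \<Longrightarrow> (\<lambda>c. \<Prod>a\<in>A. \<Phi> a c) \<in> rpolyfun J"
  by (induction A rule: infinite_finite_induct) (auto intro: rpolyfun_const rpolyfun_mult)

lemma rpolyfun_diff: "\<Phi> \<in> rpolyfun J \<Longrightarrow> \<Psi> \<in> rpolyfun J \<Longrightarrow> (\<lambda>c. \<Phi> c - \<Psi> c) \<in> rpolyfun J"
  using rpolyfun_add[OF _ rpolyfun_mult[OF rpolyfun_const[of "- 1"]], of \<Phi> J \<Psi>] by simp

lemma rpolyfun_linear:
  assumes "\<Phi> \<in> rpolyfun J" "linear_form L"
  shows "(\<lambda>c. L (\<Phi> c)) \<in> polyfun J"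
  using assms(1)
proof (induction rule: rpolyfun.induct)
  case (rpolyfun_base p s)
  show ?case unfolding linear_formD(2)[OF assms(2)] by (intro polyfun_mult rpolyfun_base polyfun_const)
next
  case (rpolyfun_add \<Phi> \<Psi>)
  show ?case unfolding linear_formD(1)[OF assms(2)] by (intro polyfun_add rpolyfun_add.IH)
qed

section \<open>Matrices with homogeneous entries\<close>

lemma det_in_S:
  assumes A: "A \<in> carrier_mat m m" and S: "\<And>i j. i < m \<Longrightarrow> j < m \<Longrightarrow> A $$ (i, j) \<in> S"
  shows "Determinant.det A \<in> S"
  unfolding det_def'[OF A]
proof (intro S_sum S_mult)
  fix p assume "p \<in> {p. p permutes {0..<m}}"
  then have p: "p permutes {0..<m}" by simp
  have "(signof p :: 'r) = 1 \<or> (signof p :: 'r) = - 1" by (simp add: sign_def)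
  then show "(signof p :: 'r) \<in> S" using S_1 S_uminus by auto
  have "(\<Prod>i\<in>I. A $$ (i, p i)) \<in> S" if "I \<subseteq> {0..<m}" for I
    using finite_subset[OF that finite_atLeastLessThan] that
  proof (induction I rule: finite_induct)
    case empty then show ?case using S_1 by simp
  next
    case (insert i I)
    have "p i < m" using permutes_in_image[OF p, of i] insert.prems by simp
    then show ?case using insert S_mult S by simp
  qed
  then show "(\<Prod>i = 0..<m. A $$ (i, p i)) \<in> S" by blast
qed

text \<open>In the Leibniz formula the degrees \<open>l (p i) - l i\<close> along a permutation p
  sum to 0.\<close>

lemma det_homog:
  assumes A: "A \<in> carrier_mat m m" and R: "\<And>i j. i < m \<Longrightarrow> j < m \<Longrightarrow> A $$ (i, j) \<in> Rg (l j - l i)"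
  shows "Determinant.det A \<in> Rg 0"
  unfolding det_def'[OF A]
proof (intro Rg_sum)
  fix p assume "p \<in> {p. p permutes {0..<m}}"
  then have p: "p permutes {0..<m}" by simp
  have "(\<Prod>i\<in>I. A $$ (i, p i)) \<in> Rg (\<Sum>i\<in>I. l (p i) - l i)" if "I \<subseteq> {0..<m}" for I
    using finite_subset[OF that finite_atLeastLessThan] that
  proof (induction I rule: finite_induct)
    case empty then show ?case using one_Rg by simp
  next
    case (insert i I)
    have "p i < m" using permutes_in_image[OF p, of i] insert.prems by simp
    then show ?case using insert Rg_mult R by simp
  qed
  from this[OF order_refl] have "(\<Prod>i = 0..<m. A $$ (i, p i)) \<in> Rg (\<Sum>i = 0..<m. l (p i) - l i)" .
  moreover have "(\<Sum>i = 0..<m. l (p i) - l i) = 0"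
    using sum.permute[OF p, of l] by (simp add: sum_subtractf o_def)
  ultimately have prod: "(\<Prod>i = 0..<m. A $$ (i, p i)) \<in> Rg 0" by simp
  have "(signof p :: 'r) = 1 \<or> (signof p :: 'r) = - 1" by (simp add: sign_def)
  then show "signof p * (\<Prod>i = 0..<m. A $$ (i, p i)) \<in> Rg 0"
    using prod direct_grading_uminus[OF Rg prod] by auto
qed

lemma adj_mat_in_S:
  assumes A: "A \<in> carrier_mat m m" and S: "\<And>i j. i < m \<Longrightarrow> j < m \<Longrightarrow> A $$ (i, j) \<in> S"
    and ij: "i < m" "j < m"
  shows "adj_mat A $$ (i, j) \<in> S"
proof -
  have e: "adj_mat A $$ (i, j) = (-1) ^ (j + i) * Determinant.det (mat_delete A j i)"
    using A ij by (simp add: adj_mat_def cofactor_def)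
  have "Determinant.det (mat_delete A j i) \<in> S"
  proof (rule det_in_S)
    show "mat_delete A j i \<in> carrier_mat (m - 1) (m - 1)" using A by (simp add: mat_delete_def)
    fix p q assume "p < m - 1" "q < m - 1"
    then show "mat_delete A j i $$ (p, q) \<in> S" using A S by (auto simp: mat_delete_def)
  qed
  moreover have "((-1) ^ (j + i) :: 'r) \<in> S" using S_1 S_uminus by (cases "even (j + i)") auto
  ultimately show ?thesis unfolding e using S_mult by blast
qed

text \<open>Row vectors times matrices: row i of P is the image of the i-th unit vector, and
  applying P before Q corresponds to the matrix product of P and Q in this order. This fixes the
  order of the factors in all later matrix equations.\<close>

definition vec_mat :: "nat \<Rightarrow> (nat \<Rightarrow> nat \<Rightarrow> 'r) \<Rightarrow> (nat \<Rightarrow> 'r) \<Rightarrow> nat \<Rightarrow> 'r" where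
  "vec_mat m P v = (\<lambda>h. if h < m then \<Sum>i<m. v i * P i h else 0)"

lemma vec_mat_add: "vec_mat m P (v + w) = vec_mat m P v + vec_mat m P w"
  by (auto simp: vec_mat_def sum.distrib algebra_simps)

lemma add_vec_mat: "vec_mat m (\<lambda>i h. P i h + Q i h) v = vec_mat m P v + vec_mat m Q v"
  by (auto simp: vec_mat_def sum.distrib algebra_simps)

lemma vec_mat_cong: "(\<And>i h. i < m \<Longrightarrow> h < m \<Longrightarrow> P i h = Q i h) \<Longrightarrow> vec_mat m P v = vec_mat m Q v"
  unfolding vec_mat_def by (intro ext if_cong sum.cong) auto

lemma vec_mat_vec_mat: "vec_mat m Q (vec_mat m P v) = vec_mat m (\<lambda>i h. \<Sum>j<m. P i j * Q j h) v"
proof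
  fix h
  have "(\<Sum>j<m. (\<Sum>i<m. v i * P i j) * Q j h) = (\<Sum>j<m. \<Sum>i<m. v i * P i j * Q j h)"
    by (simp add: sum_distrib_right)
  also have "\<dots> = (\<Sum>i<m. v i * (\<Sum>j<m. P i j * Q j h))"
    by (subst sum.swap) (simp add: sum_distrib_left mult.assoc)
  finally show "vec_mat m Q (vec_mat m P v) h = vec_mat m (\<lambda>i h. \<Sum>j<m. P i j * Q j h) v h"
    by (simp add: vec_mat_def)
qed

lemma vec_mat_one:
  "v \<in> free_carrier m \<Longrightarrow> vec_mat m (\<lambda>i h. if i = h then s else 0) v = (\<lambda>i. s * v i)"
  by (auto simp: vec_mat_def free_carrier_def if_distrib[of "\<lambda>x. _ * x"] mult.commute cong: if_cong)

lemma vec_mat_unit: "i < m \<Longrightarrow> h < m \<Longrightarrow> vec_mat m P (unit_vec i) h = P i h"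
  by (simp add: vec_mat_def unit_vec_def if_distrib[of "\<lambda>x. x * _"] cong: if_cong)

lemma vec_mat_in:
  "(\<And>i h. i < m \<Longrightarrow> h < m \<Longrightarrow> P i h \<in> S) \<Longrightarrow> v \<in> free_carrier m \<Longrightarrow> vec_mat m P v \<in> free_carrier m"
  by (auto simp: vec_mat_def free_carrier_def intro!: S_sum S_mult)

text \<open>The i-th unit vector has degree \<open>- l i\<close>, so the entry (i, h) of a map of
  degree p has degree \<open>p - l i + l h\<close>.\<close>

lemma vec_mat_homog:
  assumes P: "\<And>i h. i < m \<Longrightarrow> h < m \<Longrightarrow> P i h \<in> S" "\<And>i h. i < m \<Longrightarrow> h < m \<Longrightarrow> P i h \<in> Rg (p - l i + l h)"
    and v: "v \<in> free_grading m l q"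
  shows "vec_mat m P v \<in> free_grading m l (p + q)"
proof -
  have "vec_mat m P v \<in> free_carrier m" using vec_mat_in[OF P(1)] v by (simp add: free_grading_def)
  moreover have "(\<Sum>i<m. v i * P i h) \<in> Rg (p + q + l h)" if "h < m" for h
    using v P(2) that by (intro Rg_sum Rg_mult'[of _ "q + l _" _ "p - l _ + l h"]) (auto simp: free_grading_def)
  ultimately show ?thesis by (simp add: free_grading_def vec_mat_def)
qed

end

section \<open>A graded basis of R over S\<close>

text \<open>Cohen-Macaulayness of R as a graded S-basis b, where \<open>b a\<close> has degree
  \<open>d a\<close>. The shifts are \<open>- d a\<close>, by the sign convention of
  \<open>homog_basis\<close>.\<close>

locale graded_cm = graded_setup \<iota> Rg S
  for \<iota> :: "'k::field \<Rightarrow> 'r::comm_ring_1" and Rg S +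
  fixes n :: nat and b :: "nat \<Rightarrow> 'r" and d :: "nat \<Rightarrow> int"
  assumes R_basis: "homog_basis S UNIV (*) Rg {..<n} b (\<lambda>a. - d a)"
begin

definition R_coeff :: "'r \<Rightarrow> nat \<Rightarrow> 'r" where
  "R_coeff r = (SOME f. (\<forall>a\<in>{..<n}. f a \<in> S) \<and> r = (\<Sum>a<n. f a * b a))"

lemma R_coeff: "\<forall>a\<in>{..<n}. R_coeff r a \<in> S" "r = (\<Sum>a<n. R_coeff r a * b a)"
  using someI_ex[OF homog_basisD(3)[OF R_basis UNIV_I, of r]] unfolding R_coeff_def by blast+

lemma R_coeff_in: "a < n \<Longrightarrow> R_coeff r a \<in> S" using R_coeff(1) by blast

lemma R_coeff_eq:
  assumes "\<And>a. a < n \<Longrightarrow> f a \<in> S" "r = (\<Sum>a<n. f a * b a)" "a < n"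
  shows "R_coeff r a = f a"
  by (rule basis_unique[OF R_gmodule R_basis]) (use assms R_coeff in auto)

lemma R_coeff_add: "a < n \<Longrightarrow> R_coeff (r + s) a = R_coeff r a + R_coeff s a"
proof (rule R_coeff_eq)
  show "r + s = (\<Sum>a<n. (R_coeff r a + R_coeff s a) * b a)"
    using R_coeff(2)[of r] R_coeff(2)[of s] by (simp add: distrib_right sum.distrib)
qed (auto intro: S_add R_coeff_in)

lemma R_coeff_smult: "s \<in> S \<Longrightarrow> a < n \<Longrightarrow> R_coeff (s * r) a = s * R_coeff r a"
proof (rule R_coeff_eq)
  show "s * r = (\<Sum>a<n. s * R_coeff r a * b a)"
    using R_coeff(2)[of r] by (simp add: sum_distrib_left[symmetric] mult.assoc)
qed (auto intro: S_mult R_coeff_in)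

lemma R_coeff_homog: "r \<in> Rg p \<Longrightarrow> a < n \<Longrightarrow> R_coeff r a \<in> Rg (p - d a)"
  using basis_coeff_homog[OF R_gmodule R_basis, of "R_coeff r" r p a] R_coeff[of r] by simp

lemma R_coeff_basis: "a < n \<Longrightarrow> e < n \<Longrightarrow> R_coeff (b a) e = (if e = a then 1 else 0)"
  by (rule R_coeff_eq) (auto simp: S_0 S_1 if_distrib[of "\<lambda>x. x * _"] cong: if_cong)

lemma b_homog: "a < n \<Longrightarrow> b a \<in> Rg (d a)" using homog_basisD(2)[OF R_basis, of a] by simp

end

section \<open>Parametrizing the module structures\<close>

locale free_parameters = graded_cm \<iota> Rg S n b d
  for \<iota> :: "'k::field \<Rightarrow> 'r::comm_ring_1" and Rg S n b d +
  fixes m :: nat and l :: "nat \<Rightarrow> int"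
begin

text \<open>One variable for each coordinate of the entry (i, j) of the matrix of
  \<open>b a\<close>. The image of the i-th unit vector under \<open>b a\<close> has degree
  \<open>d a - l i\<close>, so its j-th entry lies in degree \<open>d a - l i + l j\<close> of
  S.\<close>

definition par_index :: "(nat \<times> nat \<times> nat \<times> 'r) set" where
  "par_index = (SIGMA a:{..<n}. SIGMA i:{..<m}. SIGMA j:{..<m}. homog_base (d a - l i + l j))"

definition gen_mat :: "(nat \<times> nat \<times> nat \<times> 'r \<Rightarrow> 'k) \<Rightarrow> nat \<Rightarrow> nat \<Rightarrow> nat \<Rightarrow> 'r" where
  "gen_mat c a i j = (\<Sum>u\<in>homog_base (d a - l i + l j). \<iota> (c (a, i, j, u)) * u)"

definition act_mat :: "(nat \<times> nat \<times> nat \<times> 'r \<Rightarrow> 'k) \<Rightarrow> 'r \<Rightarrow> nat \<Rightarrow> nat \<Rightarrow> 'r" where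
  "act_mat c r i h = (\<Sum>a<n. R_coeff r a * gen_mat c a i h)"

definition par_act :: "(nat \<times> nat \<times> nat \<times> 'r \<Rightarrow> 'k) \<Rightarrow> 'r \<Rightarrow> (nat \<Rightarrow> 'r) \<Rightarrow> nat \<Rightarrow> 'r" where
  "par_act c r = vec_mat m (act_mat c r)"

text \<open>The matrix of \<open>b e\<close> stands first because vectors are rows and
  \<open>b e\<close> acts first. Both sides extend S-bilinearly to pairs of ring elements, so
  products of basis elements are enough to express associativity of the action.\<close>

definition mult_defect :: "(nat \<times> nat \<times> nat \<times> 'r \<Rightarrow> 'k) \<Rightarrow> nat \<Rightarrow> nat \<Rightarrow> nat \<Rightarrow> nat \<Rightarrow> 'r" where
  "mult_defect c a e i h = (\<Sum>j<m. gen_mat c e i j * gen_mat c a j h) - act_mat c (b a * b e) i h"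

definition unit_defect :: "(nat \<times> nat \<times> nat \<times> 'r \<Rightarrow> 'k) \<Rightarrow> nat \<Rightarrow> nat \<Rightarrow> 'r" where
  "unit_defect c i h = act_mat c 1 i h - (if i = h then 1 else 0)"

definition structure_eqs :: "((nat \<times> nat \<times> nat \<times> 'r \<Rightarrow> 'k) \<Rightarrow> 'k) set" where
  "structure_eqs =
     {\<lambda>c. homog_coord (d a + d e - l i + l h) u (mult_defect c a e i h) | a e i h u. a < n \<and> e < n \<and> i < m \<and> h < m} \<union>
     {\<lambda>c. homog_coord (l h - l i) u (unit_defect c i h) | i h u. i < m \<and> h < m}"

definition is_structure :: "(nat \<times> nat \<times> nat \<times> 'r \<Rightarrow> 'k) \<Rightarrow> bool" where
  "is_structure c \<longleftrightarrow> (\<forall>a<n. \<forall>e<n. \<forall>i<m. \<forall>h<m. mult_defect c a e i h = 0) \<and>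
     (\<forall>i<m. \<forall>h<m. unit_defect c i h = 0)"

lemma par_index_countable: "countable par_index"
  unfolding par_index_def using homog_base_fin by (intro countable_finite finite_SigmaI) auto

lemma gen_mat_in: "gen_mat c a i j \<in> S" "gen_mat c a i j \<in> Rg (d a - l i + l j)"
  unfolding gen_mat_def by (rule homog_comb_in)+

lemma act_mat_in: "act_mat c r i h \<in> S"
  unfolding act_mat_def using gen_mat_in(1) R_coeff_in by (intro S_sum S_mult) auto

lemma act_mat_homog: "r \<in> Rg p \<Longrightarrow> act_mat c r i h \<in> Rg (p - l i + l h)"
  unfolding act_mat_def using gen_mat_in(2) R_coeff_homog
  by (intro Rg_sum Rg_mult'[of _ "p - d _" _ "d _ - l i + l h"]) auto

lemma act_mat_add: "act_mat c (r + s) i h = act_mat c r i h + act_mat c s i h"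
  unfolding act_mat_def sum.distrib[symmetric] by (intro sum.cong) (auto simp: R_coeff_add distrib_right)

lemma act_mat_smult: "s \<in> S \<Longrightarrow> act_mat c (s * r) i h = s * act_mat c r i h"
  unfolding act_mat_def sum_distrib_left by (intro sum.cong) (auto simp: R_coeff_smult mult.assoc)

lemma act_mat_sum: "finite I \<Longrightarrow> act_mat c (sum f I) i h = (\<Sum>x\<in>I. act_mat c (f x) i h)"
proof (induction I rule: finite_induct)
  case empty
  show ?case using act_mat_smult[OF S_0, of c 0 i h] by simp
qed (simp add: act_mat_add)

lemma act_mat_basis: "a < n \<Longrightarrow> act_mat c (b a) i h = gen_mat c a i h"
proof -
  assume a: "a < n"
  have "act_mat c (b a) i h = (\<Sum>e<n. if e = a then gen_mat c e i h else 0)"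
    unfolding act_mat_def using a by (intro sum.cong) (auto simp: R_coeff_basis)
  then show ?thesis using a by simp
qed

lemma gen_mat_rpolyfun:
  assumes "a < n" "i < m" "j < m"
  shows "(\<lambda>c. gen_mat c a i j) \<in> rpolyfun par_index"
  unfolding gen_mat_def using assms
  by (intro rpolyfun_sum rpolyfun_base polyfun_coord) (auto simp: par_index_def)

lemma act_mat_rpolyfun:
  assumes "i < m" "h < m"
  shows "(\<lambda>c. act_mat c r i h) \<in> rpolyfun par_index"
  unfolding act_mat_def using assms by (intro rpolyfun_sum rpolyfun_mult rpolyfun_const gen_mat_rpolyfun) auto

lemma structure_eqs_polyfun: "structure_eqs \<subseteq> polyfun par_index"
proof -
  have "(\<lambda>c. mult_defect c a e i h) \<in> rpolyfun par_index" if "a < n" "e < n" "i < m" "h < m" for a e i h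
    unfolding mult_defect_def using that
    by (intro rpolyfun_diff rpolyfun_sum rpolyfun_mult gen_mat_rpolyfun act_mat_rpolyfun) auto
  moreover have "(\<lambda>c. unit_defect c i h) \<in> rpolyfun par_index" if "i < m" "h < m" for i h
    unfolding unit_defect_def using that by (intro rpolyfun_diff rpolyfun_const act_mat_rpolyfun) auto
  ultimately show ?thesis
    unfolding structure_eqs_def by (auto intro!: rpolyfun_linear homog_coord_linear)
qed

text \<open>Both defects are homogeneous elements of S of exactly the degree in which coordinates
  are taken, so they vanish once all coordinates do.\<close>

lemma structure_eqs_iff: "(\<forall>f\<in>structure_eqs. f c = 0) \<longleftrightarrow> is_structure c"
proof
  assume "is_structure c"
  then show "\<forall>f\<in>structure_eqs. f c = 0"
    unfolding structure_eqs_def is_structure_def by (auto simp: linear_formD(3)[OF homog_coord_linear])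
next
  assume eqs: "\<forall>f\<in>structure_eqs. f c = 0"
  have "mult_defect c a e i h = 0" if ae: "a < n" "e < n" "i < m" "h < m" for a e i h
  proof (rule homog_coord_zero)
    show "mult_defect c a e i h \<in> S"
      unfolding mult_defect_def by (intro S_diff S_sum S_mult gen_mat_in act_mat_in)
    have "b a * b e \<in> Rg (d a + d e)" using Rg_mult b_homog ae by simp
    then show "mult_defect c a e i h \<in> Rg (d a + d e - l i + l h)"
      unfolding mult_defect_def
      by (intro Rg_diff Rg_sum act_mat_homog Rg_mult'[OF gen_mat_in(2) gen_mat_in(2)]) auto
    fix u
    have "(\<lambda>c. homog_coord (d a + d e - l i + l h) u (mult_defect c a e i h)) \<in> structure_eqs"
      unfolding structure_eqs_def using ae by blast
    from bspec[OF eqs this] show "homog_coord (d a + d e - l i + l h) u (mult_defect c a e i h) = 0" .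
  qed
  moreover have "unit_defect c i h = 0" if ih: "i < m" "h < m" for i h
  proof (rule homog_coord_zero)
    show "unit_defect c i h \<in> S"
      unfolding unit_defect_def by (intro S_diff act_mat_in) (auto simp: S_0 S_1)
    have "(if i = h then 1 else 0) \<in> Rg (l h - l i)" by (auto simp: one_Rg Rg_zero)
    moreover have "act_mat c 1 i h \<in> Rg (l h - l i)" using act_mat_homog[OF one_Rg, of c i h] by simp
    ultimately show "unit_defect c i h \<in> Rg (l h - l i)" unfolding unit_defect_def by (intro Rg_diff)
    fix u
    have "(\<lambda>c. homog_coord (l h - l i) u (unit_defect c i h)) \<in> structure_eqs"
      unfolding structure_eqs_def using ih by blast
    from bspec[OF eqs this] show "homog_coord (l h - l i) u (unit_defect c i h) = 0" .
  qed
  ultimately show "is_structure c" by (simp add: is_structure_def)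
qed

lemma act_mat_one: "is_structure c \<Longrightarrow> i < m \<Longrightarrow> h < m \<Longrightarrow> act_mat c 1 i h = (if i = h then 1 else 0)"
  unfolding is_structure_def unit_defect_def by simp

text \<open>Both ring elements are expanded in the basis b; S-linearity of \<open>act_mat\<close>
  reduces the identity to the equations for the products \<open>b a * b e\<close>.\<close>

lemma act_mat_mult:
  assumes c: "is_structure c" and ih: "i < m" "h < m"
  shows "act_mat c (r * s) i h = (\<Sum>j<m. act_mat c s i j * act_mat c r j h)"
proof -
  have "r * s = (\<Sum>a<n. R_coeff r a * b a) * (\<Sum>e<n. R_coeff s e * b e)"
    using R_coeff(2)[of r] R_coeff(2)[of s] by simp
  also have "\<dots> = (\<Sum>a<n. \<Sum>e<n. (R_coeff r a * R_coeff s e) * (b a * b e))"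
    unfolding sum_product by (intro sum.cong) (auto simp: mult_ac)
  finally have "act_mat c (r * s) i h =
      act_mat c (\<Sum>a<n. \<Sum>e<n. (R_coeff r a * R_coeff s e) * (b a * b e)) i h" by simp
  also have "\<dots> = (\<Sum>a<n. \<Sum>e<n. R_coeff r a * R_coeff s e * act_mat c (b a * b e) i h)"
    unfolding act_mat_sum[OF finite_lessThan]
    by (intro sum.cong refl act_mat_smult S_mult R_coeff_in) auto
  also have "\<dots> = (\<Sum>a<n. \<Sum>e<n. \<Sum>j<m. (R_coeff s e * gen_mat c e i j) * (R_coeff r a * gen_mat c a j h))"
  proof (intro sum.cong refl)
    fix a e assume "a \<in> {..<n}" "e \<in> {..<n}"
    then have "act_mat c (b a * b e) i h = (\<Sum>j<m. gen_mat c e i j * gen_mat c a j h)"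
      using c ih unfolding is_structure_def mult_defect_def by simp
    then show "R_coeff r a * R_coeff s e * act_mat c (b a * b e) i h =
        (\<Sum>j<m. (R_coeff s e * gen_mat c e i j) * (R_coeff r a * gen_mat c a j h))"
      by (simp add: sum_distrib_left mult_ac)
  qed
  also have "\<dots> = (\<Sum>j<m. \<Sum>a<n. \<Sum>e<n. (R_coeff s e * gen_mat c e i j) * (R_coeff r a * gen_mat c a j h))"
    by (subst sum.swap[of _ "{..<m}"], subst sum.swap[of _ "{..<m}"]) simp
  also have "\<dots> = (\<Sum>j<m. act_mat c s i j * act_mat c r j h)"
    unfolding act_mat_def sum_product by (subst sum.swap) simp
  finally show ?thesis .
qed

text \<open>The unit equation and S-linearity make the matrix of s in S equal to s times the
  identity, so the action extends the given one of S; the product equation gives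
  associativity.\<close>

lemma par_act_structure:
  assumes c: "is_structure c"
  shows "free_structure m l (par_act c)"
proof -
  have S_act: "par_act c s v = (\<lambda>i. s * v i)" if "s \<in> S" "v \<in> free_carrier m" for s v
  proof -
    have "act_mat c s i h = (if i = h then s else 0)" if "i < m" "h < m" for i h
      using act_mat_smult[OF \<open>s \<in> S\<close>, of c 1 i h] act_mat_one[OF c that] by simp
    then have "par_act c s v = vec_mat m (\<lambda>i h. if i = h then s else 0) v"
      unfolding par_act_def by (intro vec_mat_cong) simp
    then show ?thesis using vec_mat_one[OF that(2)] by simp
  qed
  have "typed_gmodule Rg (free_carrier m) (par_act c) (free_grading m l)"
  proof unfold_locales
    show "direct_grading (free_carrier m) (free_grading m l)" by (rule free_grading_direct)
    show "x - y \<in> free_carrier m" if "x \<in> free_carrier m" "y \<in> free_carrier m" for x y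
      using that by (auto simp: free_carrier_def intro: S_diff)
    show "par_act c r x \<in> free_carrier m" if "x \<in> free_carrier m" for r x
      unfolding par_act_def using act_mat_in that by (intro vec_mat_in)
    show "par_act c r (x + y) = par_act c r x + par_act c r y" for r x y
      unfolding par_act_def by (rule vec_mat_add)
    show "par_act c (r + s) x = par_act c r x + par_act c s x" for r s x
      unfolding par_act_def act_mat_add add_vec_mat[symmetric] ..
    show "par_act c (r * s) x = par_act c r (par_act c s x)" for r s x
      unfolding par_act_def vec_mat_vec_mat using act_mat_mult[OF c] by (intro vec_mat_cong)
    show "par_act c 1 x = x" if "x \<in> free_carrier m" for x using S_act[OF S_1 that] by simp
    show "par_act c r x \<in> free_grading m l (i + j)" if "r \<in> Rg i" "x \<in> free_grading m l j" for r i x j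
      unfolding par_act_def using that act_mat_in act_mat_homog by (intro vec_mat_homog)
  qed
  then show ?thesis using S_act by (simp add: free_structure_def)
qed

lemma S_linear_vec_mat:
  assumes F: "\<And>v w. v \<in> free_carrier m \<Longrightarrow> w \<in> free_carrier m \<Longrightarrow> F (v + w) = F v + F w"
    "\<And>s v. s \<in> S \<Longrightarrow> v \<in> free_carrier m \<Longrightarrow> F (\<lambda>i. s * v i) = (\<lambda>i. s * F v i)"
    "\<And>v. v \<in> free_carrier m \<Longrightarrow> F v \<in> free_carrier m" and v: "v \<in> free_carrier m"
  shows "F v = vec_mat m (\<lambda>i. F (unit_vec i)) v"
proof -
  have in1: "(\<lambda>j. v i * unit_vec i j) \<in> free_carrier m" if "i < m" for i
    using unit_vec_in(1)[OF that] v that by (auto simp: free_carrier_def S_mult)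
  have "v = (\<Sum>i<m. (\<lambda>j. v i * unit_vec i j))"
    using v by (intro ext) (simp add: sum_fun_apply sum_unit_vec free_carrier_def)
  then have "F v = F (\<Sum>i<m. (\<lambda>j. v i * unit_vec i j))" by simp
  also have "\<dots> = (\<Sum>i<m. F (\<lambda>j. v i * unit_vec i j))"
  proof (rule conjunct1[OF additive_sum[of "free_carrier m" F "{..<m}" "\<lambda>i j. v i * unit_vec i j"]])
    show "0 \<in> free_carrier m" by (simp add: free_carrier_def S_0)
    show "x + y \<in> free_carrier m" if "x \<in> free_carrier m" "y \<in> free_carrier m" for x y
      using that by (auto simp: free_carrier_def S_add)
  qed (use F(1) in1 in auto)
  also have "\<dots> = (\<Sum>i<m. (\<lambda>h. v i * F (unit_vec i) h))"
    using v unit_vec_in(1) by (intro sum.cong F(2)) (auto simp: free_carrier_def)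
  also have "\<dots> = vec_mat m (\<lambda>i. F (unit_vec i)) v"
  proof
    fix h
    have "F (unit_vec i) h = 0" if "i < m" "\<not> h < m" for i
      using F(3)[OF unit_vec_in(1)[OF that(1)]] that(2) by (simp add: free_carrier_def)
    then show "(\<Sum>i<m. (\<lambda>h. v i * F (unit_vec i) h)) h = vec_mat m (\<lambda>i. F (unit_vec i)) v h"
      by (auto simp: sum_fun_apply vec_mat_def)
  qed
  finally show ?thesis .
qed

text \<open>The parameters are read off from the images of the unit vectors under the basis elements
  \<open>b a\<close>; S-linearity propagates the agreement to all ring elements and all
  vectors.\<close>

lemma structure_par:
  assumes act: "free_structure m l act"
  shows "\<exists>c. is_structure c \<and> (\<forall>r. \<forall>v\<in>free_carrier m. act r v = par_act c r v)"
proof -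
  interpret M: typed_gmodule Rg "free_carrier m" act "free_grading m l"
    using act by (simp add: free_structure_def)
  have S_act: "act s v = (\<lambda>i. s * v i)" if "s \<in> S" "v \<in> free_carrier m" for s v
    using act that by (simp add: free_structure_def)
  define Q where "Q a i j = act (b a) (unit_vec i) j" for a i j
  have Qin: "Q a i j \<in> S \<and> Q a i j \<in> Rg (d a - l i + l j)" if "a < n" "i < m" "j < m" for a i j
  proof -
    have "act (b a) (unit_vec i) \<in> free_grading m l (d a + - l i)"
      by (rule M.act_homog[OF b_homog[OF that(1)] unit_vec_in(2)[OF that(2)]])
    then show ?thesis using that(3) unfolding Q_def free_grading_def free_carrier_def by auto
  qed
  define c where "c = (\<lambda>(a, i, j, u). homog_coord (d a - l i + l j) u (Q a i j))"
  have gen: "gen_mat c a i j = Q a i j" if "a < n" "i < m" "j < m" for a i j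
    unfolding gen_mat_def c_def using homog_coord_sum Qin[OF that] by simp
  have mat: "act r (unit_vec i) h = act_mat c r i h" if ih: "i < m" "h < m" for r i h
  proof -
    note u = unit_vec_in(1)[OF ih(1)]
    have "act r (unit_vec i) = act (\<Sum>a<n. R_coeff r a * b a) (unit_vec i)" using R_coeff(2)[of r] by simp
    also have "\<dots> = (\<Sum>a<n. act (R_coeff r a) (act (b a) (unit_vec i)))"
      using u by (simp add: M.sum_act M.act_act)
    also have "\<dots> = (\<Sum>a<n. (\<lambda>h. R_coeff r a * act (b a) (unit_vec i) h))"
      using u by (intro sum.cong S_act R_coeff_in M.act_closed) auto
    finally have "act r (unit_vec i) h = (\<Sum>a<n. R_coeff r a * Q a i h)" by (simp add: sum_fun_apply Q_def)
    then show ?thesis unfolding act_mat_def using gen ih by simp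
  qed
  have act_eq: "act r v = par_act c r v" if v: "v \<in> free_carrier m" for r v
  proof -
    have "act r v = vec_mat m (\<lambda>i. act r (unit_vec i)) v"
    proof (rule S_linear_vec_mat[OF _ _ _ v])
      fix s w assume sw: "s \<in> S" "w \<in> free_carrier m"
      \<comment> \<open>The action of r is S-linear because R is commutative, and is therefore given
        by a matrix.\<close>
      have "act r (act s w) = act s (act r w)"
        using M.act_act[OF sw(2), of r s] M.act_act[OF sw(2), of s r] by (simp add: mult.commute)
      then show "act r (\<lambda>i. s * w i) = (\<lambda>i. s * act r w i)"
        using S_act[OF sw] S_act[OF sw(1) M.act_closed[OF sw(2)]] by simp
    next
      fix v w assume "v \<in> free_carrier m" "w \<in> free_carrier m"
      then show "act r (v + w) = act r v + act r w" by (rule M.act_add)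
    next
      fix v assume "v \<in> free_carrier m"
      then show "act r v \<in> free_carrier m" by (rule M.act_closed)
    qed
    also have "\<dots> = par_act c r v" unfolding par_act_def using mat by (intro vec_mat_cong)
    finally show ?thesis .
  qed
  have "is_structure c"
    unfolding is_structure_def mult_defect_def unit_defect_def
  proof (intro conjI allI impI)
    fix a e i h assume ae: "a < n" "e < n" "i < m" "h < m"
    have "act_mat c (b a * b e) i h = act (b a) (act (b e) (unit_vec i)) h"
      using mat[OF ae(3,4), of "b a * b e"] M.act_act[OF unit_vec_in(1)[OF ae(3)]] by simp
    also have "\<dots> = par_act c (b a) (par_act c (b e) (unit_vec i)) h"
      using act_eq M.act_closed unit_vec_in(1)[OF ae(3)] by metis
    also have "\<dots> = (\<Sum>j<m. act_mat c (b e) i j * act_mat c (b a) j h)"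
      unfolding par_act_def vec_mat_vec_mat by (rule vec_mat_unit[OF ae(3,4)])
    finally show "(\<Sum>j<m. gen_mat c e i j * gen_mat c a j h) - act_mat c (b a * b e) i h = 0"
      using act_mat_basis ae by simp
  next
    fix i h assume ih: "i < m" "h < m"
    show "act_mat c 1 i h - (if i = h then 1 else 0) = 0"
      using mat[OF ih, of 1] M.act_one[OF unit_vec_in(1)[OF ih(1)]] by (auto simp: unit_vec_def)
  qed
  then show ?thesis using act_eq by blast
qed

end

section \<open>Isomorphisms between parametrized structures\<close>

context free_parameters
begin

text \<open>Unknowns of a degree 0 endomorphism: the entry (i, j) of its matrix has degree
  \<open>l j - l i\<close>.\<close>

definition hom_index :: "(nat \<times> nat \<times> 'r) set" where
  "hom_index = (SIGMA i:{..<m}. SIGMA j:{..<m}. homog_base (l j - l i))"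

definition hom_mat :: "(nat \<times> nat \<times> 'r \<Rightarrow> 'k) \<Rightarrow> nat \<Rightarrow> nat \<Rightarrow> 'r" where
  "hom_mat \<phi> i j = (\<Sum>u\<in>homog_base (l j - l i). \<iota> (\<phi> (i, j, u)) * u)"

definition hom_det :: "(nat \<times> nat \<times> 'r \<Rightarrow> 'k) \<Rightarrow> 'r" where
  "hom_det \<phi> = Determinant.det (mat m m (\<lambda>(i, j). hom_mat \<phi> i j))"

text \<open>In the row convention its vanishing says that \<phi> carries the action of
  \<open>b a\<close> in the structure y to that in z. The elements \<open>b a\<close> suffice
  because \<open>act_mat\<close> is S-linear in the ring element.\<close>

definition hom_defect where
  "hom_defect \<phi> y z a i h = (\<Sum>j<m. gen_mat y a i j * hom_mat \<phi> j h) - (\<Sum>j<m. hom_mat \<phi> i j * gen_mat z a j h)"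

text \<open>The system is linear in \<phi>, so the coefficient of the unknown \<kappa> is the defect
  of the unit vector at \<kappa>. The structure z is fixed and y is the parameter, on which the
  coefficients depend polynomially.\<close>

definition hom_rows where
  "hom_rows z = {\<lambda>\<kappa> y. homog_coord (d a - l i + l h) w (hom_defect (\<lambda>x. if x = \<kappa> then 1 else 0) y z a i h) |
     a i h w. a < n \<and> i < m \<and> h < m \<and> w \<in> homog_base (d a - l i + l h)}"

text \<open>A k-linear form on R that does not vanish at 1. On \<open>R_0 = k\<close> it vanishes
  only at 0, so it replaces the determinant, an element of R, by an element of k that is zero in the
  same cases.\<close>

definition unit_form :: "'r \<Rightarrow> 'k" where
  "unit_form = homog_coord 0 (SOME u. homog_coord 0 u 1 \<noteq> 0)"

lemma unit_form: "linear_form unit_form" "unit_form 1 \<noteq> 0"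
proof -
  have "\<exists>u. homog_coord 0 u 1 \<noteq> 0" using homog_coord_zero[OF S_1 one_Rg] by auto
  then show "unit_form 1 \<noteq> 0" unfolding unit_form_def by (rule someI_ex)
qed (simp add: unit_form_def homog_coord_linear)

lemma hom_index_finite: "finite hom_index"
  unfolding hom_index_def using homog_base_fin by (intro finite_SigmaI) auto

lemma hom_mat_in: "hom_mat \<phi> i j \<in> S" "hom_mat \<phi> i j \<in> Rg (l j - l i)"
  unfolding hom_mat_def by (rule homog_comb_in)+

lemma hom_det_unit: "\<exists>t. hom_det \<phi> = \<iota> t"
proof -
  have "hom_det \<phi> \<in> Rg 0" unfolding hom_det_def by (rule det_homog[of _ m l]) (auto simp: hom_mat_in)
  then show ?thesis using Rg_0 by auto
qed

lemma unit_form_hom_det: "unit_form (hom_det \<phi>) \<noteq> 0 \<longleftrightarrow> hom_det \<phi> \<noteq> 0"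
proof -
  obtain t where t: "hom_det \<phi> = \<iota> t" using hom_det_unit by blast
  have "unit_form (\<iota> t) = t * unit_form 1" using linear_formD(2)[OF unit_form(1), of t 1] by simp
  then show ?thesis using t unit_form(2) iota_eq_0 by simp
qed

lemma hom_mat_linear:
  assumes "i < m" "j < m"
  shows "hom_mat \<phi> i j = (\<Sum>\<kappa>\<in>hom_index. \<iota> (\<phi> \<kappa>) * hom_mat (\<lambda>x. if x = \<kappa> then 1 else 0) i j)"
proof -
  have "(\<Sum>\<kappa>\<in>hom_index. \<iota> (\<phi> \<kappa>) * hom_mat (\<lambda>x. if x = \<kappa> then 1 else 0) i j) =
      (\<Sum>\<kappa>\<in>hom_index. \<Sum>u\<in>homog_base (l j - l i). if (i, j, u) = \<kappa> then \<iota> (\<phi> (i, j, u)) * u else 0)"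
    unfolding hom_mat_def sum_distrib_left by (intro sum.cong) (auto simp: iota_one iota_zero)
  also have "\<dots> = (\<Sum>u\<in>homog_base (l j - l i). \<Sum>\<kappa>\<in>hom_index. if (i, j, u) = \<kappa> then \<iota> (\<phi> (i, j, u)) * u else 0)"
    by (rule sum.swap)
  also have "\<dots> = (\<Sum>u\<in>homog_base (l j - l i). \<iota> (\<phi> (i, j, u)) * u)"
    using hom_index_finite assms by (intro sum.cong) (auto simp: hom_index_def)
  finally show ?thesis by (simp add: hom_mat_def)
qed

lemma hom_defect_linear:
  assumes "i < m" "h < m"
  shows "hom_defect \<phi> y z a i h = (\<Sum>\<kappa>\<in>hom_index. \<iota> (\<phi> \<kappa>) * hom_defect (\<lambda>x. if x = \<kappa> then 1 else 0) y z a i h)"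
proof -
  let ?P = "\<lambda>\<kappa>. hom_mat (\<lambda>x. if x = \<kappa> then 1 else 0)"
  have "(\<Sum>j<m. gen_mat y a i j * hom_mat \<phi> j h) = (\<Sum>j<m. \<Sum>\<kappa>\<in>hom_index. \<iota> (\<phi> \<kappa>) * (gen_mat y a i j * ?P \<kappa> j h))"
  proof (intro sum.cong refl)
    fix j assume j: "j \<in> {..<m}"
    show "gen_mat y a i j * hom_mat \<phi> j h = (\<Sum>\<kappa>\<in>hom_index. \<iota> (\<phi> \<kappa>) * (gen_mat y a i j * ?P \<kappa> j h))"
      using j assms by (subst hom_mat_linear) (auto simp: sum_distrib_left mult_ac)
  qed
  also have "\<dots> = (\<Sum>\<kappa>\<in>hom_index. \<iota> (\<phi> \<kappa>) * (\<Sum>j<m. gen_mat y a i j * ?P \<kappa> j h))"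
    by (subst sum.swap) (simp add: sum_distrib_left)
  finally have 1: "(\<Sum>j<m. gen_mat y a i j * hom_mat \<phi> j h) =
    (\<Sum>\<kappa>\<in>hom_index. \<iota> (\<phi> \<kappa>) * (\<Sum>j<m. gen_mat y a i j * ?P \<kappa> j h))" .
  have "(\<Sum>j<m. hom_mat \<phi> i j * gen_mat z a j h) = (\<Sum>j<m. \<Sum>\<kappa>\<in>hom_index. \<iota> (\<phi> \<kappa>) * (?P \<kappa> i j * gen_mat z a j h))"
  proof (intro sum.cong refl)
    fix j assume j: "j \<in> {..<m}"
    show "hom_mat \<phi> i j * gen_mat z a j h = (\<Sum>\<kappa>\<in>hom_index. \<iota> (\<phi> \<kappa>) * (?P \<kappa> i j * gen_mat z a j h))"
      using j assms by (subst hom_mat_linear) (auto simp: sum_distrib_left sum_distrib_right mult_ac)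
  qed
  also have "\<dots> = (\<Sum>\<kappa>\<in>hom_index. \<iota> (\<phi> \<kappa>) * (\<Sum>j<m. ?P \<kappa> i j * gen_mat z a j h))"
    by (subst sum.swap) (simp add: sum_distrib_left)
  finally show ?thesis using 1 unfolding hom_defect_def by (simp add: sum_subtractf right_diff_distrib)
qed

lemma hom_rows_finite: "finite (hom_rows z)"
proof -
  let ?I = "SIGMA a:{..<n}. SIGMA i:{..<m}. SIGMA h:{..<m}. homog_base (d a - l i + l h)"
  have "hom_rows z \<subseteq> (\<lambda>(a, i, h, w). \<lambda>\<kappa> y. homog_coord (d a - l i + l h) w
      (hom_defect (\<lambda>x. if x = \<kappa> then 1 else 0) y z a i h)) ` ?I"
  proof
    fix r assume "r \<in> hom_rows z"
    then obtain a i h w where r: "r = (\<lambda>\<kappa> y. homog_coord (d a - l i + l h) w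
        (hom_defect (\<lambda>x. if x = \<kappa> then 1 else 0) y z a i h))" "a < n" "i < m" "h < m"
      "w \<in> homog_base (d a - l i + l h)" unfolding hom_rows_def by blast
    show "r \<in> (\<lambda>(a, i, h, w). \<lambda>\<kappa> y. homog_coord (d a - l i + l h) w
      (hom_defect (\<lambda>x. if x = \<kappa> then 1 else 0) y z a i h)) ` ?I"
      by (rule image_eqI[of _ _ "(a, i, h, w)"]) (use r in auto)
  qed
  moreover have "finite ?I" using homog_base_fin by (intro finite_SigmaI) auto
  ultimately show ?thesis using finite_surj by blast
qed

lemma hom_rows_polyfun:
  assumes "r \<in> hom_rows z"
  shows "r \<kappa> \<in> polyfun par_index"
proof -
  obtain a i h w where r: "r = (\<lambda>\<kappa> y. homog_coord (d a - l i + l h) w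
      (hom_defect (\<lambda>x. if x = \<kappa> then 1 else 0) y z a i h))" "a < n" "i < m" "h < m"
    using assms unfolding hom_rows_def by blast
  show ?thesis unfolding r(1) hom_defect_def using r(2-)
    by (intro rpolyfun_linear homog_coord_linear rpolyfun_diff rpolyfun_sum rpolyfun_mult
        rpolyfun_const gen_mat_rpolyfun) auto
qed

text \<open>By linearity a row applied to \<phi> is a coordinate of the defect of \<phi>, and the
  defects are homogeneous elements of S whose coordinates detect vanishing.\<close>

lemma hom_rows_iff:
  "(\<forall>r\<in>hom_rows z. (\<Sum>\<kappa>\<in>hom_index. r \<kappa> y * \<phi> \<kappa>) = 0) \<longleftrightarrow>
   (\<forall>a<n. \<forall>i<m. \<forall>h<m. hom_defect \<phi> y z a i h = 0)"
proof -
  have sum: "(\<Sum>\<kappa>\<in>hom_index. homog_coord D w (hom_defect (\<lambda>x. if x = \<kappa> then 1 else 0) y z a i h) * \<phi> \<kappa>) =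
      homog_coord D w (hom_defect \<phi> y z a i h)" if "i < m" "h < m" for D w a i h
    unfolding hom_defect_linear[OF that, of \<phi>] linear_formD(5)[OF homog_coord_linear]
      linear_formD(2)[OF homog_coord_linear] by (simp add: mult.commute)
  show ?thesis
  proof
    assume rows: "\<forall>r\<in>hom_rows z. (\<Sum>\<kappa>\<in>hom_index. r \<kappa> y * \<phi> \<kappa>) = 0"
    show "\<forall>a<n. \<forall>i<m. \<forall>h<m. hom_defect \<phi> y z a i h = 0"
    proof (intro allI impI)
      fix a i h assume ih: "a < n" "i < m" "h < m"
      show "hom_defect \<phi> y z a i h = 0"
      proof (rule homog_coord_zero)
        show "hom_defect \<phi> y z a i h \<in> S"
          unfolding hom_defect_def by (intro S_diff S_sum S_mult gen_mat_in hom_mat_in)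
        show "hom_defect \<phi> y z a i h \<in> Rg (d a - l i + l h)"
          unfolding hom_defect_def
          by (intro Rg_diff Rg_sum Rg_mult'[OF gen_mat_in(2) hom_mat_in(2)] Rg_mult'[OF hom_mat_in(2) gen_mat_in(2)]) auto
        fix w assume w: "w \<in> homog_base (d a - l i + l h)"
        have "(\<lambda>\<kappa> y. homog_coord (d a - l i + l h) w (hom_defect (\<lambda>x. if x = \<kappa> then 1 else 0) y z a i h)) \<in> hom_rows z"
          unfolding hom_rows_def using ih w by blast
        from bspec[OF rows this] show "homog_coord (d a - l i + l h) w (hom_defect \<phi> y z a i h) = 0"
          unfolding sum[OF ih(2,3)] .
      qed
    qed
  next
    assume zero: "\<forall>a<n. \<forall>i<m. \<forall>h<m. hom_defect \<phi> y z a i h = 0"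
    show "\<forall>r\<in>hom_rows z. (\<Sum>\<kappa>\<in>hom_index. r \<kappa> y * \<phi> \<kappa>) = 0"
    proof
      fix r assume "r \<in> hom_rows z"
      then obtain a i h w where r: "r = (\<lambda>\<kappa> y. homog_coord (d a - l i + l h) w
          (hom_defect (\<lambda>x. if x = \<kappa> then 1 else 0) y z a i h))" "a < n" "i < m" "h < m"
        unfolding hom_rows_def by blast
      show "(\<Sum>\<kappa>\<in>hom_index. r \<kappa> y * \<phi> \<kappa>) = 0"
        unfolding r(1) sum[OF r(3,4)] using zero r(2-) by (simp add: linear_formD(3)[OF homog_coord_linear])
    qed
  qed
qed

abbreviation par_module :: "(nat \<times> nat \<times> nat \<times> 'r \<Rightarrow> 'k) \<Rightarrow> ('r, nat \<Rightarrow> 'r) gmodule" where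
  "par_module c \<equiv> mk_gmodule (free_carrier m) (par_act c) (free_grading m l)"

text \<open>The determinant is a nonzero element of \<open>R_0 = k\<close> and hence a unit, so the
  adjugate matrix gives an inverse over S. Compatibility with the elements \<open>b a\<close> yields
  R-linearity, and \<open>additive_bij_grading\<close> supplies the degrees of the inverse.\<close>

lemma par_iso_of_hom:
  assumes y: "is_structure y" and z: "is_structure z"
    and comm: "\<And>a i h. a < n \<Longrightarrow> i < m \<Longrightarrow> h < m \<Longrightarrow> hom_defect \<phi> y z a i h = 0" and det: "hom_det \<phi> \<noteq> 0"
  shows "graded_iso ring_of_type_algebra (par_module y) (par_module z)"
proof -
  interpret Y: typed_gmodule Rg "free_carrier m" "par_act y" "free_grading m l"
    using par_act_structure[OF y] by (simp add: free_structure_def)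
  let ?P = "hom_mat \<phi>"
  define A where "A = mat m m (\<lambda>(i, j). ?P i j)"
  have A: "A \<in> carrier_mat m m" by (simp add: A_def)
  have AP: "A $$ (i, j) = ?P i j" if "i < m" "j < m" for i j using that by (simp add: A_def)
  obtain t where t: "hom_det \<phi> = \<iota> t" using hom_det_unit by blast
  have detA: "Determinant.det A = \<iota> t" using t by (simp add: hom_det_def A_def)
  have t0: "t \<noteq> 0" using det t iota_zero by auto
  define Q where "Q i j = \<iota> (inverse t) * adj_mat A $$ (i, j)" for i j
  have adj: "adj_mat A \<in> carrier_mat m m" by (rule adj_mat(1)[OF A])
  have Q_in: "Q i j \<in> S" if "i < m" "j < m" for i j
    unfolding Q_def using that by (intro S_mult iota_S adj_mat_in_S[OF A]) (auto simp: AP hom_mat_in)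
  have PQ: "(\<Sum>j<m. ?P i j * Q j h) = (if i = h then 1 else 0)" if ih: "i < m" "h < m" for i h
  proof -
    have "(\<Sum>j<m. ?P i j * Q j h) = \<iota> (inverse t) * (\<Sum>j<m. A $$ (i, j) * adj_mat A $$ (j, h))"
      unfolding sum_distrib_left Q_def using ih by (intro sum.cong) (auto simp: AP mult_ac)
    also have "(\<Sum>j<m. A $$ (i, j) * adj_mat A $$ (j, h)) = (A * adj_mat A) $$ (i, h)"
      using A adj ih by (auto simp: scalar_prod_def atLeast0LessThan intro!: sum.cong)
    also have "\<dots> = (if i = h then \<iota> t else 0)" unfolding adj_mat(2)[OF A] detA using ih by simp
    finally show ?thesis using iota_inverse[OF t0] by simp
  qed
  have QP: "(\<Sum>j<m. Q i j * ?P j h) = (if i = h then 1 else 0)" if ih: "i < m" "h < m" for i h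
  proof -
    have "(\<Sum>j<m. Q i j * ?P j h) = \<iota> (inverse t) * (\<Sum>j<m. adj_mat A $$ (i, j) * A $$ (j, h))"
      unfolding sum_distrib_left Q_def using ih by (intro sum.cong) (auto simp: AP mult_ac)
    also have "(\<Sum>j<m. adj_mat A $$ (i, j) * A $$ (j, h)) = (adj_mat A * A) $$ (i, h)"
      using A adj ih by (auto simp: scalar_prod_def atLeast0LessThan intro!: sum.cong)
    also have "\<dots> = (if i = h then \<iota> t else 0)" unfolding adj_mat(3)[OF A] detA using ih by simp
    finally show ?thesis using iota_inverse[OF t0] by simp
  qed
  define F where "F = vec_mat m ?P"
  have F_in: "F v \<in> free_carrier m" if "v \<in> free_carrier m" for v
    unfolding F_def using hom_mat_in(1) that by (intro vec_mat_in)
  have inv1: "vec_mat m Q (F v) = v" if v: "v \<in> free_carrier m" for v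
  proof -
    have "vec_mat m Q (F v) = vec_mat m (\<lambda>i h. if i = h then 1 else 0) v"
      unfolding F_def vec_mat_vec_mat using PQ by (intro vec_mat_cong)
    then show ?thesis using vec_mat_one[OF v, of 1] by simp
  qed
  have inv2: "F (vec_mat m Q v) = v" if v: "v \<in> free_carrier m" for v
  proof -
    have "F (vec_mat m Q v) = vec_mat m (\<lambda>i h. if i = h then 1 else 0) v"
      unfolding F_def vec_mat_vec_mat using QP by (intro vec_mat_cong)
    then show ?thesis using vec_mat_one[OF v, of 1] by simp
  qed
  have bij: "bij_betw F (free_carrier m) (free_carrier m)"
    by (rule bij_betwI[where g = "vec_mat m Q"]) (use F_in vec_mat_in[OF Q_in] inv1 inv2 in auto)
  have hom: "F (par_act y r v) = par_act z r (F v)" for r v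
    unfolding F_def par_act_def vec_mat_vec_mat
  proof (rule vec_mat_cong)
    fix i h assume ih: "i < m" "h < m"
    have "(\<Sum>j<m. act_mat y r i j * ?P j h) = (\<Sum>j<m. \<Sum>a<n. R_coeff r a * (gen_mat y a i j * ?P j h))"
      unfolding act_mat_def by (simp add: sum_distrib_right mult.assoc)
    also have "\<dots> = (\<Sum>a<n. R_coeff r a * (\<Sum>j<m. gen_mat y a i j * ?P j h))"
      by (subst sum.swap) (simp add: sum_distrib_left)
    also have "\<dots> = (\<Sum>a<n. R_coeff r a * (\<Sum>j<m. ?P i j * gen_mat z a j h))"
      using comm ih unfolding hom_defect_def by (intro sum.cong) auto
    also have "\<dots> = (\<Sum>j<m. \<Sum>a<n. R_coeff r a * (?P i j * gen_mat z a j h))"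
      by (subst sum.swap) (simp add: sum_distrib_left)
    also have "\<dots> = (\<Sum>j<m. ?P i j * act_mat z r j h)"
      unfolding act_mat_def by (simp add: sum_distrib_left mult_ac)
    finally show "(\<Sum>j<m. act_mat y r i j * ?P j h) = (\<Sum>j<m. ?P i j * act_mat z r j h)" .
  qed
  have F_gr: "F v \<in> free_grading m l q" if "v \<in> free_grading m l q" for q v
  proof -
    have "?P i h \<in> Rg (0 - l i + l h)" for i h using hom_mat_in(2)[of \<phi> i h] by simp
    then have "F v \<in> free_grading m l (0 + q)" unfolding F_def by (intro vec_mat_homog hom_mat_in(1) that)
    then show ?thesis by simp
  qed
  have F_add: "F (v + w) = F v + F w" for v w unfolding F_def by (rule vec_mat_add)
  have "F ` free_grading m l q = free_grading m l q" for q
    by (rule additive_bij_grading[OF free_grading_direct free_grading_direct Y.add_closed F_add bij F_gr])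
  then show ?thesis
    unfolding graded_iso_def LinearCombinations.module_hom_def using bij F_in hom F_add
    by (intro bexI[of _ F]) auto
qed

text \<open>An R-isomorphism between these structures is S-linear, since both extend the same
  S-action, and so it is given by a matrix with entries in the expected degrees.\<close>

lemma hom_of_par_iso:
  assumes y: "is_structure y" and z: "is_structure z"
    and iso: "graded_iso ring_of_type_algebra (par_module y) (par_module z)"
  shows "\<exists>\<phi>. (\<forall>a<n. \<forall>i<m. \<forall>h<m. hom_defect \<phi> y z a i h = 0) \<and> hom_det \<phi> \<noteq> 0"
proof -
  interpret Y: typed_gmodule Rg "free_carrier m" "par_act y" "free_grading m l"
    using par_act_structure[OF y] by (simp add: free_structure_def)
  have Sy: "par_act y s v = (\<lambda>i. s * v i)" and Sz: "par_act z s v = (\<lambda>i. s * v i)"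
    if "s \<in> S" "v \<in> free_carrier m" for s v
    using par_act_structure[OF y] par_act_structure[OF z] that by (simp_all add: free_structure_def)
  obtain f where f: "f \<in> LinearCombinations.module_hom ring_of_type_algebra (par_module y) (par_module z)"
    and bij: "bij_betw f (free_carrier m) (free_carrier m)"
    and gr: "\<And>q. f ` free_grading m l q = free_grading m l q"
    using iso unfolding graded_iso_def by auto
  have f_in: "f v \<in> free_carrier m" if "v \<in> free_carrier m" for v using bij that by (auto simp: bij_betw_def)
  have f_add: "f (v + w) = f v + f w" if "v \<in> free_carrier m" "w \<in> free_carrier m" for v w
    using LinearCombinations.module_hom_add[OF f, of v w] that by simp
  have f_act: "f (par_act y r v) = par_act z r (f v)" if "v \<in> free_carrier m" for r v
    using LinearCombinations.module_hom_smult[OF f, of r v] that by simp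
  define P where "P i j = f (unit_vec i) j" for i j
  have fP: "f v = vec_mat m P v" if v: "v \<in> free_carrier m" for v
    unfolding P_def
  proof (rule S_linear_vec_mat[OF _ _ _ v])
    fix s w assume sw: "s \<in> S" "w \<in> free_carrier m"
    show "f (\<lambda>i. s * w i) = (\<lambda>i. s * f w i)"
      using f_act[OF sw(2), of s] Sy[OF sw] Sz[OF sw(1) f_in[OF sw(2)]] by simp
  next
    fix v w assume "v \<in> free_carrier m" "w \<in> free_carrier m"
    then show "f (v + w) = f v + f w" by (rule f_add)
  next
    fix v assume "v \<in> free_carrier m"
    then show "f v \<in> free_carrier m" by (rule f_in)
  qed
  have P_in: "P i j \<in> S \<and> P i j \<in> Rg (l j - l i)" if "i < m" "j < m" for i j
  proof -
    have "f (unit_vec i) \<in> free_grading m l (- l i)" using gr[of "- l i"] unit_vec_in(2)[OF that(1)] by blast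
    then show ?thesis using that(2) unfolding P_def free_grading_def free_carrier_def by simp
  qed
  define \<phi> where "\<phi> = (\<lambda>(i, j, u). homog_coord (l j - l i) u (P i j))"
  have \<phi>P: "hom_mat \<phi> i j = P i j" if "i < m" "j < m" for i j
    unfolding hom_mat_def \<phi>_def using homog_coord_sum P_in[OF that] by simp
  have "hom_defect \<phi> y z a i h = 0" if ih: "a < n" "i < m" "h < m" for a i h
  proof -
    note u = unit_vec_in(1)[OF ih(2)]
    have "f (par_act y (b a) (unit_vec i)) h = vec_mat m P (vec_mat m (act_mat y (b a)) (unit_vec i)) h"
      using fP[OF Y.act_closed[OF u]] by (simp add: par_act_def)
    also have "\<dots> = (\<Sum>j<m. act_mat y (b a) i j * P j h)"
      unfolding vec_mat_vec_mat by (rule vec_mat_unit[OF ih(2,3)])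
    finally have 1: "f (par_act y (b a) (unit_vec i)) h = (\<Sum>j<m. act_mat y (b a) i j * P j h)" .
    have "f (par_act y (b a) (unit_vec i)) h = vec_mat m (act_mat z (b a)) (vec_mat m P (unit_vec i)) h"
      using f_act[OF u, of "b a"] fP[OF u] by (simp add: par_act_def)
    also have "\<dots> = (\<Sum>j<m. P i j * act_mat z (b a) j h)"
      unfolding vec_mat_vec_mat by (rule vec_mat_unit[OF ih(2,3)])
    finally show ?thesis unfolding hom_defect_def using 1 \<phi>P ih act_mat_basis[OF ih(1)] by simp
  qed
  moreover have "hom_det \<phi> \<noteq> 0"
  proof -
    \<comment> \<open>Preimages of the unit vectors are the rows of a left inverse matrix, so the
      determinant divides 1.\<close>
    have "\<exists>w\<in>free_carrier m. f w = unit_vec j" if "j < m" for j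
      using bij unit_vec_in(1)[OF that] unfolding bij_betw_def by (metis imageE)
    then obtain w where w: "\<And>j. j < m \<Longrightarrow> w j \<in> free_carrier m \<and> f (w j) = unit_vec j" by metis
    let ?A = "mat m m (\<lambda>(i, j). hom_mat \<phi> i j)" and ?B = "mat m m (\<lambda>(i, j). w i j)"
    have "?B * ?A = 1\<^sub>m m"
    proof (rule eq_matI)
      fix i h assume "i < dim_row (1\<^sub>m m)" "h < dim_col (1\<^sub>m m)"
      then have ih: "i < m" "h < m" by simp_all
      have "(?B * ?A) $$ (i, h) = (\<Sum>j<m. w i j * P j h)"
        using ih \<phi>P by (auto simp: scalar_prod_def atLeast0LessThan intro!: sum.cong)
      also have "\<dots> = vec_mat m P (w i) h" using ih by (simp add: vec_mat_def)
      also have "\<dots> = unit_vec i h" using fP[of "w i"] w[OF ih(1)] by simp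
      also have "\<dots> = 1\<^sub>m m $$ (i, h)" using ih by (auto simp: unit_vec_def)
      finally show "(?B * ?A) $$ (i, h) = 1\<^sub>m m $$ (i, h)" .
    qed auto
    then have "Determinant.det ?B * Determinant.det ?A = 1"
      using det_mult[of ?B m ?A] by simp
    then show ?thesis unfolding hom_det_def by auto
  qed
  ultimately show ?thesis by blast
qed

lemma hom_mat_rpolyfun:
  assumes "\<And>\<kappa>. \<kappa> \<in> hom_index \<Longrightarrow> \<psi> \<kappa> \<in> polyfun J" "i < m" "j < m"
  shows "(\<lambda>y. hom_mat (\<lambda>\<kappa>. \<psi> \<kappa> y) i j) \<in> rpolyfun J"
  unfolding hom_mat_def using assms by (intro rpolyfun_sum rpolyfun_base) (auto simp: hom_index_def)

lemma hom_det_rpolyfun: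
  assumes "\<And>\<kappa>. \<kappa> \<in> hom_index \<Longrightarrow> \<psi> \<kappa> \<in> polyfun J"
  shows "(\<lambda>y. hom_det (\<lambda>\<kappa>. \<psi> \<kappa> y)) \<in> rpolyfun J"
proof -
  have "hom_det \<phi> = (\<Sum>p | p permutes {0..<m}. signof p * (\<Prod>i = 0..<m. hom_mat \<phi> i (p i)))" for \<phi>
    unfolding hom_det_def by (subst det_def'[of _ m]) (auto intro!: sum.cong prod.cong)
  then show ?thesis
    by (simp, intro rpolyfun_sum rpolyfun_mult rpolyfun_const rpolyfun_prod hom_mat_rpolyfun assms)
      (auto dest: permutes_in_image)
qed

lemma hom_det_cong:
  assumes "\<And>\<kappa>. \<kappa> \<in> hom_index \<Longrightarrow> \<phi> \<kappa> = \<psi> \<kappa>"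
  shows "hom_det \<phi> = hom_det \<psi>"
proof -
  have "hom_mat \<phi> i j = hom_mat \<psi> i j" if "i < m" "j < m" for i j
    unfolding hom_mat_def using assms that by (intro sum.cong) (auto simp: hom_index_def)
  then show ?thesis unfolding hom_det_def by (intro arg_cong[of _ _ Determinant.det] cong_mat) auto
qed

end

section \<open>Finiteness for a fixed shape\<close>

lemma finite_iso_classesI:
  assumes F: "finite F" "\<And>M. M \<in> \<A> \<Longrightarrow> f M \<in> F"
    and E: "\<And>M M'. M \<in> \<A> \<Longrightarrow> M' \<in> \<A> \<Longrightarrow> f M = f M' \<Longrightarrow> E M M'"
    and trans: "\<And>M N P. E M N \<Longrightarrow> E N P \<Longrightarrow> E M P"
  shows "finite (iso_classes E \<A>)"
proof -
  let ?r = "{(x, y). x \<in> \<A> \<and> y \<in> \<A> \<and> E x y}"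
  define g where "g k = ?r `` {SOME M. M \<in> \<A> \<and> f M = k}" for k
  have "?r `` {M} = g (f M)" if M: "M \<in> \<A>" for M
  proof -
    define M' where "M' = (SOME M'. M' \<in> \<A> \<and> f M' = f M)"
    have M': "M' \<in> \<A> \<and> f M' = f M" unfolding M'_def by (rule someI[of _ M]) (use M in simp)
    have "E M M'" "E M' M" using E M M' by auto
    then have "?r `` {M} = ?r `` {M'}" using M M' trans by blast
    then show ?thesis by (simp add: g_def M'_def)
  qed
  then have "iso_classes E \<A> \<subseteq> g ` F" unfolding iso_classes_def quotient_def using F(2) by auto
  then show ?thesis using F(1) finite_surj by blast
qed

lemma graded_iso_cong_act:
  assumes "\<And>r v. v \<in> A \<Longrightarrow> act r v = act' r v"
  shows "graded_iso K (mk_gmodule A act G) (mk_gmodule A act' G)"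
  unfolding graded_iso_def LinearCombinations.module_hom_def using assms
  by (intro bexI[of _ "\<lambda>x. x"]) (auto simp: bij_betw_def)

text \<open>The parametrization reduces modules with carriers in an arbitrary type to structures on
  one carrier, where the keys of \<open>rank_key\<close> apply. The covering theorem is then used
  for the orbits of one chosen structure per key.\<close>

lemma finite_classes_of_shape:
  fixes \<iota> :: "'k::alg_closed_field \<Rightarrow> 'r::comm_ring_1" and \<A> :: "('r, 'm) gmodule set"
  assumes unc: "uncountable (UNIV :: 'k set)" and cm: "graded_cm \<iota> Rg S n b d"
    and cnt: "graded_countable_CM_type Rg S"
    and \<A>: "\<And>M. M \<in> \<A> \<Longrightarrow> graded_module ring_of_type_algebra Rg M \<and>
      graded_iso (subring_of S) M (graded_free_module Rg S m l)"
  shows "finite (iso_classes (graded_iso ring_of_type_algebra) \<A>)"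
proof -
  interpret graded_cm \<iota> Rg S n b d by (rule cm)
  interpret free_parameters \<iota> Rg S n b d m l by unfold_locales
  let ?iso = "graded_iso ring_of_type_algebra"
  have pmod: "graded_module ring_of_type_algebra Rg (par_module c)" if "is_structure c" for c
    using par_act_structure[OF that] by (intro typed_gmodule.graded_module_mk) (simp add: free_structure_def)
  have to_par: "\<exists>c. is_structure c \<and> ?iso M (par_module c)" if M: "M \<in> \<A>" for M
  proof -
    obtain act where act: "free_structure m l act"
      "?iso M (mk_gmodule (free_carrier m) act (free_grading m l))"
      using free_structure_of_iso \<A>[OF M] by blast
    obtain c where c: "is_structure c" "\<And>r v. v \<in> free_carrier m \<Longrightarrow> act r v = par_act c r v"
      using structure_par[OF act(1)] by blast
    have "?iso (mk_gmodule (free_carrier m) act (free_grading m l)) (par_module c)"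
      by (rule graded_iso_cong_act) (rule c(2))
    then show ?thesis using c(1) graded_iso_trans[OF act(2)] by blast
  qed
  show ?thesis
  proof (cases "\<exists>c. is_structure c")
    case False
    then have "\<A> = {}" using to_par by blast
    then show ?thesis by (simp add: iso_classes_def quotient_def)
  next
    case True
    then obtain c0 where c0: "is_structure c0" by blast
    define T where "T c = (free_carrier m, par_act c, free_grading m l)" for c
    have rank: "rank_le m (T c)" if c: "is_structure c" for c
    proof -
      have "homog_basis S (free_carrier m) (par_act c) (free_grading m l) {..<m} unit_vec l"
        by (rule free_structure_basis[OF par_act_structure[OF c]])
      moreover have "card {..<m} \<le> m" by simp
      moreover have "typed_gmodule Rg (free_carrier m) (par_act c) (free_grading m l)"
        using par_act_structure[OF c] by (simp add: free_structure_def)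
      ultimately show ?thesis unfolding rank_le_def T_def by blast
    qed
    obtain \<kappa> :: "_ \<Rightarrow> nat" where \<kappa>: "\<forall>A act G A' act' G'. rank_le m (A, act, G) \<and> rank_le m (A', act', G') \<and>
        \<kappa> (A, act, G) = \<kappa> (A', act', G') \<longrightarrow> ?iso (mk_gmodule A act G) (mk_gmodule A' act' G')"
      using rank_key[OF cnt, of m] by (rule exE)
    have \<kappa>_iso: "?iso (par_module c) (par_module c')"
      if "is_structure c" "is_structure c'" "\<kappa> (T c) = \<kappa> (T c')" for c c'
      using \<kappa>[rule_format, of "free_carrier m" "par_act c" "free_grading m l" "free_carrier m" "par_act c'" "free_grading m l"]
        rank[OF that(1)] rank[OF that(2)] that(3) unfolding T_def by simp
    \<comment> \<open>A structure with key k, and c0 when no structure has key k. The default keeps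
      \<open>zc k\<close> a structure for all k, so that the orbits can be indexed by all natural
      numbers.\<close>
    define zc where "zc k = (if \<exists>c. is_structure c \<and> \<kappa> (T c) = k
      then SOME c. is_structure c \<and> \<kappa> (T c) = k else c0)" for k
    have zc: "is_structure (zc k)" for k
    proof (cases "\<exists>c. is_structure c \<and> \<kappa> (T c) = k")
      case True
      then show ?thesis using someI_ex[OF True] by (simp add: zc_def)
    next
      case False
      show ?thesis unfolding zc_def if_not_P[OF False] by (rule c0)
    qed
    have zc_\<kappa>: "\<kappa> (T (zc (\<kappa> (T c)))) = \<kappa> (T c)" if "is_structure c" for c
    proof -
      have ex: "\<exists>c'. is_structure c' \<and> \<kappa> (T c') = \<kappa> (T c)" using that by blast
      then show ?thesis using someI_ex[OF ex] by (simp add: zc_def)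
    qed
    define Ob where "Ob k = {y. \<exists>\<phi>. (\<forall>r\<in>hom_rows (zc k). (\<Sum>\<kappa>\<in>hom_index. r \<kappa> y * \<phi> \<kappa>) = 0) \<and>
      unit_form (hom_det \<phi>) \<noteq> 0}" for k
    \<comment> \<open>At structures \<open>Ob k\<close> is the isomorphism class of
      \<open>zc k\<close>; at other parameters it is merely the set where the same linear conditions
      have a solution of nonzero determinant.\<close>
    have Ob: "y \<in> Ob k \<longleftrightarrow> ?iso (par_module y) (par_module (zc k))" if y: "is_structure y" for y k
      unfolding Ob_def mem_Collect_eq hom_rows_iff unit_form_hom_det
      using par_iso_of_hom[OF y zc] hom_of_par_iso[OF y zc] by blast
    have "\<exists>N. \<forall>y. (\<forall>f\<in>structure_eqs. f y = 0) \<longrightarrow> (\<exists>k<N. y \<in> Ob k)"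
    proof (rule countable_cover_finite[where \<delta> = "\<lambda>\<phi>. unit_form (hom_det \<phi>)" and K = hom_index
          and L = "\<lambda>k. hom_rows (zc k)" and J = par_index])
      show "\<And>k. Ob k = {y. \<exists>\<phi>. (\<forall>r\<in>hom_rows (zc k). (\<Sum>\<kappa>\<in>hom_index. r \<kappa> y * \<phi> \<kappa>) = 0) \<and>
        unit_form (hom_det \<phi>) \<noteq> 0}" by (rule Ob_def)
      fix y assume "\<forall>f\<in>structure_eqs. f y = 0"
      then have y: "is_structure y" unfolding structure_eqs_iff .
      have "?iso (par_module y) (par_module (zc (\<kappa> (T y))))"
        by (rule \<kappa>_iso[OF y zc zc_\<kappa>[OF y, symmetric]])
      then show "\<exists>k. y \<in> Ob k" using Ob[OF y] by blast
    next
      fix \<phi> \<psi> :: "nat \<times> nat \<times> 'r \<Rightarrow> 'k" assume "\<And>\<kappa>. \<kappa> \<in> hom_index \<Longrightarrow> \<phi> \<kappa> = \<psi> \<kappa>"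
      then show "unit_form (hom_det \<phi>) = unit_form (hom_det \<psi>)" using hom_det_cong by metis
    next
      fix \<psi> :: "nat \<times> nat \<times> 'r \<Rightarrow> (nat \<times> nat \<times> nat \<times> 'r \<Rightarrow> 'k) \<Rightarrow> 'k"
      assume \<psi>: "\<And>\<kappa>. \<kappa> \<in> hom_index \<Longrightarrow> \<psi> \<kappa> \<in> polyfun par_index"
      show "(\<lambda>y. unit_form (hom_det (\<lambda>\<kappa>. \<psi> \<kappa> y))) \<in> polyfun par_index"
        by (rule rpolyfun_linear[OF hom_det_rpolyfun[OF \<psi>] unit_form(1)])
    next
      show "\<And>k r \<kappa>. r \<in> hom_rows (zc k) \<Longrightarrow> \<kappa> \<in> hom_index \<Longrightarrow> r \<kappa> \<in> polyfun par_index"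
        by (rule hom_rows_polyfun)
    qed (fact unc par_index_countable hom_index_finite structure_eqs_polyfun hom_rows_finite)+
    then obtain N where "\<forall>y. (\<forall>f\<in>structure_eqs. f y = 0) \<longrightarrow> (\<exists>k<N. y \<in> Ob k)" by (rule exE)
    then have N: "\<exists>k<N. y \<in> Ob k" if "is_structure y" for y using that by (simp add: structure_eqs_iff)
    have ex: "\<exists>k<N. ?iso M (par_module (zc k))" if M: "M \<in> \<A>" for M
    proof -
      obtain y where y: "is_structure y" "?iso M (par_module y)" using to_par[OF M] by blast
      obtain k where "k < N" "y \<in> Ob k" using N[OF y(1)] by blast
      then show ?thesis using Ob[OF y(1)] graded_iso_trans[OF y(2)] by blast
    qed
    define f where "f M = (SOME k. k < N \<and> ?iso M (par_module (zc k)))" for M :: "('r, 'm) gmodule"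
    have f: "f M < N \<and> ?iso M (par_module (zc (f M)))" if M: "M \<in> \<A>" for M
      unfolding f_def by (rule someI_ex) (use ex[OF M] in blast)
    show ?thesis
    proof (rule finite_iso_classesI[where f = f and F = "{..<N}"])
      fix M M' assume M: "M \<in> \<A>" "M' \<in> \<A>" "f M = f M'"
      have "?iso (par_module (zc (f M'))) M'"
        by (rule graded_module_sym[of Rg, OF conjunct1[OF \<A>[OF M(2)]] conjunct2[OF f[OF M(2)]]])
      moreover have "?iso M (par_module (zc (f M')))" using f[OF M(1)] unfolding M(3) by (rule conjunct2)
      ultimately show "?iso M M'" by (rule graded_iso_trans[rotated])
    next
      fix M N P :: "('r, 'm) gmodule" assume "?iso M N" "?iso N P"
      then show "?iso M P" by (rule graded_iso_trans)
    next
      fix M assume "M \<in> \<A>"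
      then show "f M \<in> {..<N}" using f by simp
    qed simp
  qed
qed

section \<open>The setting derived from the hypotheses on R and S\<close>

lemma graded_module_self:
  assumes "graded_mcm Rg S (self_module Rg)"
  shows "graded_module ring_of_type_algebra Rg (self_module Rg)"
  using assms by (simp add: graded_mcm_def)

text \<open>The basis of R consists of the preimages of the unit vectors. As the transported
  structure makes f linear over R, \<open>f (c i * b i)\<close> is the action of \<open>c i\<close>
  on the i-th unit vector, and the basis property is pulled back.\<close>

lemma (in graded_setup) graded_cm_of_mcm:
  assumes mcm: "graded_mcm Rg S (self_module Rg)"
  shows "\<exists>n b d. graded_cm \<iota> Rg S n b d"
proof -
  obtain n l where iso: "graded_iso (subring_of S) (self_module Rg) (graded_free_module Rg S n l)"
    using mcm by (auto simp: graded_mcm_def)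
  obtain act where act: "free_structure n l act"
    and isoR: "graded_iso ring_of_type_algebra (self_module Rg) (mk_gmodule (free_carrier n) act (free_grading n l))"
    using free_structure_of_iso[OF graded_module_self[OF mcm] iso] by blast
  interpret M: typed_gmodule Rg "free_carrier n" act "free_grading n l"
    using act by (simp add: free_structure_def)
  have self: "carrier (self_module Rg) = UNIV" "hcomp (self_module Rg) = Rg"
    "x \<oplus>\<^bsub>self_module Rg\<^esub> y = x + y" "x \<odot>\<^bsub>self_module Rg\<^esub> y = x * y" for x y
    by (simp_all add: self_module_def)
  obtain f where f: "f \<in> LinearCombinations.module_hom ring_of_type_algebra (self_module Rg)
      (mk_gmodule (free_carrier n) act (free_grading n l))" "bij_betw f UNIV (free_carrier n)"
    "\<And>j. f ` Rg j = free_grading n l j"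
    using isoR unfolding graded_iso_def self mk_gmodule_simps by blast
  have f_add: "f (r + s) = f r + f s" for r s
    using LinearCombinations.module_hom_add[OF f(1), of r s] by (simp add: self)
  have f_act: "f (r * s) = act r (f s)" for r s
    using LinearCombinations.module_hom_smult[OF f(1), of r s] by (simp add: self)
  have f_inj: "r = s" if "f r = f s" for r s using f(2) that by (auto simp: bij_betw_def inj_on_def)
  have f_sum: "f (sum g I) = (\<Sum>i\<in>I. f (g i))" for g :: "nat \<Rightarrow> 'r" and I
    using additive_sum[of UNIV f I g] f_add by simp
  have f0: "f 0 = 0" using f_add[of 0 0] by simp
  have "\<exists>r\<in>Rg (- l i). f r = unit_vec i" if "i < n" for i
    using unit_vec_in(2)[OF that, of l] f(3)[of "- l i"] by (metis imageE)
  then obtain b where b: "\<And>i. i < n \<Longrightarrow> b i \<in> Rg (- l i) \<and> f (b i) = unit_vec i" by metis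
  note basis = free_structure_basis[OF act]
  have fb: "f (\<Sum>i<n. c i * b i) = (\<Sum>i<n. act (c i) (unit_vec i))" for c
    unfolding f_sum f_act using b by (intro sum.cong) auto
  have "homog_basis S UNIV (*) Rg {..<n} b l"
    unfolding homog_basis_def
  proof (intro conjI allI ballI impI)
    fix r :: 'r
    have "f r \<in> free_carrier n" using f(2) by (auto simp: bij_betw_def)
    then obtain c where c: "\<forall>i\<in>{..<n}. c i \<in> S" "f r = (\<Sum>i<n. act (c i) (unit_vec i))"
      using homog_basisD(3)[OF basis] by blast
    have "r = (\<Sum>i<n. c i * b i)" by (rule f_inj) (simp add: fb c(2))
    then show "\<exists>c. (\<forall>i\<in>{..<n}. c i \<in> S) \<and> r = (\<Sum>i<n. c i * b i)" using c(1) by blast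
  next
    fix c i assume c: "(\<forall>i\<in>{..<n}. c i \<in> S) \<and> (\<Sum>i<n. c i * b i) = 0" and i: "i \<in> {..<n}"
    have "(\<Sum>i<n. act (c i) (unit_vec i)) = 0" using fb[of c] c f0 by simp
    then show "c i = 0" using homog_basisD(4)[OF basis, of c i] c i by simp
  qed (use b in auto)
  then have "graded_cm \<iota> Rg S n b (\<lambda>a. - l a)" by unfold_locales simp
  then show ?thesis by blast
qed

text \<open>Elements of S are k-combinations of monomials \<open>mon e\<close>, each homogeneous of
  the weighted degree \<open>deg e\<close>. Taking a homogeneous component therefore amounts to
  selecting monomials and does not leave S.\<close>

lemma graded_setup_of_normalization:
  fixes \<iota> :: "'k::field \<Rightarrow> 'r::comm_ring_1"
  assumes alg: "graded_algebra \<iota> Rg" and nn: "graded_noether_normalization \<iota> Rg S"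
  shows "graded_setup \<iota> Rg S"
proof -
  have \<iota>: "\<iota> (a + c) = \<iota> a + \<iota> c" "\<iota> (a * c) = \<iota> a * \<iota> c" "\<iota> 1 = 1" for a c
    using alg unfolding graded_algebra_def Ring.ring_hom_def by simp_all
  have Rg: "direct_grading UNIV Rg"
  proof -
    have "abelian_group (ring_of_type_algebra :: 'r ring)"
      using ring_from_type_algebra by (rule ring.is_abelian_group)
    then show ?thesis using alg is_grading_iff[of "ring_of_type_algebra :: 'r ring" Rg]
      by (simp add: graded_algebra_def)
  qed
  have mult: "r * s \<in> Rg (i + j)" if "r \<in> Rg i" "s \<in> Rg j" for r s i j
    using alg that by (simp add: graded_algebra_def)
  have neg: "Rg i = {0}" if "i < 0" for i using alg that by (simp add: graded_algebra_def)
  have zero: "Rg 0 = range \<iota>" using alg by (simp add: graded_algebra_def)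
  have \<iota>0: "\<iota> 0 = 0" using \<iota>(1)[of 0 0] by simp
  have \<iota>_sum: "\<iota> (sum f I) = (\<Sum>i\<in>I. \<iota> (f i))" for f :: "(nat \<Rightarrow>\<^sub>0 nat) \<Rightarrow> 'k" and I
    by (induction I rule: infinite_finite_induct) (auto simp: \<iota>0 \<iota>(1))
  have \<iota>_neg: "\<iota> (- a) = - \<iota> a" for a using \<iota>(1)[of a "- a"] \<iota>0 by (simp add: eq_neg_iff_add_eq_0 add.commute)
  have one: "1 \<in> Rg 0" using zero \<iota>(3) by (metis rangeI)
  obtain n y where y: "\<forall>j<n. \<exists>d>0. y j \<in> Rg d" and S: "S = poly_eval \<iota> y ` polys n"
    using nn unfolding graded_noether_normalization_def by blast
  obtain dy where dy: "\<And>j. j < n \<Longrightarrow> dy j > 0 \<and> y j \<in> Rg (dy j)" using y by metis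
  define mon where "mon e = (\<Prod>j<n. y j ^ Poly_Mapping.lookup e j)" for e :: "nat \<Rightarrow>\<^sub>0 nat"
  define deg where "deg e = (\<Sum>j<n. int (Poly_Mapping.lookup e j) * dy j)" for e :: "nat \<Rightarrow>\<^sub>0 nat"
  define EE where "EE = {e :: nat \<Rightarrow>\<^sub>0 nat. Poly_Mapping.keys e \<subseteq> {..<n}}"
  have mon_eq: "(\<Prod>j\<in>Poly_Mapping.keys e. y j ^ Poly_Mapping.lookup e j) = mon e" if "e \<in> EE" for e
    unfolding mon_def using that
    by (intro prod.mono_neutral_left) (auto simp: EE_def in_keys_iff)
  have mon_add: "mon (e + e') = mon e * mon e'" for e e'
    by (simp add: mon_def lookup_add power_add prod.distrib)
  have EE_add: "e + e' \<in> EE" if "e \<in> EE" "e' \<in> EE" for e e'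
    using that keys_add[of e e'] unfolding EE_def by blast
  have pow: "y j ^ k \<in> Rg (int k * dy j)" if "j < n" for j k
  proof (induction k)
    case 0 then show ?case using one by simp
  next
    case (Suc k)
    have "dy j + int k * dy j = int (Suc k) * dy j" by (simp add: algebra_simps)
    then show ?case using mult[OF _ Suc, of "y j" "dy j"] dy[OF that] by simp
  qed
  have mon_Rg: "mon e \<in> Rg (deg e)" for e
  proof -
    have "(\<Prod>j\<in>I. y j ^ Poly_Mapping.lookup e j) \<in> Rg (\<Sum>j\<in>I. int (Poly_Mapping.lookup e j) * dy j)"
      if "I \<subseteq> {..<n}" for I
      using finite_subset[OF that finite_lessThan] that
    proof (induction I rule: finite_induct)
      case empty then show ?case using one by simp
    next
      case (insert j I)
      then show ?case using mult[OF pow] by simp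
    qed
    then show ?thesis unfolding mon_def deg_def by blast
  qed
  have term_Rg: "\<iota> c * mon e \<in> Rg (deg e)" for c e
    using mult[of "\<iota> c" 0 "mon e" "deg e"] mon_Rg zero by simp
  have S_rep: "\<exists>K c. finite K \<and> K \<subseteq> EE \<and> s = (\<Sum>e\<in>K. \<iota> (c e) * mon e)" if s: "s \<in> S" for s
  proof -
    obtain p where p: "p \<in> polys n" "s = poly_eval \<iota> y p" using s S by blast
    have K: "Poly_Mapping.keys p \<subseteq> EE" using p(1) by (auto simp: polys_def EE_def)
    have "s = (\<Sum>e\<in>Poly_Mapping.keys p. \<iota> (Poly_Mapping.lookup p e) * mon e)"
      unfolding p(2) poly_eval_def using mon_eq K by (intro sum.cong) auto
    then show ?thesis using K finite_keys by blast
  qed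
  have S_in: "(\<Sum>e\<in>K. \<iota> (c e) * mon e) \<in> S" if K: "finite K" "K \<subseteq> EE" for K c
  proof -
    define p where "p = (\<Sum>e\<in>K. Poly_Mapping.single e (c e))"
    have lk: "Poly_Mapping.lookup p e = (if e \<in> K then c e else 0)" for e
      unfolding p_def lookup_sum lookup_single using K(1) by (simp add: when_def)
    have keys: "Poly_Mapping.keys p \<subseteq> K" by (auto simp: in_keys_iff lk split: if_splits)
    have "poly_eval \<iota> y p = (\<Sum>e\<in>Poly_Mapping.keys p. \<iota> (c e) * mon e)"
      unfolding poly_eval_def using keys K(2) mon_eq by (intro sum.cong) (auto simp: lk)
    also have "\<dots> = (\<Sum>e\<in>K. \<iota> (c e) * mon e)"
      using K(1) keys by (intro sum.mono_neutral_left) (auto simp: in_keys_iff lk \<iota>0)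
    finally have "(\<Sum>e\<in>K. \<iota> (c e) * mon e) = poly_eval \<iota> y p" by simp
    moreover have "p \<in> polys n" using keys K(2) by (auto simp: polys_def EE_def)
    ultimately show ?thesis unfolding S by blast
  qed
  have S_diff: "r - s \<in> S" if rs: "r \<in> S" "s \<in> S" for r s
  proof -
    obtain K c where K: "finite K" "K \<subseteq> EE" "r = (\<Sum>e\<in>K. \<iota> (c e) * mon e)" using S_rep[OF rs(1)] by blast
    obtain L g where L: "finite L" "L \<subseteq> EE" "s = (\<Sum>e\<in>L. \<iota> (g e) * mon e)" using S_rep[OF rs(2)] by blast
    let ?c = "\<lambda>e. if e \<in> K then c e else 0" and ?g = "\<lambda>e. if e \<in> L then g e else 0"
    have "r = (\<Sum>e\<in>K \<union> L. \<iota> (?c e) * mon e)"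
      unfolding K(3) using K(1) L(1) by (intro sum.mono_neutral_cong_left) (auto simp: \<iota>0)
    moreover have "s = (\<Sum>e\<in>K \<union> L. \<iota> (?g e) * mon e)"
      unfolding L(3) using K(1) L(1) by (intro sum.mono_neutral_cong_left) (auto simp: \<iota>0)
    ultimately have "r - s = (\<Sum>e\<in>K \<union> L. \<iota> (?c e) * mon e - \<iota> (?g e) * mon e)"
      by (simp only: sum_subtractf)
    also have "\<dots> = (\<Sum>e\<in>K \<union> L. \<iota> (?c e + - ?g e) * mon e)"
      unfolding \<iota>(1) \<iota>_neg by (simp only: left_diff_distrib[symmetric] add_uminus_conv_diff)
    finally show ?thesis using S_in[of "K \<union> L" "\<lambda>e. ?c e + - ?g e"] K L by simp
  qed
  have S_0: "0 \<in> S" using S_in[of "{}"] by simp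
  have S_add: "r + s \<in> S" if "r \<in> S" "s \<in> S" for r s using S_diff[OF that(1) S_diff[OF S_0 that(2)]] by simp
  have S_sum: "sum f I \<in> S" if "\<And>i. i \<in> I \<Longrightarrow> f i \<in> S" for f and I :: "'x set"
    using that by (induction I rule: infinite_finite_induct) (auto intro: S_0 S_add)
  have term_S: "\<iota> c * mon e \<in> S" if "e \<in> EE" for c e using S_in[of "{e}" "\<lambda>_. c"] that by simp
  have S_mult: "r * s \<in> S" if rs: "r \<in> S" "s \<in> S" for r s
  proof -
    obtain K c where K: "finite K" "K \<subseteq> EE" "r = (\<Sum>e\<in>K. \<iota> (c e) * mon e)" using S_rep[OF rs(1)] by blast
    obtain L g where L: "finite L" "L \<subseteq> EE" "s = (\<Sum>e\<in>L. \<iota> (g e) * mon e)" using S_rep[OF rs(2)] by blast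
    have "r * s = (\<Sum>e\<in>K. \<Sum>e'\<in>L. \<iota> (c e * g e') * mon (e + e'))"
      unfolding K(3) L(3) sum_product \<iota>(2) mon_add by (simp add: mult_ac)
    moreover have "\<iota> (c e * g e') * mon (e + e') \<in> S" if "e \<in> K" "e' \<in> L" for e e'
      using that K(2) L(2) by (intro term_S EE_add) auto
    ultimately show ?thesis by (simp add: S_sum)
  qed
  have \<iota>S: "\<iota> c \<in> S" for c using term_S[of 0 c] by (simp add: EE_def mon_def)
  have comp: "homog_comp Rg (\<Sum>e\<in>K. \<iota> (c e) * mon e) i = (\<Sum>e\<in>{e\<in>K. deg e = i}. \<iota> (c e) * mon e)"
    if K: "finite K" for K c i
  proof -
    have add: "homog_comp Rg (r + s) i = homog_comp Rg r i + homog_comp Rg s i" for r s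
      using homog_comp_diff[OF Rg, of "r + s" s i] by simp
    have "homog_comp Rg (\<Sum>e\<in>K. \<iota> (c e) * mon e) i = (\<Sum>e\<in>K. homog_comp Rg (\<iota> (c e) * mon e) i)"
      using additive_sum[of UNIV "\<lambda>r. homog_comp Rg r i" K "\<lambda>e. \<iota> (c e) * mon e"] add by simp
    also have "\<dots> = (\<Sum>e\<in>K. if deg e = i then \<iota> (c e) * mon e else 0)"
      using homog_comp_single[OF Rg term_Rg] by (intro sum.cong) auto
    also have "\<dots> = (\<Sum>e\<in>{e\<in>K. deg e = i}. \<iota> (c e) * mon e)"
      using K by (simp add: sum.inter_filter)
    finally show ?thesis .
  qed
  have S_homog: "homog_comp Rg s i \<in> S" if s: "s \<in> S" for s i
  proof -
    obtain K c where K: "finite K" "K \<subseteq> EE" "s = (\<Sum>e\<in>K. \<iota> (c e) * mon e)" using S_rep[OF s] by blast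
    show ?thesis unfolding K(3) comp[OF K(1)] using K by (intro S_in) auto
  qed
  have "\<exists>T. finite T \<and> T \<subseteq> S \<inter> Rg i \<and> (\<forall>s\<in>S \<inter> Rg i. \<exists>c. s = (\<Sum>t\<in>T. \<iota> (c t) * t))" for i
  proof -
    let ?E = "{e \<in> EE. deg e = i}"
    \<comment> \<open>All generators have positive degree, so each exponent is bounded by the total
      degree; hence only finitely many monomials have degree i.\<close>
    have "Poly_Mapping.lookup ` ?E \<subseteq> {f. \<forall>x. (x \<in> {..<n} \<longrightarrow> f x \<in> {..nat i}) \<and> (x \<notin> {..<n} \<longrightarrow> f x = 0)}"
    proof clarify
      fix e x assume e: "e \<in> EE" "i = deg e"
      have "Poly_Mapping.lookup e x \<le> nat (deg e)" if x: "x < n"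
      proof -
        have "int (Poly_Mapping.lookup e x) * 1 \<le> int (Poly_Mapping.lookup e x) * dy x"
          using dy[OF x] by (intro mult_left_mono) auto
        also have "\<dots> \<le> deg e"
          unfolding deg_def using x dy by (intro member_le_sum) (auto intro!: mult_nonneg_nonneg simp: less_imp_le)
        finally show ?thesis by simp
      qed
      moreover have "Poly_Mapping.lookup e x = 0" if "x \<notin> {..<n}"
        using e(1) that by (auto simp: EE_def in_keys_iff)
      ultimately show "(x \<in> {..<n} \<longrightarrow> Poly_Mapping.lookup e x \<in> {..nat (deg e)}) \<and>
          (x \<notin> {..<n} \<longrightarrow> Poly_Mapping.lookup e x = 0)" by simp
    qed
    then have "finite (Poly_Mapping.lookup ` ?E)"
      using finite_set_of_finite_funs[of "{..<n}" "{..nat i}" 0] finite_subset by blast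
    moreover have "inj_on Poly_Mapping.lookup ?E" by (simp add: inj_on_def Poly_Mapping.lookup_inject)
    ultimately have finE: "finite ?E" by (rule finite_imageD)
    have "\<exists>c. s = (\<Sum>t\<in>mon ` ?E. \<iota> (c t) * t)" if s: "s \<in> S \<inter> Rg i" for s
    proof -
      obtain K c where K: "finite K" "K \<subseteq> EE" "s = (\<Sum>e\<in>K. \<iota> (c e) * mon e)" using S_rep s by blast
      let ?K = "{e\<in>K. deg e = i}"
      have "s = homog_comp Rg s i" using homog_comp_single[OF Rg, of s i i] s by simp
      also have "\<dots> = (\<Sum>e\<in>?K. \<iota> (c e) * mon e)" unfolding K(3) by (rule comp[OF K(1)])
      \<comment> \<open>The spanning set consists of ring elements, so the coefficients of all
        exponents with the same value t are added.\<close>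
      also have "\<dots> = (\<Sum>t\<in>mon ` ?E. \<Sum>e\<in>{e \<in> ?K. mon e = t}. \<iota> (c e) * mon e)"
        using K finE by (intro sum.group[symmetric]) auto
      also have "\<dots> = (\<Sum>t\<in>mon ` ?E. \<iota> (\<Sum>e\<in>{e \<in> ?K. mon e = t}. c e) * t)"
        unfolding \<iota>_sum sum_distrib_right by (intro sum.cong) auto
      finally have eq: "s = (\<Sum>t\<in>mon ` ?E. \<iota> (\<Sum>e\<in>{e \<in> ?K. mon e = t}. c e) * t)" .
      show ?thesis by (rule exI[where x = "\<lambda>t. \<Sum>e\<in>{e \<in> ?K. mon e = t}. c e"]) (rule eq)
    qed
    moreover have "mon ` ?E \<subseteq> S \<inter> Rg i"
      using term_S[of _ 1] \<iota>(3) mon_Rg by auto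
    ultimately show ?thesis using finE by (intro exI[of _ "mon ` ?E"]) simp
  qed
  then show ?thesis
    using \<iota> Rg mult neg zero \<iota>S S_diff S_mult S_homog by unfold_locales
qed

section \<open>Hilbert series\<close>

text \<open>Here s stands for the Hilbert function of S. Its values 1 in degree 0 and 0 in negative
  degrees make the linear system for the counts triangular with 1 on the diagonal.\<close>

lemma shift_counts:
  fixes s :: "int \<Rightarrow> nat" and l l' :: "nat \<Rightarrow> int"
  assumes s: "s 0 = 1" "\<And>d. d < 0 \<Longrightarrow> s d = 0"
    and eq: "\<And>j. (\<Sum>i<m. s (j + l i)) = (\<Sum>i<m'. s (j + l' i))"
  shows "card {i\<in>{..<m}. l i = v} = card {i\<in>{..<m'}. l' i = v}"
proof -
  define W where "W = l ` {..<m} \<union> l' ` {..<m'}"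
  define c where "c w = card {i\<in>{..<m}. l i = w}" for w
  define c' where "c' w = card {i\<in>{..<m'}. l' i = w}" for w
  have W: "finite W" by (simp add: W_def)
  have grp: "(\<Sum>i<p. s (j + k i)) = (\<Sum>w\<in>W. card {i\<in>{..<p}. k i = w} * s (j + w))"
    if "k ` {..<p} \<subseteq> W" for p :: nat and k j
  proof -
    have "(\<Sum>i<p. s (j + k i)) = (\<Sum>w\<in>W. \<Sum>i\<in>{i\<in>{..<p}. k i = w}. s (j + k i))"
      using W that by (intro sum.group[symmetric]) auto
    also have "\<dots> = (\<Sum>w\<in>W. card {i\<in>{..<p}. k i = w} * s (j + w))" by (intro sum.cong) auto
    finally show ?thesis .
  qed
  have eqW: "(\<Sum>w\<in>W. c w * s (j + w)) = (\<Sum>w\<in>W. c' w * s (j + w))" for j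
    using eq[of j] grp[of l m j] grp[of l' m' j] by (simp add: W_def c_def c'_def)
  have "{w\<in>W. c w \<noteq> c' w} = {}"
  proof (rule ccontr)
    assume ne: "{w\<in>W. c w \<noteq> c' w} \<noteq> {}"
    \<comment> \<open>A generator of shift w sits in degree \<open>- w\<close>. In degree
      \<open>- x\<close> the shifts below x contribute nothing, those above x contribute equally on
      both sides, and the shift x contributes its count times \<open>s 0 = 1\<close>.\<close>
    define x where "x = Max {w\<in>W. c w \<noteq> c' w}"
    have x: "x \<in> W" "c x \<noteq> c' x" using Max_in[OF _ ne] W unfolding x_def by auto
    have "c w * s (- x + w) = c' w * s (- x + w)" if w: "w \<in> W - {x}" for w
    proof (cases "w < x")
      case True then show ?thesis using s(2)[of "- x + w"] by simp
    next
      case False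
      have "c w = c' w"
      proof (rule ccontr)
        assume "c w \<noteq> c' w"
        then have "w \<le> x" unfolding x_def using W w by (intro Max_ge) auto
        then show False using False w by auto
      qed
      then show ?thesis by simp
    qed
    then have "(\<Sum>w\<in>W - {x}. c w * s (- x + w)) = (\<Sum>w\<in>W - {x}. c' w * s (- x + w))" by (intro sum.cong) auto
    then have "c x * s (- x + x) = c' x * s (- x + x)"
      using eqW[of "- x"] sum.remove[OF W x(1), of "\<lambda>w. c w * s (- x + w)"]
        sum.remove[OF W x(1), of "\<lambda>w. c' w * s (- x + w)"] by linarith
    then show False using x(2) s(1) by simp
  qed
  moreover have "c v = 0 \<and> c' v = 0" if "v \<notin> W"
    using that by (auto simp: c_def c'_def W_def)
  ultimately show ?thesis unfolding c_def[symmetric] c'_def[symmetric] by (cases "v \<in> W") auto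
qed

text \<open>Bijections between the fibres over the single values v are glued to one permutation of
  generators that matches the shifts.\<close>

lemma fibrewise_bij:
  fixes l l' :: "nat \<Rightarrow> int"
  assumes "\<And>v. card {i\<in>{..<m}. l i = v} = card {i\<in>{..<m'}. l' i = v}"
  shows "\<exists>h. bij_betw h {..<m'} {..<m} \<and> (\<forall>i<m'. l (h i) = l' i)"
proof -
  have "\<exists>h. bij_betw h {i\<in>{..<m'}. l' i = v} {i\<in>{..<m}. l i = v}" for v
    using assms[of v] by (intro finite_same_card_bij) auto
  then obtain h where h: "\<And>v. bij_betw (h v) {i\<in>{..<m'}. l' i = v} {i\<in>{..<m}. l i = v}" by metis
  define g where "g i = h (l' i) i" for i
  have g: "g i < m" "l (g i) = l' i" if "i < m'" for i
  proof -
    have mem: "i \<in> {p\<in>{..<m'}. l' p = l' i}" using that by simp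
    from bspec[OF bij_betwE[OF h[of "l' i"]] mem] show "g i < m" "l (g i) = l' i" by (simp_all add: g_def)
  qed
  have "bij_betw g {..<m'} {..<m}"
  proof (rule bij_betwI')
    fix i p assume ip: "i \<in> {..<m'}" "p \<in> {..<m'}"
    show "(g i = g p) = (i = p)"
    proof
      assume eq: "g i = g p"
      then have lp: "l' i = l' p" using g(2) ip by (metis lessThan_iff)
      have "inj_on (h (l' p)) {i\<in>{..<m'}. l' i = l' p}" by (rule bij_betw_imp_inj_on[OF h])
      moreover have "h (l' p) i = h (l' p) p" using eq lp by (simp add: g_def)
      ultimately show "i = p" using ip lp by (auto dest: inj_onD)
    qed simp
  next
    fix i assume "i \<in> {..<m'}" then show "g i \<in> {..<m}" using g(1) by simp
  next
    fix p assume p: "p \<in> {..<m}"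
    then have "p \<in> {i\<in>{..<m}. l i = l p}" by simp
    then have "p \<in> h (l p) ` {i\<in>{..<m'}. l' i = l p}" using h[of "l p"] by (simp add: bij_betw_def)
    then obtain i where i: "i < m'" "l' i = l p" "p = h (l p) i" by blast
    have "p = g i" unfolding g_def i(2) by (rule i(3))
    then show "\<exists>i\<in>{..<m'}. p = g i" using i(1) by blast
  qed
  then show ?thesis using g(2) by blast
qed

lemma graded_iso_subring:
  "graded_iso ring_of_type_algebra M N \<Longrightarrow> graded_iso (subring_of S) M N"
  unfolding graded_iso_def LinearCombinations.module_hom_def by auto

section \<open>The Hilbert series of a graded free module\<close>

context graded_setup
begin

lemma homog_base_indep:
  "(\<Sum>u\<in>homog_base d. \<iota> (c u) * u) = 0 \<Longrightarrow> u \<in> homog_base d \<Longrightarrow> c u = 0"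
  using homog_coords[of d] unfolding homog_coords_def by blast

lemma homog_base_nonzero:
  assumes u: "u \<in> homog_base d"
  shows "u \<noteq> 0"
proof
  assume "u = 0"
  have "(\<Sum>x\<in>homog_base d. \<iota> (if x = u then 1 else 0) * x) = 0"
    using \<open>u = 0\<close> by (intro sum.neutral) (auto simp: iota_zero)
  from homog_base_indep[OF this u] show False by simp
qed

lemma card_homog_base_neg:
  assumes "d < 0"
  shows "card (homog_base d) = 0"
proof -
  have "u \<notin> homog_base d" for u
    using homog_base_nonzero[of u d] homog_base_in(2)[of u d] Rg_neg[OF assms] by auto
  then have "homog_base d = {}" by blast
  then show ?thesis by simp
qed

lemma card_homog_base_0: "card (homog_base 0) = 1"
proof -
  have "(\<Sum>u\<in>homog_base 0. \<iota> (homog_coord 0 u 1) * u) = 1" by (rule homog_coord_sum[OF S_1 one_Rg])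
  then have "homog_base 0 \<noteq> {}" by auto
  then obtain u where u: "u \<in> homog_base 0" by blast
  have "w = u" if w: "w \<in> homog_base 0" for w
  proof (rule ccontr)
    assume ne: "w \<noteq> u"
    obtain a where a: "u = \<iota> a" using homog_base_in(2)[OF u] Rg_0 by auto
    obtain b where b: "w = \<iota> b" using homog_base_in(2)[OF w] Rg_0 by auto
    \<comment> \<open>Two elements \<open>\<iota> a\<close> and \<open>\<iota> b\<close> of
      \<open>R_0 = k\<close> satisfy the linear relation with coefficients b and
      \<open>- a\<close>.\<close>
    define c where "c x = (if x = u then b else if x = w then - a else 0)" for x
    have "(\<Sum>x\<in>homog_base 0. \<iota> (c x) * x) = (\<Sum>x\<in>{u, w}. \<iota> (c x) * x)"
      using u w homog_base_fin by (intro sum.mono_neutral_right) (auto simp: c_def iota_zero)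
    also have "\<dots> = \<iota> b * \<iota> a + \<iota> (- a) * \<iota> b" using ne by (simp add: c_def a b)
    also have "\<dots> = 0" by (simp add: iota_uminus mult.commute)
    finally have "c u = 0" by (rule homog_base_indep) (rule u)
    then have "w = 0" using b iota_zero by (simp add: c_def)
    then show False using homog_base_nonzero[OF w] by simp
  qed
  then have "homog_base 0 = {u}" using u by blast
  then show ?thesis by simp
qed

text \<open>In degree j the free module has as k-basis the vectors with an element u of
  \<open>homog_base (j + l i)\<close> in position i and 0 elsewhere; their preimages form a basis of
  the component of M.\<close>

lemma hilbert_series_free:
  fixes M :: "('r, 'm) gmodule"
  assumes M: "graded_module ring_of_type_algebra Rg M"
    and iso: "graded_iso (subring_of S) M (graded_free_module Rg S m l)"
  shows "hilbert_series \<iota> M j = (\<Sum>i<m. card (homog_base (j + l i)))"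
proof -
  interpret M: Module.module ring_of_type_algebra M using M by (simp add: graded_module_def)
  obtain act where act: "free_structure m l act"
    and isoR: "graded_iso ring_of_type_algebra M (mk_gmodule (free_carrier m) act (free_grading m l))"
    using free_structure_of_iso[OF M iso] by blast
  obtain f where f: "f \<in> LinearCombinations.module_hom ring_of_type_algebra M
      (mk_gmodule (free_carrier m) act (free_grading m l))" "bij_betw f (carrier M) (free_carrier m)"
    "\<And>j. f ` hcomp M j = free_grading m l j"
    using isoR unfolding graded_iso_def mk_gmodule_simps by blast
  have f_add: "f (x \<oplus>\<^bsub>M\<^esub> y) = f x + f y" if "x \<in> carrier M" "y \<in> carrier M" for x y
    using LinearCombinations.module_hom_add[OF f(1) that] by simp
  have f_in: "f x \<in> free_carrier m" if "x \<in> carrier M" for x using f(2) that by (auto simp: bij_betw_def)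
  have f_smult: "f (\<iota> c \<odot>\<^bsub>M\<^esub> x) = (\<lambda>i. \<iota> c * f x i)" if "x \<in> carrier M" for c x
    using LinearCombinations.module_hom_smult[OF f(1) _ that, of "\<iota> c"] act f_in[OF that] iota_S
    by (simp add: free_structure_def)
  have f_inj: "x = y" if "x \<in> carrier M" "y \<in> carrier M" "f x = f y" for x y
    using f(2) that by (auto simp: bij_betw_def inj_on_def)
  have sub: "subgroup (hcomp M j) (add_monoid M)" using M by (simp add: graded_module_def is_grading_def)
  have hM: "x \<in> carrier M" if "x \<in> hcomp M j" for x using subgroup.subset[OF sub] that by auto
  have h_add: "x \<oplus>\<^bsub>M\<^esub> y \<in> hcomp M j" if "x \<in> hcomp M j" "y \<in> hcomp M j" for x y
    using subgroup.m_closed[OF sub that] by simp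
  have h_zero: "\<zero>\<^bsub>M\<^esub> \<in> hcomp M j" using subgroup.one_closed[OF sub] by simp
  have h_neg: "\<ominus>\<^bsub>M\<^esub> x \<in> hcomp M j" if "x \<in> hcomp M j" for x
    using subgroup.m_inv_closed[OF sub that] by (simp add: a_inv_def)
  have h_smult: "\<iota> c \<odot>\<^bsub>M\<^esub> x \<in> hcomp M j" if "x \<in> hcomp M j" for c x
  proof -
    have "\<iota> c \<odot>\<^bsub>M\<^esub> x \<in> hcomp M (0 + j)" using M that iota_Rg[of c] unfolding graded_module_def by blast
    then show ?thesis by simp
  qed
  define W where "W = \<lparr>carrier = hcomp M j, monoid.mult = monoid.mult M, one = \<one>\<^bsub>M\<^esub>,
        ring.zero = \<zero>\<^bsub>M\<^esub>, add = add M, module.smult = (\<lambda>c x. \<iota> c \<odot>\<^bsub>M\<^esub> x)\<rparr>"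
  have W_simps: "carrier W = hcomp M j" "\<zero>\<^bsub>W\<^esub> = \<zero>\<^bsub>M\<^esub>" "x \<oplus>\<^bsub>W\<^esub> y = x \<oplus>\<^bsub>M\<^esub> y" "c \<odot>\<^bsub>W\<^esub> x = \<iota> c \<odot>\<^bsub>M\<^esub> x" for x y c
    by (simp_all add: W_def)
  have "abelian_group W"
  proof (rule abelian_groupI, unfold W_simps)
    fix x assume "x \<in> hcomp M j"
    then show "\<exists>y\<in>hcomp M j. y \<oplus>\<^bsub>M\<^esub> x = \<zero>\<^bsub>M\<^esub>" using h_neg hM M.l_neg by (intro bexI[of _ "\<ominus>\<^bsub>M\<^esub> x"]) auto
  qed (use h_add h_zero hM M.a_assoc M.a_comm in auto)
  then have "Module.module (ring_of_type_algebra :: 'k ring) W"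
    using hM h_smult M.smult_l_distr M.smult_r_distr M.smult_assoc1 M.smult_one
    by (intro moduleI cring_from_type_algebra) (auto simp: W_simps iota_add iota_mult iota_one)
  then interpret W: vectorspace "ring_of_type_algebra :: 'k ring" W
    using field_from_type_algebra by (rule vectorspace.intro)
  have f_fin: "f (finsum W g I) = (\<Sum>v\<in>I. f (g v)) \<and> finsum W g I \<in> hcomp M j"
    if "finite I" "\<And>v. v \<in> I \<Longrightarrow> g v \<in> hcomp M j" for g and I :: "'m set"
    using that
  proof (induction I rule: finite_induct)
    case empty
    have "f \<zero>\<^bsub>M\<^esub> = 0" using f_add[OF M.zero_closed M.zero_closed] by simp
    then show ?case using h_zero by (simp add: W.finsum_empty W_simps)
  next
    case (insert v I)
    have "finsum W g (insert v I) = g v \<oplus>\<^bsub>W\<^esub> finsum W g I"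
      using insert by (intro W.finsum_insert) (auto simp: W_simps)
    then show ?case using insert f_add hM h_add by (simp add: W_simps)
  qed
  define P where "P = (SIGMA i:{..<m}. homog_base (j + l i))"
  define e :: "nat \<times> 'r \<Rightarrow> nat \<Rightarrow> 'r" where "e = (\<lambda>(i, u) h. if h = i then u else 0)"
  have P: "finite P" "card P = (\<Sum>i<m. card (homog_base (j + l i)))"
    unfolding P_def using homog_base_fin by (auto intro: finite_SigmaI)
  have e_in: "e p \<in> free_grading m l j" if "p \<in> P" for p
    using that homog_base_in by (auto simp: P_def e_def free_grading_def free_carrier_def S_0 Rg_zero)
  have "\<exists>x\<in>hcomp M j. f x = e p" if "p \<in> P" for p using e_in[OF that] f(3)[of j] by (metis imageE)
  then obtain x where x: "\<And>p. p \<in> P \<Longrightarrow> x p \<in> hcomp M j \<and> f (x p) = e p" by metis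
  \<comment> \<open>Basis elements u are nonzero, so position and entry can be recovered from the
    vector.\<close>
  have e_inj: "p = q" if pq: "p \<in> P" "q \<in> P" "e p = e q" for p q
  proof -
    obtain i u i' u' where p: "p = (i, u)" and q: "q = (i', u')" by (metis surj_pair)
    have "u \<noteq> 0" using pq(1) homog_base_nonzero by (auto simp: p P_def)
    moreover have "e p i = u" "e q i = (if i = i' then u' else 0)" by (simp_all add: p q e_def)
    ultimately show ?thesis using pq(3) p q by (auto split: if_splits)
  qed
  have inj: "inj_on x P" using x e_inj by (metis inj_onI)
  have A: "finite (x ` P)" "x ` P \<subseteq> carrier W" using P(1) x by (auto simp: W_simps)
  have lin: "f (W.lincomb a (x ` P)) h = (if h < m then \<Sum>u\<in>homog_base (j + l h). \<iota> (a (x (h, u))) * u else 0)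
      \<and> W.lincomb a (x ` P) \<in> hcomp M j" for a h
  proof -
    have "f (W.lincomb a (x ` P)) = (\<Sum>v\<in>x ` P. f (\<iota> (a v) \<odot>\<^bsub>M\<^esub> v)) \<and> W.lincomb a (x ` P) \<in> hcomp M j"
      unfolding W.lincomb_def W_simps using A x h_smult by (intro f_fin) auto
    moreover have "(\<Sum>v\<in>x ` P. f (\<iota> (a v) \<odot>\<^bsub>M\<^esub> v)) h = (\<Sum>p\<in>P. \<iota> (a (x p)) * e p h)"
      unfolding sum_fun_apply sum.reindex[OF inj] o_def using x hM by (intro sum.cong) (auto simp: f_smult)
    moreover have "(\<Sum>p\<in>P. \<iota> (a (x p)) * e p h) =
        (\<Sum>i<m. \<Sum>u\<in>homog_base (j + l i). \<iota> (a (x (i, u))) * e (i, u) h)"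
      unfolding P_def using homog_base_fin by (subst sum.Sigma) (auto intro!: sum.cong)
    moreover have "\<dots> = (\<Sum>i<m. if i = h then \<Sum>u\<in>homog_base (j + l h). \<iota> (a (x (h, u))) * u else 0)"
      by (intro sum.cong) (auto simp: e_def)
    ultimately show ?thesis by simp
  qed
  have "W.basis (x ` P)"
    unfolding W.basis_criterion[OF A]
  proof (intro allI impI)
    fix v assume "v \<in> carrier W"
    then have v: "v \<in> hcomp M j" by (simp add: W_simps)
    then have fv: "f v \<in> free_grading m l j" using f(3)[of j] by blast
    define q where "q = inv_into P x"
    have q: "q (x p) = p" if "p \<in> P" for p unfolding q_def using inj that by (rule inv_into_f_f)
    \<comment> \<open>The coordinates of the entries of \<open>f v\<close>; the restriction is there
      because the criterion asks for a unique extensional coefficient function.\<close>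
    define a where "a = restrict (\<lambda>w. homog_coord (j + l (fst (q w))) (snd (q w)) (f v (fst (q w)))) (x ` P)"
    have ax: "a (x (h, u)) = homog_coord (j + l h) u (f v h)" if "h < m" "u \<in> homog_base (j + l h)" for h u
    proof -
      have "(h, u) \<in> P" using that by (simp add: P_def)
      then show ?thesis using q[of "(h, u)"] by (simp add: a_def)
    qed
    have "f (W.lincomb a (x ` P)) = f v"
    proof
      fix h
      show "f (W.lincomb a (x ` P)) h = f v h"
      proof (cases "h < m")
        case True
        then have "f (W.lincomb a (x ` P)) h = (\<Sum>u\<in>homog_base (j + l h). \<iota> (homog_coord (j + l h) u (f v h)) * u)"
          using lin[of a h] ax by simp
        also have "\<dots> = f v h"
          using fv True by (intro homog_coord_sum) (auto simp: free_grading_def free_carrier_def)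
        finally show ?thesis .
      next
        case False
        then show ?thesis using lin[of a h] fv by (simp add: free_grading_def free_carrier_def)
      qed
    qed
    then have av: "W.lincomb a (x ` P) = v" using f_inj hM lin v by blast
    show "\<exists>!a. a \<in> x ` P \<rightarrow>\<^sub>E carrier ring_of_type_algebra \<and> W.lincomb a (x ` P) = v"
    proof (rule ex1I[of _ a])
      show "a \<in> x ` P \<rightarrow>\<^sub>E carrier ring_of_type_algebra \<and> W.lincomb a (x ` P) = v"
        using av by (auto simp: a_def)
      fix a' :: "'m \<Rightarrow> 'k" assume a': "a' \<in> x ` P \<rightarrow>\<^sub>E carrier ring_of_type_algebra \<and> W.lincomb a' (x ` P) = v"
      have "a' (x (h, u)) = a (x (h, u))" if hu: "h < m" "u \<in> homog_base (j + l h)" for h u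
      proof -
        have "(\<Sum>u\<in>homog_base (j + l h). \<iota> (a' (x (h, u)) + - a (x (h, u))) * u) =
            (\<Sum>u\<in>homog_base (j + l h). \<iota> (a' (x (h, u))) * u) - (\<Sum>u\<in>homog_base (j + l h). \<iota> (a (x (h, u))) * u)"
          by (simp only: iota_add iota_uminus distrib_right mult_minus_left sum.distrib sum_negf diff_conv_add_uminus)
        also have "\<dots> = f (W.lincomb a' (x ` P)) h - f (W.lincomb a (x ` P)) h"
          using lin[of a' h] lin[of a h] hu(1) by simp
        also have "W.lincomb a' (x ` P) = W.lincomb a (x ` P)" unfolding av using a' by (rule conjunct2)
        also have "f (W.lincomb a (x ` P)) h - f (W.lincomb a (x ` P)) h = 0" by (rule diff_self)
        finally have "a' (x (h, u)) + - a (x (h, u)) = 0" by (rule homog_base_indep) (rule hu(2))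
        then show ?thesis by simp
      qed
      then have eq: "a' (x p) = a (x p)" if "p \<in> P" for p using that unfolding P_def by (cases p) simp
      show "a' = a"
      proof (rule PiE_ext[OF conjunct1[OF a']])
        show "a \<in> x ` P \<rightarrow>\<^sub>E carrier ring_of_type_algebra" by (simp add: a_def)
        fix w assume "w \<in> x ` P"
        then show "a' w = a w" using eq by (elim imageE) simp
      qed
    qed
  qed
  then have "W.dim = card (x ` P)" by (rule W.dim_basis[OF A(1)])
  also have "\<dots> = card P" by (rule card_image[OF inj])
  finally show ?thesis unfolding hilbert_series_def W_def[symmetric] P(2) .
qed

lemma free_module_cong:
  assumes "\<And>i. i < m \<Longrightarrow> l i = l' i"
  shows "graded_free_module Rg S m l = graded_free_module Rg S m l'"
proof -
  have "{f \<in> {..<m} \<rightarrow>\<^sub>E S. \<forall>i<m. f i \<in> Rg (j + l i)} = {f \<in> {..<m} \<rightarrow>\<^sub>E S. \<forall>i<m. f i \<in> Rg (j + l' i)}" for j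
    using assms by auto
  then show ?thesis by (simp add: graded_free_module_def)
qed

text \<open>Equal series give equal numbers of generators in each degree, so the shifts of M and M'
  differ by a permutation, and permuting the basis of M turns its shape into that of M'.\<close>

lemma free_shape_of_hilbert_series:
  fixes M M' :: "('r, 'm) gmodule"
  assumes M: "graded_module ring_of_type_algebra Rg M" "graded_iso (subring_of S) M (graded_free_module Rg S m l)"
    and M': "graded_module ring_of_type_algebra Rg M'" "graded_iso (subring_of S) M' (graded_free_module Rg S m' l')"
    and eq: "hilbert_series \<iota> M = hilbert_series \<iota> M'"
  shows "graded_iso (subring_of S) M (graded_free_module Rg S m' l')"
proof -
  have "(\<Sum>i<m. card (homog_base (j + l i))) = (\<Sum>i<m'. card (homog_base (j + l' i)))" for j
    using hilbert_series_free[OF M, of j] hilbert_series_free[OF M', of j] eq by simp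
  then have "card {i\<in>{..<m}. l i = v} = card {i\<in>{..<m'}. l' i = v}" for v
    by (intro shift_counts[of "\<lambda>d. card (homog_base d)"] card_homog_base_0 card_homog_base_neg)
  then obtain h where h: "bij_betw h {..<m'} {..<m}" "\<forall>i<m'. l (h i) = l' i" using fibrewise_bij by blast
  obtain act where act: "free_structure m l act"
    "graded_iso ring_of_type_algebra M (mk_gmodule (free_carrier m) act (free_grading m l))"
    using free_structure_of_iso[OF M] by blast
  have "typed_gmodule Rg (free_carrier m) act (free_grading m l)" using act(1) by (simp add: free_structure_def)
  then have "graded_iso (subring_of S) (mk_gmodule (free_carrier m) act (free_grading m l))
      (graded_free_module Rg S m' (l \<circ> h))"
    by (rule free_iso_of_basis[OF _ homog_basis_reindex[OF free_structure_basis[OF act(1)] h(1)]])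
  also have "graded_free_module Rg S m' (l \<circ> h) = graded_free_module Rg S m' l'"
    using h(2) by (intro free_module_cong) simp
  finally show ?thesis using graded_iso_trans[OF graded_iso_subring[OF act(2)]] by blast
qed

end

theorem theorem1p2:
  fixes \<iota> :: "'k::{alg_closed_field, field_char_0} \<Rightarrow> 'r::comm_ring_1"
    and Rg :: "int \<Rightarrow> 'r set"
    and S :: "'r set"
  assumes "uncountable (UNIV :: 'k set)"
    and "graded_algebra \<iota> Rg"
    and "graded_noether_normalization \<iota> Rg S"
    and "graded_mcm Rg S (self_module Rg)"
    and "graded_countable_CM_type Rg S"
  shows "(\<forall>V :: ('k, 'v) gmodule. findim_graded_vectorspace V \<longrightarrow>
            finite (iso_classes (graded_iso ring_of_type_algebra)
              {M :: ('r, 'm) gmodule.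
                 graded_mcm Rg S M \<and> graded_iso (subring_of S) M (tensor_module \<iota> Rg S V)})) \<and>
         (\<forall>h :: int \<Rightarrow> nat.
            finite (iso_classes (graded_iso ring_of_type_algebra)
              {M :: ('r, 'm) gmodule. graded_mcm Rg S M \<and> hilbert_series \<iota> M = h}))"
proof -
  interpret graded_setup \<iota> Rg S by (rule graded_setup_of_normalization[OF assms(2,3)])
  obtain n b d where cm: "graded_cm \<iota> Rg S n b d" using graded_cm_of_mcm[OF assms(4)] by blast
  \<comment> \<open>A free shape of one member is a shape of all members, so the finiteness for a
    fixed shape applies; the empty family is set apart because it offers no shape.\<close>
  have finite_if: "finite (iso_classes (graded_iso ring_of_type_algebra) \<A>)"
    if mcm: "\<And>M. M \<in> \<A> \<Longrightarrow> graded_mcm Rg S M"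
      and same: "\<And>M M' m l. M \<in> \<A> \<Longrightarrow> M' \<in> \<A> \<Longrightarrow> graded_iso (subring_of S) M' (graded_free_module Rg S m l) \<Longrightarrow>
        graded_iso (subring_of S) M (graded_free_module Rg S m l)"
    for \<A> :: "('r, 'm) gmodule set"
  proof (cases "\<A> = {}")
    case True then show ?thesis by (simp add: iso_classes_def quotient_def)
  next
    case False
    then obtain M0 where M0: "M0 \<in> \<A>" by blast
    then obtain m l where "graded_iso (subring_of S) M0 (graded_free_module Rg S m l)"
      using mcm[OF M0] unfolding graded_mcm_def by blast
    then show ?thesis
      using same[OF _ M0] mcm
      by (intro finite_classes_of_shape[OF assms(1) cm assms(5), of _ m l]) (simp add: graded_mcm_def)
  qed
  show ?thesis
  proof (intro conjI allI impI)
    fix V :: "('k, 'v) gmodule"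
    show "finite (iso_classes (graded_iso ring_of_type_algebra)
        {M :: ('r, 'm) gmodule. graded_mcm Rg S M \<and> graded_iso (subring_of S) M (tensor_module \<iota> Rg S V)})"
    proof (rule finite_if)
      fix M M' :: "('r, 'm) gmodule" and m l
      assume M: "M \<in> {M. graded_mcm Rg S M \<and> graded_iso (subring_of S) M (tensor_module \<iota> Rg S V)}"
        and M': "M' \<in> {M. graded_mcm Rg S M \<and> graded_iso (subring_of S) M (tensor_module \<iota> Rg S V)}"
        and iso: "graded_iso (subring_of S) M' (graded_free_module Rg S m l)"
      have "graded_module ring_of_type_algebra Rg M'"
        using conjunct1[OF CollectD[OF M']] unfolding graded_mcm_def by (rule conjunct1)
      \<comment> \<open>Both modules are S-isomorphic to the tensor product. The isomorphism is
        reversed on the side of M', which is known to be a graded module, and the free shape then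
        passes from M' to M.\<close>
      from graded_module_sym[OF this conjunct2[OF CollectD[OF M']]]
      have "graded_iso (subring_of S) M M'" by (rule graded_iso_trans[OF conjunct2[OF CollectD[OF M]]])
      then show "graded_iso (subring_of S) M (graded_free_module Rg S m l)" using iso by (rule graded_iso_trans)
    qed (drule CollectD, erule conjunct1)
  next
    fix h :: "int \<Rightarrow> nat"
    show "finite (iso_classes (graded_iso ring_of_type_algebra)
        {M :: ('r, 'm) gmodule. graded_mcm Rg S M \<and> hilbert_series \<iota> M = h})"
    proof (rule finite_if)
      fix M M' :: "('r, 'm) gmodule" and m l
      assume M: "M \<in> {M. graded_mcm Rg S M \<and> hilbert_series \<iota> M = h}"
        and M': "M' \<in> {M. graded_mcm Rg S M \<and> hilbert_series \<iota> M = h}"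
        and iso: "graded_iso (subring_of S) M' (graded_free_module Rg S m l)"
      \<comment> \<open>M has a free shape of its own, a priori unrelated to that of M'; equality of
        the Hilbert series is what compares the two.\<close>
      obtain m0 l0 where iso0: "graded_iso (subring_of S) M (graded_free_module Rg S m0 l0)"
        using conjunct1[OF CollectD[OF M]] unfolding graded_mcm_def by blast
      have gM: "graded_module ring_of_type_algebra Rg M"
        using conjunct1[OF CollectD[OF M]] unfolding graded_mcm_def by (rule conjunct1)
      have gM': "graded_module ring_of_type_algebra Rg M'"
        using conjunct1[OF CollectD[OF M']] unfolding graded_mcm_def by (rule conjunct1)
      have "hilbert_series \<iota> M = hilbert_series \<iota> M'"
        by (rule trans[OF conjunct2[OF CollectD[OF M]] conjunct2[OF CollectD[OF M'], symmetric]])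
      then show "graded_iso (subring_of S) M (graded_free_module Rg S m l)"
        by (rule free_shape_of_hilbert_series[OF gM iso0 gM' iso])
    qed (drule CollectD, erule conjunct1)
  qed
qed

end
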